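(* Assume the 3SUM Conjecture. Then for every $\varepsilon>0$ there is no algorithm that, given two straight-line programs each of size $n=\Theta(N^{1/4})$ generating two $N$-dimensional vectors $u,v$, computes the inner product $u\cdot v=\sum_{i=1}^N u[i]v[i]$ in time $O(n^{2-\varepsilon})$.
   Context: A straight-line program (SLP), or grammar compression, over an alphabet $\Sigma$ (here the possible vector entries, e.g. $\{0,1\}$) is a sequence of rules $S_1,\dots,S_n$, where each rule is either $S_i\to \sigma$ for a symbol $\sigma\in\Sigma$ or $S_i\to S_jS_k$ with $j,k<i$ (concatenation of two earlier rules). Each $S_i$ generates a unique string; the SLP generates the string of its last rule. Its size is the number of rules $n$. An $N$-dimensional vector is identified with the length-$N$ string of its entries. The 3SUM problem: given three sets $A,B,C$ of $m$ integers in $\{1,\dots,U\}$, decide whether there are $a\in A,b\in B,c\in C$ with $a+b=c$. The 3SUM Conjecture: no algorithm (deterministic or randomized, succeeding with high probability) solves the 3SUM problem in time $O(m^{2-\varepsilon})$ for any $\varepsilon>0$. *)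

theory Defs
  imports "HOL-Probability.Probability"
begin

text \<open>
  Programs are structured and work on registers and finitely many arrays, both of which hold
  integers. Every executed instruction takes one time step. Integers are unbounded
  in the semantics; the restriction to words of logarithmically many bits is imposed on whole
  runs in \<open>solvable_in_time\<close> below.
\<close>

datatype arith_op = Add | Sub | Mul | Div | Mod | And | Or | Xor | Shl | Shr

fun eval_op :: "arith_op \<Rightarrow> int \<Rightarrow> int \<Rightarrow> int" where
  "eval_op Add x y = x + y"
| "eval_op Sub x y = x - y"
| "eval_op Mul x y = x * y"
| "eval_op Div x y = x div y"
| "eval_op Mod x y = x mod y"
| "eval_op And x y = Bit_Operations.and x y"
| "eval_op Or x y = Bit_Operations.or x y"
| "eval_op Xor x y = Bit_Operations.xor x y"
| "eval_op Shl x y = push_bit (nat y) x"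
| "eval_op Shr x y = drop_bit (nat y) x"

datatype instr =
    Const nat int
  | Arith arith_op nat nat nat
  | Load nat nat nat
  | Store nat nat nat
  | Rand nat nat
  | Branch nat "instr list" "instr list"
  | Loop nat "instr list"

record state =
  regs :: "nat \<Rightarrow> int"
  arrs :: "nat \<Rightarrow> int \<Rightarrow> int"

definition set_reg :: "nat \<Rightarrow> int \<Rightarrow> state \<Rightarrow> state" where
  "set_reg d x s = s\<lparr>regs := (regs s)(d := x)\<rparr>"

definition set_arr :: "nat \<Rightarrow> int \<Rightarrow> int \<Rightarrow> state \<Rightarrow> state" where
  "set_arr a i x s = s\<lparr>arrs := (arrs s)(a := (arrs s a)(i := x))\<rparr>"

text \<open>
  A configuration consists of the instructions that remain to be executed and the state.
  \<open>Rand d r\<close> draws uniformly from \<open>{0..<k}\<close>, where \<open>k\<close> is the content of register \<open>r\<close>;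
  tests are for positivity.
\<close>

type_synonym config = "instr list \<times> state"

fun step :: "config \<Rightarrow> config pmf" where
  "step ([], s) = return_pmf ([], s)"
| "step (Const d x # p, s) = return_pmf (p, set_reg d x s)"
| "step (Arith f d r1 r2 # p, s) =
     return_pmf (p, set_reg d (eval_op f (regs s r1) (regs s r2)) s)"
| "step (Load d a r # p, s) = return_pmf (p, set_reg d (arrs s a (regs s r)) s)"
| "step (Store a r1 r2 # p, s) = return_pmf (p, set_arr a (regs s r1) (regs s r2) s)"
| "step (Rand d r # p, s) =
     (if regs s r > 0
      then map_pmf (\<lambda>x. (p, set_reg d x s)) (pmf_of_set {0..<regs s r})
      else return_pmf (p, set_reg d 0 s))"
| "step (Branch r q1 q2 # p, s) = return_pmf ((if regs s r > 0 then q1 else q2) @ p, s)"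
| "step (Loop r q # p, s) = return_pmf (if regs s r > 0 then q @ Loop r q # p else p, s)"

primrec run :: "nat \<Rightarrow> config \<Rightarrow> config pmf" where
  "run 0 c = return_pmf c"
| "run (Suc t) c = bind_pmf (step c) (run t)"

definition halts_within :: "nat \<Rightarrow> instr list \<Rightarrow> state \<Rightarrow> bool" where
  "halts_within T p s \<longleftrightarrow> (\<forall>c \<in> set_pmf (run T (p, s)). fst c = [])"

definition words_bounded :: "real \<Rightarrow> instr list \<Rightarrow> state \<Rightarrow> bool" where
  "words_bounded B p s \<longleftrightarrow>
     (\<forall>t. \<forall>c \<in> set_pmf (run t (p, s)).
        (\<forall>r. \<bar>real_of_int (regs (snd c) r)\<bar> \<le> B) \<and>
        (\<forall>a i. \<bar>real_of_int (arrs (snd c) a i)\<bar> \<le> B))"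

definition success_prob :: "nat \<Rightarrow> instr list \<Rightarrow> state \<Rightarrow> int \<Rightarrow> real" where
  "success_prob T p s out = measure_pmf.prob (run T (p, s)) {c. fst c = [] \<and> regs (snd c) 0 = out}"

definition array_of_list :: "int list \<Rightarrow> int \<Rightarrow> int" where
  "array_of_list xs i = (if 0 \<le> i \<and> i < int (length xs) then xs ! nat i else 0)"

definition initial_state :: "int list \<Rightarrow> int list list \<Rightarrow> state" where
  "initial_state ns xss =
     \<lparr>regs = (\<lambda>r. if r < length ns then ns ! r else 0),
      arrs = (\<lambda>a. if a < length xss then array_of_list (xss ! a) else (\<lambda>_. 0))\<rparr>"

text \<open>
  For a problem with instances \<open>X\<close>, where \<open>sz\<close> measures the size of an instance, \<open>mag\<close> bounds the
  numbers occurring in it, \<open>inp\<close> is its encoding and \<open>ans\<close> its answer, \<open>solvable_in_time\<close> says that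
  some program, on every instance and for every outcome of its random choices, halts within
  \<open>O(f sz)\<close> steps and uses only words of \<open>O(log mag)\<close> bits (all values are polynomially bounded
  in \<open>mag\<close>), and that it succeeds with high probability: its error probability
  is at most \<open>O(sz powr - c)\<close> for some constant \<open>c > 0\<close>. Deterministic programs are the special case
  without \<open>Rand\<close>.
\<close>

definition solvable_in_time ::
  "'x set \<Rightarrow> ('x \<Rightarrow> nat) \<Rightarrow> ('x \<Rightarrow> nat) \<Rightarrow> ('x \<Rightarrow> state) \<Rightarrow> ('x \<Rightarrow> int) \<Rightarrow> (nat \<Rightarrow> real) \<Rightarrow> bool"
where
  "solvable_in_time X sz mag inp ans f \<longleftrightarrow>
     (\<exists>(p :: instr list) (K :: real) (d :: nat) (c :: real). c > 0 \<and>
        (\<forall>x\<in>X. let T = nat \<lfloor>K * f (sz x)\<rfloor> in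
           halts_within T p (inp x) \<and>
           words_bounded (K * real (mag x) ^ d) p (inp x) \<and>
           success_prob T p (inp x) (ans x) \<ge> 1 - K * real (sz x) powr (- c)))"


text \<open>An instance \<open>(U, A, B, C)\<close> lists each of the three sets without repetition, in any order.\<close>

type_synonym three_sum_inst = "nat \<times> nat list \<times> nat list \<times> nat list"

definition three_sum_instances :: "three_sum_inst set" where
  "three_sum_instances =
     {(U, A, B, C). A \<noteq> [] \<and> length B = length A \<and> length C = length A \<and>
        distinct A \<and> distinct B \<and> distinct C \<and>
        set A \<subseteq> {1..U} \<and> set B \<subseteq> {1..U} \<and> set C \<subseteq> {1..U}}"

fun three_sum_size :: "three_sum_inst \<Rightarrow> nat" where
  "three_sum_size (U, A, B, C) = length A"

fun three_sum_universe :: "three_sum_inst \<Rightarrow> nat" where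
  "three_sum_universe (U, A, B, C) = U"

fun three_sum_input :: "three_sum_inst \<Rightarrow> state" where
  "three_sum_input (U, A, B, C) =
     initial_state [int (length A), int U] [map int A, map int B, map int C]"

fun three_sum_answer :: "three_sum_inst \<Rightarrow> int" where
  "three_sum_answer (U, A, B, C) =
     (if \<exists>a\<in>set A. \<exists>b\<in>set B. \<exists>c\<in>set C. a + b = c then 1 else 0)"

definition three_sum_conjecture :: bool where
  "three_sum_conjecture \<longleftrightarrow>
     (\<forall>\<epsilon>>0. \<not> solvable_in_time three_sum_instances three_sum_size three_sum_universe
        three_sum_input three_sum_answer (\<lambda>m. real m powr (2 - \<epsilon>)))"


text \<open>Rules are numbered from 0, so rule \<open>i\<close> of \<open>S\<close> is \<open>S ! i\<close>.\<close>

datatype 'a rule = Terminal 'a | Concat nat nat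

definition is_slp :: "'a set \<Rightarrow> 'a rule list \<Rightarrow> bool" where
  "is_slp \<Sigma> S \<longleftrightarrow> S \<noteq> [] \<and>
     (\<forall>i<length S. case S ! i of Terminal a \<Rightarrow> a \<in> \<Sigma> | Concat j k \<Rightarrow> j < i \<and> k < i)"

fun rule_string :: "'a list list \<Rightarrow> 'a rule \<Rightarrow> 'a list" where
  "rule_string ws (Terminal a) = [a]"
| "rule_string ws (Concat j k) = ws ! j @ ws ! k"

definition slp_strings :: "'a rule list \<Rightarrow> 'a list list" where
  "slp_strings S = foldl (\<lambda>ws r. ws @ [rule_string ws r]) [] S"

definition slp_string :: "'a rule list \<Rightarrow> 'a list" where
  "slp_string S = last (slp_strings S)"


definition inner_product :: "int list \<Rightarrow> int list \<Rightarrow> int" where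
  "inner_product u v = (\<Sum>i<length u. u ! i * v ! i)"

type_synonym ip_inst = "int rule list \<times> int rule list"

text \<open>The constants \<open>c1\<close> and \<open>c2\<close> are those of the promise \<open>n = \<Theta>(N powr (1/4))\<close>.\<close>

definition ip_instances :: "int set \<Rightarrow> real \<Rightarrow> real \<Rightarrow> ip_inst set" where
  "ip_instances \<Sigma> c1 c2 =
     {(S, T). is_slp \<Sigma> S \<and> is_slp \<Sigma> T \<and> length S = length T \<and>
        length (slp_string S) = length (slp_string T) \<and>
        c1 * real (length (slp_string S)) powr (1/4) \<le> real (length S) \<and>
        real (length S) \<le> c2 * real (length (slp_string S)) powr (1/4)}"

fun ip_size :: "ip_inst \<Rightarrow> nat" where
  "ip_size (S, T) = length S"

fun ip_dim :: "ip_inst \<Rightarrow> nat" where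
  "ip_dim (S, T) = length (slp_string S)"

text \<open>A program is stored in three arrays: the kind of each rule and its at most two arguments.\<close>

fun rule_kind :: "int rule \<Rightarrow> int" where
  "rule_kind (Terminal a) = 0"
| "rule_kind (Concat j k) = 1"

fun rule_arg1 :: "int rule \<Rightarrow> int" where
  "rule_arg1 (Terminal a) = a"
| "rule_arg1 (Concat j k) = int j"

fun rule_arg2 :: "int rule \<Rightarrow> int" where
  "rule_arg2 (Terminal a) = 0"
| "rule_arg2 (Concat j k) = int k"

fun ip_input :: "ip_inst \<Rightarrow> state" where
  "ip_input (S, T) = initial_state [int (length S)]
     [map rule_kind S, map rule_arg1 S, map rule_arg2 S,
      map rule_kind T, map rule_arg1 T, map rule_arg2 T]"

fun ip_answer :: "ip_inst \<Rightarrow> int" where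
  "ip_answer (S, T) = inner_product (slp_string S) (slp_string T)"

end

theory Submission
  imports Defs "HOL-Real_Asymp.Real_Asymp"
begin

text \<open>
  A 3SUM instance is hashed by the almost linear map \<open>h x = (r x mod U R) div U\<close>, where \<open>r\<close> is random
  and \<open>R = m powr (3 + 1 / k)\<close> up to constants: \<open>a + b = c\<close> forces
  \<open>h a + h b + e = h c + f R\<close> for some \<open>e, f \<in> {0, 1}\<close>, while a fixed triple with \<open>a + b \<noteq> c\<close>
  satisfies such an equation with probability at most \<open>10 / R\<close>, so that all \<open>m ^ 3\<close> triples together
  err with probability \<open>O(m powr (- 1 / k))\<close>. The vector \<open>u\<close> is a concatenation of \<open>m\<close> blocks, one for
  each \<open>a\<close>, namely the indicator vector of the numbers \<open>h b\<close> and \<open>h b + 1\<close> shifted by \<open>h a\<close>; \<open>v\<close> is the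
  concatenation of \<open>m\<close> copies of the unshifted indicator vector of the numbers \<open>h c\<close> and \<open>h c + R\<close>. The inner
  product is positive iff some triple collides. The dimension is about \<open>m R\<close>, that is
  \<open>m powr (4 + 1 / k)\<close>, and \<open>O(m log m)\<close> rules suffice: the indicator vector of a set is a
  perfect binary tree into which the elements are inserted one after the other by copying a path, and a
  shift by \<open>y\<close> appends or prepends \<open>2 ^ i\<close> zeros for each bit \<open>i\<close> of \<open>y\<close>. Unused rules pad the size to
  the fourth root of the dimension, and an algorithm with running time \<open>n powr (2 - \<epsilon>)\<close> for inner products
  would solve 3SUM in time \<open>m powr (2 - \<epsilon> / 2)\<close> if \<open>1 / k \<le> \<epsilon> \<le> 1\<close>.
\<close>

section \<open>Deterministic and random runs\<close>

text \<open>The slack \<open>1 / k\<close> in the exponent of \<open>R\<close> does two jobs. It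
  makes the union bound over all triples work in a single round, so that no candidate triple is ever
  verified, and it lifts the fourth root of the dimension from \<open>m\<close> to
  \<open>m powr (1 + 1 / (4 * k))\<close>, which leaves room for the \<open>m log m\<close> rules.
  The constant \<open>c0\<close> in the depth makes this true for every \<open>m > 0\<close>, small
  ones included. The promise allows any \<open>c1 < c2\<close>, however close. Hence the size is the
  least \<open>n\<close> with \<open>P * N \<le> D * n ^ 4\<close>, where \<open>P / D\<close> is a
  rational between \<open>c1 ^ 4\<close> and the fourth power of the midpoint of \<open>c1\<close>
  and \<open>c2\<close>; rounding up to an integer uses the other half of the gap. Time and words
  are constrained for every random outcome, while success is averaged. The reduction therefore makes
  one draw between two deterministic stretches. The universe \<open>U\<close> may be far larger than
  \<open>m\<close>: it enters only the word size, whereas the dimension depends on \<open>m\<close>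
  alone.\<close>

lemma regs_set_reg [simp]: "regs (set_reg d x s) r = (if r = d then x else regs s r)"
  by (simp add: set_reg_def)

lemma arrs_set_reg [simp]: "arrs (set_reg d x s) = arrs s"
  by (simp add: set_reg_def)

lemma regs_set_arr [simp]: "regs (set_arr a i x s) = regs s"
  by (simp add: set_arr_def)

lemma arrs_set_arr [simp]:
  "arrs (set_arr a i x s) b = (if b = a then (arrs s a)(i := x) else arrs s b)"
  by (simp add: set_arr_def)

definition bounded_by :: "int \<Rightarrow> state \<Rightarrow> bool" where
  "bounded_by M s \<longleftrightarrow> (\<forall>r. \<bar>regs s r\<bar> \<le> M) \<and> (\<forall>a i. \<bar>arrs s a i\<bar> \<le> M)"

lemma bounded_by_set_reg: "bounded_by M s \<Longrightarrow> \<bar>x\<bar> \<le> M \<Longrightarrow> bounded_by M (set_reg d x s)"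
  by (auto simp: bounded_by_def)

section \<open>Weakest preconditions with time and word bounds\<close>

primrec det_steps :: "int \<Rightarrow> nat \<Rightarrow> config \<Rightarrow> config \<Rightarrow> bool" where
  "det_steps M 0 c c' \<longleftrightarrow> c = c' \<and> bounded_by M (snd c)"
| "det_steps M (Suc t) c c' \<longleftrightarrow>
     bounded_by M (snd c) \<and> (\<exists>c1. step c = return_pmf c1 \<and> det_steps M t c1 c')"

lemma det_steps_trans:
  "det_steps M t c c' \<Longrightarrow> det_steps M u c' c'' \<Longrightarrow> det_steps M (t + u) c c''"
  by (induction t arbitrary: c) auto

lemma det_steps_bounded: "det_steps M t c c' \<Longrightarrow> bounded_by M (snd c')"
  by (induction t arbitrary: c) auto

text \<open>The continuation \<open>q\<close> is universally quantified, so that programs compose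
  under \<open>Loop\<close> and append. The bound on \<open>s\<close> sits inside the definition:
  \<open>Load\<close> and \<open>Store\<close> only move values of a bounded state and so have no
  side condition. \<open>T\<close> is an upper bound, as branches differ in length.\<close>

definition wp :: "int \<Rightarrow> instr list \<Rightarrow> nat \<Rightarrow> (state \<Rightarrow> bool) \<Rightarrow> state \<Rightarrow> bool" where
  "wp M p T Q s \<longleftrightarrow>
     (bounded_by M s \<longrightarrow> (\<forall>q. \<exists>t\<le>T. \<exists>s'. det_steps M t (p @ q, s) (q, s') \<and> Q s'))"

lemma wp_mono:
  assumes "wp M p T Q s" "T \<le> T'" "\<And>s. Q s \<Longrightarrow> Q' s"
  shows "wp M p T' Q' s"
  using assms unfolding wp_def by (meson order_trans)

lemma wp_append:
  assumes "wp M p T1 R s" "\<And>s. R s \<Longrightarrow> wp M q T2 Q s" "T1 + T2 \<le> T"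
  shows "wp M (p @ q) T Q s"
  unfolding wp_def
proof (intro impI allI)
  fix q' assume b: "bounded_by M s"
  then obtain t s' where t: "t \<le> T1" "det_steps M t (p @ q @ q', s) (q @ q', s')" "R s'"
    using assms(1) unfolding wp_def by blast
  from det_steps_bounded[OF t(2)] have "bounded_by M s'" by simp
  with assms(2)[OF t(3)] obtain u s'' where
    u: "u \<le> T2" "det_steps M u (q @ q', s') (q', s'')" "Q s''"
    unfolding wp_def by blast
  have "t + u \<le> T" using t u assms(3) by simp
  then show "\<exists>t\<le>T. \<exists>s'. det_steps M t ((p @ q) @ q', s) (q', s') \<and> Q s'"
    using det_steps_trans[OF t(2) u(2)] u(3) by auto
qed

lemma wp_Nil: "Q s \<Longrightarrow> wp M [] T Q s"
  unfolding wp_def by (auto intro!: exI[of _ 0])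

lemma wp_step:
  assumes "\<And>q. bounded_by M s \<Longrightarrow> step (i # p @ q, s) = return_pmf (p' @ q, s')"
    and "bounded_by M s \<Longrightarrow> bounded_by M s'"
    and "0 < T" and "wp M p' (T - 1) Q s'"
  shows "wp M (i # p) T Q s"
  unfolding wp_def
proof (intro impI allI)
  fix q assume b: "bounded_by M s"
  then obtain t s'' where t: "t \<le> T - 1" "det_steps M t (p' @ q, s') (q, s'')" "Q s''"
    using assms(2,4) unfolding wp_def by blast
  then show "\<exists>t\<le>T. \<exists>s'. det_steps M t ((i # p) @ q, s) (q, s') \<and> Q s'"
    using b assms(1)[OF b, of q] \<open>0 < T\<close> by (intro exI[of _ "Suc t"]) auto
qed

lemma wp_Const:
  assumes "0 < T" "\<bar>x\<bar> \<le> M" "wp M p (T - 1) Q (set_reg d x s)"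
  shows "wp M (Const d x # p) T Q s"
  by (rule wp_step[OF _ _ assms(1,3)]) (use assms(2) bounded_by_set_reg in auto)

lemma wp_Arith:
  assumes "0 < T" "\<bar>eval_op f (regs s r1) (regs s r2)\<bar> \<le> M"
    and "wp M p (T - 1) Q (set_reg d (eval_op f (regs s r1) (regs s r2)) s)"
  shows "wp M (Arith f d r1 r2 # p) T Q s"
  by (rule wp_step[OF _ _ assms(1,3)]) (use assms(2) bounded_by_set_reg in auto)

lemma wp_Load:
  assumes "0 < T" "wp M p (T - 1) Q (set_reg d (arrs s a (regs s r)) s)"
  shows "wp M (Load d a r # p) T Q s"
  by (rule wp_step[OF _ _ assms]) (auto simp: bounded_by_def)

lemma wp_Store:
  assumes "0 < T" "wp M p (T - 1) Q (set_arr a (regs s r1) (regs s r2) s)"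
  shows "wp M (Store a r1 r2 # p) T Q s"
  by (rule wp_step[OF _ _ assms]) (auto simp: bounded_by_def)

lemma wp_Branch:
  assumes "0 < T" "regs s r > 0 \<Longrightarrow> wp M (q1 @ p) (T - 1) Q s"
    and "\<not> regs s r > 0 \<Longrightarrow> wp M (q2 @ p) (T - 1) Q s"
  shows "wp M (Branch r q1 q2 # p) T Q s"
proof (rule wp_step[OF _ _ assms(1)])
  show "wp M ((if regs s r > 0 then q1 else q2) @ p) (T - 1) Q s" using assms by auto
qed auto

lemma wp_Loop_unfold:
  assumes "0 < T" "wp M (if regs s r > 0 then q @ Loop r q # p else p) (T - 1) Q s"
  shows "wp M (Loop r q # p) T Q s"
  by (rule wp_step[OF _ _ assms]) auto

text \<open>The index of the invariant is the number of iterations that remain.\<close>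

lemma wp_Loop:
  assumes I: "I k s"
    and body: "\<And>k s. I (Suc k) s \<Longrightarrow> regs s r > 0 \<and> wp M q Tq (I k) s"
    and stop: "\<And>s. I 0 s \<Longrightarrow> \<not> regs s r > 0"
    and cont: "\<And>s. I 0 s \<Longrightarrow> wp M p Tp Q s"
    and T: "k * (Tq + 1) + 1 + Tp \<le> T"
  shows "wp M (Loop r q # p) T Q s"
  using I T
proof (induction k arbitrary: s T)
  case 0
  then show ?case
    using stop[of s] cont[of s] by (intro wp_Loop_unfold) (auto intro: wp_mono)
next
  case (Suc k)
  have "wp M (q @ Loop r q # p) (T - 1) Q s"
  proof (rule wp_append)
    show "wp M q Tq (I k) s" using body[OF Suc.prems(1)] by simp
    show "wp M (Loop r q # p) (k * (Tq + 1) + 1 + Tp) Q s'" if "I k s'" for s'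
      using Suc.IH[OF that] by simp
    show "Tq + (k * (Tq + 1) + 1 + Tp) \<le> T - 1" using Suc.prems(2) by simp
  qed
  then show ?case using body[OF Suc.prems(1)] Suc.prems(2) by (intro wp_Loop_unfold) auto
qed

text \<open>As simplification rules, these equations let the simplifier normalise the state before it looks
  at the next instruction; backward chaining with the rules for \<open>wp\<close> would blow up the state
  exponentially.\<close>

fun vc1 :: "int \<Rightarrow> instr \<Rightarrow> (state \<Rightarrow> bool) \<Rightarrow> state \<Rightarrow> bool"
  and vc :: "int \<Rightarrow> instr list \<Rightarrow> (state \<Rightarrow> bool) \<Rightarrow> state \<Rightarrow> bool" where
  "vc1 M (Const d x) Q s \<longleftrightarrow> \<bar>x\<bar> \<le> M \<and> Q (set_reg d x s)"
| "vc1 M (Arith f d r1 r2) Q s \<longleftrightarrow>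
     \<bar>eval_op f (regs s r1) (regs s r2)\<bar> \<le> M \<and> Q (set_reg d (eval_op f (regs s r1) (regs s r2)) s)"
| "vc1 M (Load d a r) Q s \<longleftrightarrow> Q (set_reg d (arrs s a (regs s r)) s)"
| "vc1 M (Store a r1 r2) Q s \<longleftrightarrow> Q (set_arr a (regs s r1) (regs s r2) s)"
| "vc1 M (Rand d r) Q s \<longleftrightarrow> False"
| "vc1 M (Branch r q1 q2) Q s \<longleftrightarrow>
     (regs s r > 0 \<longrightarrow> vc M q1 Q s) \<and> (\<not> regs s r > 0 \<longrightarrow> vc M q2 Q s)"
| "vc1 M (Loop r q) Q s \<longleftrightarrow> False"
| "vc M [] Q s \<longleftrightarrow> Q s"
| "vc M (i # p) Q s \<longleftrightarrow> vc1 M i (vc M p Q) s"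

fun cost1 :: "instr \<Rightarrow> nat" and cost :: "instr list \<Rightarrow> nat" where
  "cost1 (Branch r q1 q2) = 1 + max (cost q1) (cost q2)"
| "cost1 _ = 1"
| "cost [] = 0"
| "cost (i # p) = cost1 i + cost p"

text \<open>Induction along the recursion of \<open>vc1\<close> and \<open>vc\<close>, with the code
  \<open>p\<close> that follows generalised, since a chosen branch runs in front of it;
  \<open>Branch\<close> is charged the maximum of its two sides.\<close>

lemma
  shows wp_vc1: "vc1 M i R s \<Longrightarrow> (\<And>s. R s \<Longrightarrow> wp M p T Q s) \<Longrightarrow> wp M (i # p) (cost1 i + T) Q s"
    and wp_vc: "vc M q R s \<Longrightarrow> (\<And>s. R s \<Longrightarrow> wp M p T Q s) \<Longrightarrow> wp M (q @ p) (cost q + T) Q s"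
proof (induction M i R s and M q R s arbitrary: p T and p T rule: vc1_vc.induct)
  case (6 M r q1 q2 R s)
  have "wp M (q1 @ p) (cost q1 + T) Q s" if "regs s r > 0"
    using 6 that by simp
  moreover have "wp M (q2 @ p) (cost q2 + T) Q s" if "\<not> regs s r > 0"
    using 6 that by simp
  ultimately show ?case
    by (intro wp_Branch) (auto elim!: wp_mono)
next
  case (9 M i q R s)
  have "wp M (i # q @ p) (cost1 i + (cost q + T)) Q s"
    using 9 by simp
  then show ?case by (simp add: add.assoc)
qed (auto intro: wp_Const wp_Arith wp_Load wp_Store)

lemma wp_straight:
  assumes "vc M p (\<lambda>s. wp M q T' Q s) s" "cost p + T' \<le> T"
  shows "wp M (p @ q) T Q s"
  by (rule wp_mono[OF wp_vc[OF assms(1)] assms(2)])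

lemma wp_straight_end: "vc M p Q s \<Longrightarrow> cost p \<le> T \<Longrightarrow> wp M p T Q s"
  using wp_mono[OF wp_vc[of M p Q s "[]" 0 Q] , of T Q] wp_Nil by simp

section \<open>Reachability and composition of probabilistic runs\<close>

inductive reach :: "config \<Rightarrow> config \<Rightarrow> bool" where
  reach_refl: "reach c c"
| reach_step: "c1 \<in> set_pmf (step c) \<Longrightarrow> reach c1 c2 \<Longrightarrow> reach c c2"

lemma reach_iff_run: "reach c c' \<longleftrightarrow> (\<exists>t. c' \<in> set_pmf (run t c))"
proof
  show "reach c c' \<Longrightarrow> \<exists>t. c' \<in> set_pmf (run t c)"
  proof (induction rule: reach.induct)
    case (reach_refl c)
    then show ?case by (intro exI[of _ 0]) simp
  next
    case (reach_step c1 c c2)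
    then obtain t where "c2 \<in> set_pmf (run t c1)" by blast
    with reach_step(1) show ?case by (intro exI[of _ "Suc t"]) (simp, blast)
  qed
  have "c' \<in> set_pmf (run t c) \<Longrightarrow> reach c c'" for t
    by (induction t arbitrary: c) (auto intro: reach.intros)
  then show "\<exists>t. c' \<in> set_pmf (run t c) \<Longrightarrow> reach c c'" by blast
qed

lemma words_bounded_iff:
  "words_bounded B p s \<longleftrightarrow>
     (\<forall>c. reach (p, s) c \<longrightarrow> (\<forall>r. \<bar>real_of_int (regs (snd c) r)\<bar> \<le> B) \<and>
        (\<forall>a i. \<bar>real_of_int (arrs (snd c) a i)\<bar> \<le> B))"
  unfolding words_bounded_def reach_iff_run by blast

lemma run_det_steps: "det_steps M t c c' \<Longrightarrow> run (t + u) c = run u c'"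
proof (induction t arbitrary: c)
  case (Suc t)
  then obtain c1 where c1: "step c = return_pmf c1" "det_steps M t c1 c'" by auto
  show ?case using Suc.IH[OF c1(2)] by (simp add: c1(1) bind_return_pmf)
qed simp

text \<open>A deterministic stretch has only one path: whatever is reachable from its start lies on
  it, where all states are bounded, or beyond its end.\<close>

lemma reach_det_steps:
  "det_steps M t c c' \<Longrightarrow> reach c c'' \<Longrightarrow> bounded_by M (snd c'') \<or> reach c' c''"
proof (induction t arbitrary: c)
  case (Suc t)
  then obtain c1 where c1: "step c = return_pmf c1" "det_steps M t c1 c'" "bounded_by M (snd c)"
    by auto
  from Suc.prems(2) show ?case
    by (cases rule: reach.cases) (use c1 Suc.IH[OF c1(2)] in auto)
qed simp

lemma run_Nil: "run t ([], s) = return_pmf ([], s)"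
  by (induction t) (auto simp: bind_return_pmf)

lemma step_append:
  "p \<noteq> [] \<Longrightarrow> step (p @ q, s) = map_pmf (\<lambda>(p', s'). (p' @ q, s')) (step (p, s))"
  by (cases "(p, s)" rule: step.cases) (auto simp: pmf.map_comp o_def)

lemma run_add_halted:
  assumes "halts_within t q s"
  shows "run (t + u) (q, s) = run t (q, s)"
  using assms
proof (induction t arbitrary: q s)
  case 0
  then show ?case by (simp add: halts_within_def run_Nil)
next
  case (Suc t)
  have "run (t + u) c = run t c" if "c \<in> set_pmf (step (q, s))" for c
    using Suc.prems that Suc.IH[of "fst c" "snd c"]
    by (auto simp: halts_within_def)
  then show ?case by (auto intro!: bind_pmf_cong)
qed

text \<open>The random outcomes of \<open>p\<close> may halt at different times. An outcome that is
  early starts \<open>q\<close> early, and \<open>run_add_halted\<close> absorbs the surplus; hence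
  \<open>q\<close> has to halt within \<open>u\<close> steps from every state.\<close>

lemma run_append:
  assumes "halts_within t p s"
    and "\<And>s. halts_within u q s"
  shows "run (t + u) (p @ q, s) = bind_pmf (run t (p, s)) (\<lambda>c. run u (q, snd c))"
  using assms(1)
proof (induction t arbitrary: p s)
  case 0
  then show ?case by (simp add: halts_within_def bind_return_pmf)
next
  case (Suc t)
  show ?case
  proof (cases "p = []")
    case True
    have "run (u + Suc t) (q, s) = run u (q, s)" by (rule run_add_halted[OF assms(2)])
    moreover have "run (Suc t) ([], s) = return_pmf ([], s)" by (rule run_Nil)
    ultimately show ?thesis using True by (simp add: bind_return_pmf add.commute del: run.simps)
  next
    case False
    have IH: "run (t + u) (fst c @ q, snd c) = bind_pmf (run t c) (\<lambda>c. run u (q, snd c))"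
      if "c \<in> set_pmf (step (p, s))" for c
      using Suc.prems that Suc.IH[of "fst c" "snd c"] by (auto simp: halts_within_def)
    show ?thesis using False IH
      by (auto simp: step_append bind_map_pmf bind_assoc_pmf split_beta intro!: bind_pmf_cong)
  qed
qed

lemma reach_append:
  assumes "reach (p @ q, s) c"
  shows "(\<exists>c'. reach (p, s) c' \<and> snd c = snd c') \<or>
    (\<exists>s'. reach (p, s) ([], s') \<and> reach (q, s') c)"
  using assms
proof (induction "(p @ q, s)" c arbitrary: p s rule: reach.induct)
  case reach_refl
  then show ?case by (auto intro: reach.intros)
next
  case (reach_step c1 c2)
  show ?case
  proof (cases "p = []")
    case True
    then show ?thesis using reach_step(1,2) by (auto intro: reach.intros)
  next
    case False
    then obtain c where c: "c \<in> set_pmf (step (p, s))" "c1 = (fst c @ q, snd c)"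
      using reach_step(1) by (auto simp: step_append)
    then show ?thesis using reach_step(3)[of "fst c" "snd c"] by (auto intro: reach.intros)
  qed
qed

section \<open>Randomised reductions\<close>

definition sign_prog :: "instr list" where
  "sign_prog = [Branch 0 [Const 0 1] [Const 0 0]]"

definition sign_state :: "state \<Rightarrow> state" where
  "sign_state s = set_reg 0 (if regs s 0 > 0 then 1 else 0) s"

lemma run_sign_prog: "run 2 (sign_prog, s) = return_pmf ([], sign_state s)"
  by (simp add: sign_prog_def sign_state_def numeral_2_eq_2 bind_return_pmf)

lemma reach_sign_prog:
  assumes "reach (sign_prog, s) c"
  shows "snd c = s \<or> snd c = sign_state s"
proof -
  have 0: "c = ([], s')" if "reach ([], s') c" for s'
    using that by (induction "([] :: instr list, s')" c rule: reach.induct) simp_all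
  have 1: "snd c = s \<or> snd c = set_reg 0 x s" if "reach ([Const 0 x], s) c" for x
    using that by (cases rule: reach.cases) (auto dest: 0)
  from assms show ?thesis
    by (cases rule: reach.cases) (auto simp: sign_prog_def sign_state_def dest!: 1 split: if_splits)
qed

lemma run_append_sign:
  assumes "halts_within t p s"
  shows "run (t + 2) (p @ sign_prog, s) = map_pmf (\<lambda>c. ([], sign_state (snd c))) (run t (p, s))"
  using assms by (subst run_append) (auto simp: halts_within_def run_sign_prog map_pmf_def)

lemma halts_append_sign:
  assumes "halts_within t p s"
  shows "halts_within (t + 2) (p @ sign_prog) s"
  unfolding halts_within_def run_append_sign[OF assms] by auto

lemma success_append_sign:
  assumes "halts_within t p s" "(if v > 0 then 1 else 0) = w"
  shows "success_prob t p s v \<le> success_prob (t + 2) (p @ sign_prog) s w"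
  unfolding success_prob_def run_append_sign[OF assms(1)] using assms(2)
  by (auto intro!: measure_pmf.finite_measure_mono simp: sign_state_def)

lemma prob_bind_pmf:
  "measure_pmf.prob (bind_pmf p f) X = measure_pmf.expectation p (\<lambda>x. measure_pmf.prob (f x) X)"
proof -
  have "measure_pmf.prob q X = pmf (map_pmf (\<lambda>c. c \<in> X) q) True" for q :: "'a pmf"
    by (simp add: pmf_map vimage_def)
  then show ?thesis by (simp add: map_bind_pmf pmf_bind)
qed

text \<open>A deterministic \<open>pre\<close>, one draw, a deterministic \<open>post\<close> and an
  arbitrary program \<open>p\<close>. \<open>good r\<close> is what \<open>post\<close> hands over
  to \<open>p\<close> for the draw \<open>r\<close>; the value \<open>v\<close> that
  \<open>p\<close> computes may depend on \<open>r\<close>, only its sign has to be right. Draws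
  outside \<open>bad\<close> contribute at least \<open>1 - \<delta>\<close> to the average, the
  others at least \<open>0\<close>.\<close>

lemma randomized_reduction:
  fixes M Q :: int and B \<delta> :: real
  assumes head: "wp M pre T1 H s0" "bounded_by M s0"
    and Q: "0 < Q" "Q \<le> M"
    and H: "\<And>s. H s \<Longrightarrow> regs s 6 = Q"
    and tail: "\<And>s r. H s \<Longrightarrow> r \<in> {0..<Q} \<Longrightarrow> wp M post T2 (good r) (set_reg 5 r s)"
    and p: "\<And>s r. r \<in> {0..<Q} \<Longrightarrow> good r s \<Longrightarrow> halts_within T3 p s \<and> words_bounded B p s \<and>
      (\<exists>v. success_prob T3 p s v \<ge> 1 - \<delta> \<and> (r \<notin> bad \<longrightarrow> (if v > 0 then 1 else 0) = ans))"
    and B: "real_of_int M \<le> B" "1 \<le> B"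
    and T: "T1 + 1 + T2 + (T3 + 2) \<le> T"
    and bad: "bad \<subseteq> {0..<Q}" and \<delta>: "0 \<le> \<delta>"
  defines "prog \<equiv> pre @ [Rand 5 6] @ post @ p @ sign_prog"
  shows "halts_within T prog s0" "words_bounded B prog s0"
    "success_prob T prog s0 ans \<ge> 1 - \<delta> - real (card bad) / real_of_int Q"
proof -
  define rest where "rest = post @ p @ sign_prog"
  obtain t1 s1 where t1: "t1 \<le> T1" "det_steps M t1 (prog, s0) (Rand 5 6 # rest, s1)" "H s1"
    using head unfolding wp_def prog_def rest_def by force
  have b1: "bounded_by M s1" using det_steps_bounded[OF t1(2)] by simp
  have Q6: "regs s1 6 = Q" by (rule H[OF t1(3)])
  have "\<forall>r\<in>{0..<Q}. \<exists>ts. fst ts \<le> T2 \<and>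
      det_steps M (fst ts) (rest, set_reg 5 r s1) (p @ sign_prog, snd ts) \<and> good r (snd ts)"
  proof
    fix r assume r: "r \<in> {0..<Q}"
    have "bounded_by M (set_reg 5 r s1)" using r Q b1 by (intro bounded_by_set_reg) auto
    with tail[OF t1(3) r] obtain t s where "t \<le> T2"
      "det_steps M t (rest, set_reg 5 r s1) (p @ sign_prog, s)" "good r s"
      unfolding wp_def rest_def by blast
    then show "\<exists>ts. fst ts \<le> T2 \<and>
      det_steps M (fst ts) (rest, set_reg 5 r s1) (p @ sign_prog, snd ts) \<and> good r (snd ts)"
      by (intro exI[of _ "(t, s)"]) simp
  qed
  from bchoice[OF this] obtain g where g: "\<forall>r\<in>{0..<Q}. fst (g r) \<le> T2 \<and>
      det_steps M (fst (g r)) (rest, set_reg 5 r s1) (p @ sign_prog, snd (g r)) \<and> good r (snd (g r))" ..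
  define t2 s2 where "t2 r = fst (g r)" and "s2 r = snd (g r)" for r
  have t2: "t2 r \<le> T2" "det_steps M (t2 r) (rest, set_reg 5 r s1) (p @ sign_prog, s2 r)"
    "good r (s2 r)" if "r \<in> {0..<Q}" for r
    using g that by (auto simp: t2_def s2_def)
  note p' = p[OF _ t2(3)]
  \<comment> \<open>\<open>t1\<close> and \<open>t2 r\<close> are actual times below the budgets;
    what is left of \<open>T\<close> is spent in the halted configuration.\<close>
  have run_rest: "run (T - t1 - 1) (rest, set_reg 5 r s1) = run (T3 + 2) (p @ sign_prog, s2 r)"
    if r: "r \<in> {0..<Q}" for r
  proof -
    define u where "u = T - t1 - 1 - t2 r - (T3 + 2)"
    have u: "T - t1 - 1 = t2 r + (T3 + 2 + u)"
      using T t1(1) t2(1)[OF r] by (simp add: u_def)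
    show ?thesis unfolding u run_det_steps[OF t2(2)[OF r]]
      using p'[OF r r] by (intro run_add_halted halts_append_sign) simp
  qed
  have run_prog: "run T (prog, s0) = bind_pmf (pmf_of_set {0..<Q}) (\<lambda>r. run (T3 + 2) (p @ sign_prog, s2 r))"
  proof -
    define u where "u = T - t1 - 1"
    have u: "T = t1 + Suc u" "u = T - t1 - 1" using T t1(1) by (simp_all add: u_def)
    have "run T (prog, s0) = run (Suc u) (Rand 5 6 # rest, s1)"
      unfolding u(1) by (rule run_det_steps[OF t1(2)])
    also have "\<dots> = bind_pmf (pmf_of_set {0..<Q}) (\<lambda>r. run (T - t1 - 1) (rest, set_reg 5 r s1))"
      using Q by (simp add: Q6 bind_map_pmf u(2))
    also have "\<dots> = bind_pmf (pmf_of_set {0..<Q}) (\<lambda>r. run (T3 + 2) (p @ sign_prog, s2 r))"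
      using Q run_rest by (intro bind_pmf_cong) auto
    finally show ?thesis .
  qed
  show "halts_within T prog s0"
  proof -
    have "halts_within (T3 + 2) (p @ sign_prog) (s2 r)" if "r \<in> {0..<Q}" for r
      using p'[OF that that] by (intro halts_append_sign) simp
    then show ?thesis unfolding halts_within_def run_prog using Q by auto
  qed
  show "words_bounded B prog s0"
  proof -
    have M: "(\<forall>r. \<bar>real_of_int (regs s r)\<bar> \<le> B) \<and> (\<forall>a i. \<bar>real_of_int (arrs s a i)\<bar> \<le> B)"
      if "bounded_by M s" for s
    proof -
      have "\<bar>real_of_int x\<bar> \<le> B" if "\<bar>x\<bar> \<le> M" for x
      proof -
        have "real_of_int \<bar>x\<bar> \<le> real_of_int M" using that of_int_le_iff by blast
        with B show ?thesis by simp
      qed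
      with that show ?thesis unfolding bounded_by_def by blast
    qed
    show ?thesis unfolding words_bounded_iff
    proof (intro allI impI)
      fix c assume c: "reach (prog, s0) c"
      have "bounded_by M (snd c) \<or> (\<exists>r\<in>{0..<Q}. reach (p @ sign_prog, s2 r) c)"
      proof (cases "bounded_by M (snd c)")
        case False
        with reach_det_steps[OF t1(2) c] have "reach (Rand 5 6 # rest, s1) c" by blast
        then obtain r where r: "r \<in> {0..<Q}" "reach (rest, set_reg 5 r s1) c"
          by (cases rule: reach.cases) (use False b1 Q in \<open>auto simp: Q6\<close>)
        with reach_det_steps[OF t2(2)[OF r(1)] r(2)] False show ?thesis by blast
      qed blast
      then show "(\<forall>r. \<bar>real_of_int (regs (snd c) r)\<bar> \<le> B) \<and> (\<forall>a i. \<bar>real_of_int (arrs (snd c) a i)\<bar> \<le> B)"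
      proof (elim disjE bexE)
        fix r assume r: "r \<in> {0..<Q}" and reach: "reach (p @ sign_prog, s2 r) c"
        have w: "(\<forall>r. \<bar>real_of_int (regs (snd c') r)\<bar> \<le> B) \<and> (\<forall>a i. \<bar>real_of_int (arrs (snd c') a i)\<bar> \<le> B)"
          if "reach (p, s2 r) c'" for c'
          using p'[OF r r] that unfolding words_bounded_iff by blast
        from reach_append[OF reach] show ?thesis
        proof (elim disjE exE conjE)
          fix s' assume s': "reach (p, s2 r) ([], s')" "reach (sign_prog, s') c"
          from reach_sign_prog[OF s'(2)] w[OF s'(1)] B(2) show ?thesis
            by (auto simp: sign_state_def)
        qed (use w in auto)
      qed (rule M)
    qed
  qed
  show "success_prob T prog s0 ans \<ge> 1 - \<delta> - real (card bad) / real_of_int Q"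
  proof -
    define X where "X = {c :: config. fst c = [] \<and> regs (snd c) 0 = ans}"
    define f where "f r = measure_pmf.prob (run (T3 + 2) (p @ sign_prog, s2 r)) X" for r
    have f: "f r \<ge> (if r \<in> bad then 0 else 1 - \<delta>)" if r: "r \<in> {0..<Q}" for r
    proof (cases "r \<in> bad")
      case False
      with p'[OF r r] obtain v where "halts_within T3 p (s2 r)" "success_prob T3 p (s2 r) v \<ge> 1 - \<delta>"
        "(if v > 0 then 1 else 0) = ans" by auto
      with success_append_sign[of T3 p "s2 r" v ans] False show ?thesis
        by (simp add: f_def X_def success_prob_def)
    qed (simp add: f_def)
    have fin: "finite {0..<Q}" "{0..<Q} \<noteq> {}" using Q by auto
    have "success_prob T prog s0 ans = measure_pmf.expectation (pmf_of_set {0..<Q}) f"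
      unfolding success_prob_def run_prog f_def[abs_def] X_def by (rule prob_bind_pmf)
    also have "\<dots> = (\<Sum>r\<in>{0..<Q}. f r) / real (card {0..<Q})"
      by (rule integral_pmf_of_set[OF fin(2,1)])
    finally have eq: "success_prob T prog s0 ans = (\<Sum>r\<in>{0..<Q}. f r) / real_of_int Q"
      using Q by simp
    have finb: "finite bad" using bad finite_subset by blast
    have "(1 - \<delta>) * (real_of_int Q - real (card bad)) = (\<Sum>r\<in>{0..<Q} - bad. 1 - \<delta>)"
      using Q bad finb card_mono[OF fin(1) bad] by (simp add: card_Diff_subset of_nat_diff)
    also have "\<dots> \<le> (\<Sum>r\<in>{0..<Q} - bad. f r)" using f by (intro sum_mono) (metis DiffE)
    also have "\<dots> \<le> (\<Sum>r\<in>{0..<Q}. f r)" by (intro sum_mono2) (auto simp: f_def)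
    finally have "(1 - \<delta>) * (real_of_int Q - real (card bad)) \<le> (\<Sum>r\<in>{0..<Q}. f r)" .
    moreover have "(1 - \<delta>) * (real_of_int Q - real (card bad)) =
        (1 - \<delta>) * real_of_int Q - real (card bad) + \<delta> * real (card bad)" by (simp add: algebra_simps)
    moreover have "0 \<le> \<delta> * real (card bad)" using \<delta> by simp
    ultimately have "(1 - \<delta>) * real_of_int Q - real (card bad) \<le> (\<Sum>r\<in>{0..<Q}. f r)" by linarith
    then have "((1 - \<delta>) * real_of_int Q - real (card bad)) / real_of_int Q \<le> success_prob T prog s0 ans"
      unfolding eq using Q by (intro divide_right_mono) auto
    then show ?thesis using Q by (simp add: diff_divide_distrib)
  qed
qed

section \<open>Straight-line programs\<close>

text \<open>The string of rule \<open>i\<close> from the rules on which it depends. Unlike the fold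
  in \<open>slp_strings\<close>, it survives the overwriting of later rules and makes no claim about
  rules that are still to be filled.\<close>

inductive gen :: "'a rule list \<Rightarrow> nat \<Rightarrow> 'a list \<Rightarrow> bool" for S where
  gen_Terminal: "i < length S \<Longrightarrow> S ! i = Terminal a \<Longrightarrow> gen S i [a]"
| gen_Concat: "i < length S \<Longrightarrow> S ! i = Concat j k \<Longrightarrow> j < i \<Longrightarrow> k < i \<Longrightarrow>
    gen S j v \<Longrightarrow> gen S k w \<Longrightarrow> gen S i (v @ w)"

lemma slp_strings_snoc:
  "slp_strings (S @ [r]) = slp_strings S @ [rule_string (slp_strings S) r]"
  by (simp add: slp_strings_def)

lemma length_slp_strings [simp]: "length (slp_strings S) = length S"
  by (induction S rule: rev_induct) (simp add: slp_strings_def, simp add: slp_strings_snoc)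

lemma slp_strings_nth_append: "i < length S \<Longrightarrow> slp_strings (S @ R) ! i = slp_strings S ! i"
proof (induction R rule: rev_induct)
  case (snoc r R)
  have "slp_strings (S @ R @ [r]) ! i = slp_strings (S @ R) ! i"
    unfolding append_assoc[symmetric] slp_strings_snoc using snoc.prems by (simp add: nth_append)
  with snoc show ?case by simp
qed simp

lemma slp_strings_take: "j < i \<Longrightarrow> i \<le> length S \<Longrightarrow> slp_strings (take i S) ! j = slp_strings S ! j"
  using slp_strings_nth_append[of j "take i S" "drop i S"] by simp

lemma slp_strings_nth:
  assumes "i < length S"
  shows "slp_strings S ! i = rule_string (slp_strings (take i S)) (S ! i)"
proof -
  have "slp_strings S ! i = slp_strings (take (Suc i) S) ! i"
    using assms by (simp add: slp_strings_take)
  also have "\<dots> = rule_string (slp_strings (take i S)) (S ! i)"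
    using assms by (simp add: take_Suc_conv_app_nth slp_strings_snoc nth_append)
  finally show ?thesis .
qed

lemma gen_slp_strings: "gen S i w \<Longrightarrow> slp_strings S ! i = w"
  by (induction rule: gen.induct) (simp_all add: slp_strings_nth slp_strings_take)

lemma gen_slp_string:
  assumes "gen S (length S - 1) w" "S \<noteq> []"
  shows "slp_string S = w"
  using gen_slp_strings[OF assms(1)] assms(2) unfolding slp_string_def
  by (metis last_conv_nth length_0_conv length_slp_strings)

lemma gen_cong:
  "gen S i w \<Longrightarrow> length S' = length S \<Longrightarrow> (\<And>j. j \<le> i \<Longrightarrow> S' ! j = S ! j) \<Longrightarrow> gen S' i w"
proof (induction rule: gen.induct)
  case (gen_Terminal i a)
  then show ?case by (auto intro!: gen.intros)
next
  case (gen_Concat i j k v w)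
  show ?case
    by (rule gen.gen_Concat[of _ _ j k]) (use gen_Concat in auto)
qed

lemma gen_update: "gen S i w \<Longrightarrow> i < j \<Longrightarrow> gen (S[j := r]) i w"
  by (rule gen_cong) auto

definition rule_ok :: "'a set \<Rightarrow> nat \<Rightarrow> 'a rule \<Rightarrow> bool" where
  "rule_ok \<Sigma> i r \<longleftrightarrow> (case r of Terminal a \<Rightarrow> a \<in> \<Sigma> | Concat j k \<Rightarrow> j < i \<and> k < i)"

lemma is_slp_iff: "is_slp \<Sigma> S \<longleftrightarrow> S \<noteq> [] \<and> (\<forall>i<length S. rule_ok \<Sigma> i (S ! i))"
  by (simp add: is_slp_def rule_ok_def)

lemma is_slp_update: "is_slp \<Sigma> S \<Longrightarrow> rule_ok \<Sigma> j r \<Longrightarrow> is_slp \<Sigma> (S[j := r])"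
  unfolding is_slp_iff by (metis length_list_update list_update_nonempty nth_list_update_eq nth_list_update_neq)

section \<open>Perfect binary trees and path copying\<close>

primrec perfect :: "'a rule list \<Rightarrow> nat \<Rightarrow> nat \<Rightarrow> 'a list \<Rightarrow> bool" where
  "perfect S 0 i w \<longleftrightarrow> i < length S \<and> (\<exists>a. S ! i = Terminal a \<and> w = [a])"
| "perfect S (Suc k) i w \<longleftrightarrow> i < length S \<and>
     (\<exists>j l u v. S ! i = Concat j l \<and> j < i \<and> l < i \<and> perfect S k j u \<and> perfect S k l v \<and> w = u @ v)"

lemma perfect_length: "perfect S k i w \<Longrightarrow> length w = 2 ^ k"
proof (induction k arbitrary: i w)
  case (Suc k)
  then obtain j l u v where "perfect S k j u" "perfect S k l v" "w = u @ v" by auto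
  with Suc.IH show ?case by fastforce
qed auto

lemma perfect_gen: "perfect S k i w \<Longrightarrow> gen S i w"
  by (induction k arbitrary: i w) (auto intro: gen.intros)

lemma perfect_cong:
  "perfect S k i w \<Longrightarrow> length S' = length S \<Longrightarrow> (\<And>j. j \<le> i \<Longrightarrow> S' ! j = S ! j) \<Longrightarrow> perfect S' k i w"
proof (induction k arbitrary: i w)
  case (Suc k)
  then obtain j l u v where *: "S ! i = Concat j l" "j < i" "l < i" "perfect S k j u" "perfect S k l v"
      "w = u @ v" "i < length S" by auto
  have "perfect S' k j u" "perfect S' k l v"
    using * Suc.prems by (auto intro!: Suc.IH)
  with * Suc.prems show ?case by auto
qed auto

lemma perfect_update: "perfect S k i w \<Longrightarrow> i < j \<Longrightarrow> perfect (S[j := r]) k i w"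
  by (rule perfect_cong) auto

text \<open>Inserting position \<open>x\<close> copies the path to leaf \<open>x\<close> of the tree with root \<open>cur\<close>
  into the rules \<open>p, \<dots>, p + k\<close>, top-down as in the program.\<close>

primrec copy_path :: "nat \<Rightarrow> nat \<Rightarrow> nat \<Rightarrow> nat \<Rightarrow> int rule list \<Rightarrow> int rule list" where
  "copy_path p x 0 cur S = S[p := Terminal 1]"
| "copy_path p x (Suc k) cur S =
     (case S ! cur of
        Terminal a \<Rightarrow> S
      | Concat l r \<Rightarrow>
          if bit x k then copy_path p x k r (S[p + Suc k := Concat l (p + k)])
          else copy_path p x k l (S[p + Suc k := Concat (p + k) r]))"

lemma length_copy_path [simp]: "length (copy_path p x k cur S) = length S"
  by (induction k arbitrary: cur S) (auto split: rule.split)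

lemma copy_path_nth: "j < p \<or> p + k < j \<Longrightarrow> copy_path p x k cur S ! j = S ! j"
  by (induction k arbitrary: cur S) (auto split: rule.split)

lemma mod_power_Suc_bit:
  "x mod 2 ^ Suc k = x mod 2 ^ k + (if bit x k then 2 ^ k else 0)" for x :: nat
  unfolding take_bit_eq_mod[symmetric] take_bit_Suc_from_most by simp

text \<open>The copy of the node of height \<open>k\<close> is rule \<open>p + k\<close>. Its child
  off the path is a node of the old tree below \<open>p\<close>, which no write touches; its child
  on the path is rule \<open>p + k - 1\<close>, filled by the recursive call, which writes nothing
  above that rule. From the top, the bits of \<open>x\<close> select the child.\<close>

lemma perfect_copy_path:
  assumes "perfect S k cur w" "cur < p" "p + k < length S"
  shows "perfect (copy_path p x k cur S) k (p + k) (w[x mod 2 ^ k := 1])"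
  using assms
proof (induction k arbitrary: cur S w)
  case 0
  then show ?case by auto
next
  case (Suc k)
  then obtain l r u v where *: "S ! cur = Concat l r" "l < cur" "r < cur" "perfect S k l u"
      "perfect S k r v" "w = u @ v" by auto
  define c where "c = (if bit x k then r else l)"
  define z :: "int rule" where "z = (if bit x k then Concat l (p + k) else Concat (p + k) r)"
  define S1 where "S1 = S[p + Suc k := z]"
  define S2 where "S2 = copy_path p x k c S1"
  have eq: "copy_path p x (Suc k) cur S = S2"
    using * by (auto simp: S2_def S1_def z_def c_def)
  have len: "length u = 2 ^ k" "length v = 2 ^ k" using * perfect_length by auto
  have old: "S2 ! i = S ! i" if "i < p" for i
    using that by (simp add: S2_def copy_path_nth S1_def)
  have top: "S2 ! (p + Suc k) = z"
    using Suc.prems by (simp add: S2_def copy_path_nth S1_def)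
  have p: "perfect S2 k l u" "perfect S2 k r v"
    by (rule perfect_cong[OF *(4)], simp add: S2_def S1_def, use * Suc.prems old in auto)
      (rule perfect_cong[OF *(5)], simp add: S2_def S1_def, use * Suc.prems old in auto)
  have c: "perfect S1 k c (if bit x k then v else u)" "c < p"
    using * Suc.prems by (auto simp: S1_def c_def intro!: perfect_update)
  have new: "perfect S2 k (p + k) ((if bit x k then v else u)[x mod 2 ^ k := 1])"
    unfolding S2_def by (rule Suc.IH[OF c]) (use Suc.prems in \<open>simp add: S1_def\<close>)
  have w: "w[x mod 2 ^ Suc k := 1] =
      (if bit x k then u @ v[x mod 2 ^ k := 1] else u[x mod 2 ^ k := 1] @ v)"
    unfolding mod_power_Suc_bit using len * by (auto simp: list_update_append)
  have "p + Suc k < length S2" using Suc.prems by (simp add: S2_def S1_def)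
  then show ?case unfolding eq w using p new top Suc.prems * by (auto simp: z_def)
qed

section \<open>Indicator vectors and their shifts\<close>

definition indicator_list :: "nat \<Rightarrow> nat set \<Rightarrow> int list" where
  "indicator_list n X = map (\<lambda>i. if i \<in> X then 1 else 0) [0..<n]"

lemma length_indicator_list [simp]: "length (indicator_list n X) = n"
  by (simp add: indicator_list_def)

lemma indicator_list_nth [simp]: "i < n \<Longrightarrow> indicator_list n X ! i = (if i \<in> X then 1 else 0)"
  by (simp add: indicator_list_def)

lemma indicator_list_update: "(indicator_list n X)[x := 1] = indicator_list n (insert x X)"
proof (rule nth_equalityI)
  fix i assume "i < length ((indicator_list n X)[x := 1])"
  then show "(indicator_list n X)[x := 1] ! i = indicator_list n (insert x X) ! i"
    by (cases "i = x") auto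
qed simp

lemma indicator_list_empty: "indicator_list n {} = replicate n 0"
  by (rule nth_equalityI) auto

text \<open>Only the low \<open>k\<close> bits of \<open>y\<close> count, and the trailing zeros
  make the length independent of \<open>y\<close>; the former allows induction on the bits, the
  latter keeps all blocks aligned.\<close>

definition shifted :: "nat \<Rightarrow> nat \<Rightarrow> int list \<Rightarrow> int list" where
  "shifted k y w = replicate (y mod 2 ^ k) 0 @ w @ replicate (2 ^ k - 1 - y mod 2 ^ k) 0"

lemma shifted_0: "shifted 0 y w = w"
  by (simp add: shifted_def)

lemma length_shifted: "length (shifted k y w) = length w + 2 ^ k - 1"
proof -
  have "y mod 2 ^ k < 2 ^ k" by simp
  then show ?thesis unfolding shifted_def length_append length_replicate by linarith
qed

text \<open>Bit \<open>k\<close> decides whether \<open>2 ^ k\<close> zeros go in front or behind;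
  the length grows alike in both cases.\<close>

lemma shifted_Suc:
  "shifted (Suc k) y w =
     (if bit y k then replicate (2 ^ k) 0 @ shifted k y w else shifted k y w @ replicate (2 ^ k) 0)"
proof -
  have "y mod 2 ^ k < 2 ^ k" by simp
  then have "2 ^ k + (2 ^ k - 1 - y mod 2 ^ k) = 2 ^ Suc k - 1 - y mod 2 ^ k"
    unfolding power_Suc by linarith
  then show ?thesis unfolding shifted_def mod_power_Suc_bit
    by (simp add: replicate_add add.commute[of _ "2 ^ k"])
      (metis append_assoc replicate_add add.commute)
qed

section \<open>Inner products of block strings\<close>

text \<open>The leading zero is the string of rule \<open>0\<close>, with which the program starts
  the concatenation; the trailing one comes from the final concatenation, which moves the string to
  the last rule. \<open>rev\<close> appears because the program consumes \<open>ys\<close> from its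
  end.\<close>

definition block_string :: "nat \<Rightarrow> nat list \<Rightarrow> nat list \<Rightarrow> int list" where
  "block_string L xs ys =
     0 # concat (map (\<lambda>y. shifted L y (indicator_list (2 ^ L) (set xs))) (rev ys)) @ [0]"

lemma length_block_string:
  "length (block_string L xs ys) = 2 + length ys * (2 ^ Suc L - 1)"
  by (simp add: block_string_def length_concat o_def length_shifted sum_list_triv mult_2 add.commute)

lemma shifted_indicator_list:
  assumes "y < 2 ^ k"
  shows "shifted k y (indicator_list n X) = indicator_list (n + 2 ^ k - 1) ((\<lambda>x. x + y) ` (X \<inter> {..<n}))"
proof (rule nth_equalityI)
  show "length (shifted k y (indicator_list n X)) =
      length (indicator_list (n + 2 ^ k - 1) ((\<lambda>x. x + y) ` (X \<inter> {..<n})))"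
    by (simp add: length_shifted)
  fix i assume "i < length (shifted k y (indicator_list n X))"
  then have i: "i < n + 2 ^ k - 1" by (simp add: length_shifted)
  have "i \<in> (\<lambda>x. x + y) ` (X \<inter> {..<n}) \<longleftrightarrow> y \<le> i \<and> i - y < n \<and> i - y \<in> X"
    by (force simp: image_iff)
  then show "shifted k y (indicator_list n X) ! i =
      indicator_list (n + 2 ^ k - 1) ((\<lambda>x. x + y) ` (X \<inter> {..<n})) ! i"
    using i assms by (auto simp: shifted_def nth_append)
qed

lemma inner_product_Nil [simp]: "inner_product [] v = 0"
  by (simp add: inner_product_def)

lemma inner_product_Cons [simp]: "inner_product (x # u) (y # v) = x * y + inner_product u v"
  by (simp add: inner_product_def sum.lessThan_Suc_shift del: sum.lessThan_Suc)

lemma inner_product_append: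
  "length u = length v \<Longrightarrow> inner_product (u @ u') (v @ v') = inner_product u v + inner_product u' v'"
  by (induction u v rule: list_induct2) simp_all

lemma inner_product_concat:
  assumes "\<And>y. y \<in> set ys \<Longrightarrow> length (f y) = length (g y)"
  shows "inner_product (concat (map f ys)) (concat (map g ys)) =
    (\<Sum>y\<leftarrow>ys. inner_product (f y) (g y))"
  using assms by (induction ys) (simp_all add: inner_product_append)

lemma inner_product_indicator_list:
  "inner_product (indicator_list n X) (indicator_list n Y) = int (card (X \<inter> Y \<inter> {..<n}))"
proof -
  have "inner_product (indicator_list n X) (indicator_list n Y) =
      (\<Sum>i<n. if i \<in> X \<inter> Y then 1 else 0)"
    unfolding inner_product_def by (rule sum.cong) auto
  also have "\<dots> = int (card (X \<inter> Y \<inter> {..<n}))"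
    by (subst sum.If_cases) (simp_all add: Int_commute Int_def)
  finally show ?thesis .
qed

text \<open>Block by block the product counts the sums \<open>x + y\<close> that lie in
  \<open>set zs\<close>; no block contributes a negative amount, so nothing cancels. The second
  vector is a block string with all shifts zero, so that one construction serves for both.\<close>

lemma inner_product_block_string_pos_iff:
  assumes "\<forall>x\<in>set xs. x < 2 ^ L" "\<forall>y\<in>set ys. y < 2 ^ L" "\<forall>z\<in>set zs. z < 2 ^ L"
  shows "inner_product (block_string L xs ys) (block_string L zs (replicate (length ys) 0)) > 0 \<longleftrightarrow>
    (\<exists>x\<in>set xs. \<exists>y\<in>set ys. x + y \<in> set zs)"
proof -
  define f where "f y = shifted L y (indicator_list (2 ^ L) (set xs))" for y
  define w where "w = shifted L 0 (indicator_list (2 ^ L) (set zs))"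
  have len: "length (f y) = length w" for y by (simp add: f_def w_def length_shifted)
  have zs: "block_string L zs (replicate (length ys) 0) = [0] @ concat (map (\<lambda>_. w) (rev ys)) @ [0]"
    by (simp add: block_string_def w_def map_replicate_const)
  have "inner_product (block_string L xs ys) (block_string L zs (replicate (length ys) 0)) =
      inner_product [0] [0] + (inner_product (concat (map f (rev ys))) (concat (map (\<lambda>_. w) (rev ys))) +
      inner_product [0] [0])"
    unfolding zs by (subst inner_product_append[symmetric], simp add: length_concat o_def len,
      subst inner_product_append[symmetric], simp, simp add: block_string_def f_def[abs_def])
  also have "\<dots> = (\<Sum>y\<leftarrow>rev ys. inner_product (f y) w)"
    by (subst inner_product_concat) (simp_all add: len)
  finally have eq: "inner_product (block_string L xs ys) (block_string L zs (replicate (length ys) 0)) =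
    (\<Sum>y\<leftarrow>rev ys. inner_product (f y) w)" .
  define N :: nat where "N = 2 ^ L + 2 ^ L - Suc 0"
  have f: "inner_product (f y) w = int (card ((\<lambda>x. x + y) ` set xs \<inter> set zs))"
    if "y \<in> set ys" for y
  proof -
    have 1: "set xs \<inter> {..<2 ^ L} = set xs" "set zs \<inter> {..<2 ^ L} = set zs" using assms by auto
    have "set zs \<subseteq> {..<N}" using assms(3) by (fastforce simp: N_def)
    then have 2: "(\<lambda>x. x + y) ` set xs \<inter> set zs \<inter> {..<N} = (\<lambda>x. x + y) ` set xs \<inter> set zs" by auto
    show ?thesis
      unfolding f_def w_def using that assms(2)
      by (simp add: shifted_indicator_list 1 inner_product_indicator_list N_def[symmetric] 2)
  qed
  have "(\<Sum>y\<leftarrow>rev ys. inner_product (f y) w) > 0 \<longleftrightarrow> (\<exists>y\<in>set ys. inner_product (f y) w > 0)"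
  proof -
    have nn: "inner_product (f y) w \<ge> 0" if "y \<in> set ys" for y using f[OF that] by simp
    have "(\<Sum>y\<leftarrow>rev ys. inner_product (f y) w) = 0 \<longleftrightarrow> (\<forall>y\<in>set ys. inner_product (f y) w = 0)"
      using nn by (subst sum_list_nonneg_eq_0_iff) auto
    moreover have "(\<Sum>y\<leftarrow>rev ys. inner_product (f y) w) \<ge> 0"
      using nn by (intro sum_list_nonneg) auto
    ultimately show ?thesis using nn by (metis order_less_le)
  qed
  also have "\<dots> \<longleftrightarrow> (\<exists>x\<in>set xs. \<exists>y\<in>set ys. x + y \<in> set zs)"
    using f by (auto simp: card_gt_0_iff)
  finally show ?thesis unfolding eq .
qed

section \<open>Almost linear hashing\<close>

definition hash :: "int \<Rightarrow> int \<Rightarrow> int \<Rightarrow> int \<Rightarrow> int" where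
  "hash U R r x = (r * x mod (U * R)) div U"

lemma hash_range:
  assumes "U > 0" "R > 0"
  shows "0 \<le> hash U R r x" "hash U R r x < R"
proof -
  have "U * hash U R r x \<le> r * x mod (U * R)"
    unfolding hash_def using assms(1) by (metis mult.commute div_mod_decomp_int le_add_same_cancel1 pos_mod_sign)
  also have "\<dots> < U * R" using assms by simp
  finally show "hash U R r x < R" using assms(1) mult_less_cancel_left_pos by blast
  show "0 \<le> hash U R r x" using assms by (simp add: hash_def pos_imp_zdiv_nonneg_iff)
qed

text \<open>Multiplicative hashing reads \<open>r * x\<close> in mixed radix: a multiple of
  \<open>U * R\<close>, the digit \<open>hash U R r x\<close> in units of \<open>U\<close>, and a
  remainder below \<open>U\<close>. The two lemmas that follow compare such expansions of three
  numbers.\<close>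

lemma hash_decomp:
  assumes "U > 0" "R > 0"
  obtains \<rho> q where "r * x = U * R * q + U * hash U R r x + \<rho>" "0 \<le> \<rho>" "\<rho> < U"
proof
  show "r * x = U * R * (r * x div (U * R)) + U * hash U R r x + (r * x mod (U * R)) mod U"
    unfolding hash_def by (metis add.assoc mult_div_mod_eq)
qed (use assms in auto)

text \<open>When two expansions are added, the remainders carry at most once, which is
  \<open>e = -k\<close>, and the digits wrap around \<open>R\<close> at most once, which is
  \<open>f\<close>. This holds for every \<open>r\<close>.\<close>

lemma hash_sum:
  assumes "U > 0" "R > 0"
  shows "\<exists>e\<in>{0, 1}. \<exists>f\<in>{0, 1}. hash U R r a + (hash U R r b + e) = hash U R r (a + b) + R * f"
proof -
  obtain \<alpha> qa where a: "r * a = U * R * qa + U * hash U R r a + \<alpha>" "0 \<le> \<alpha>" "\<alpha> < U"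
    by (rule hash_decomp[OF assms])
  obtain \<beta> qb where b: "r * b = U * R * qb + U * hash U R r b + \<beta>" "0 \<le> \<beta>" "\<beta> < U"
    by (rule hash_decomp[OF assms])
  obtain \<gamma> qc where c: "r * (a + b) = U * R * qc + U * hash U R r (a + b) + \<gamma>" "0 \<le> \<gamma>" "\<gamma> < U"
    by (rule hash_decomp[OF assms])
  define k where "k = R * (qa + qb - qc) + hash U R r a + hash U R r b - hash U R r (a + b)"
  define f where "f = qc - qa - qb"
  have "U * k = \<gamma> - \<alpha> - \<beta>" using a(1) b(1) c(1) by (simp add: k_def algebra_simps)
  then have "U * k < U * 1" "U * (-2) < U * k" using a b c by linarith+
  then have k: "k < 1" "-2 < k" using assms(1) mult_less_cancel_left_pos by blast+
  have eq: "R * f = hash U R r a + hash U R r b - k - hash U R r (a + b)"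
    by (simp add: k_def f_def algebra_simps)
  then have "R * f < R * 2" "R * (-1) < R * f"
    using hash_range[OF assms, of r a] hash_range[OF assms, of r b] hash_range[OF assms, of r "a + b"] k
    by linarith+
  then have f: "f < 2" "-1 < f" using assms(2) mult_less_cancel_left_pos by blast+
  show ?thesis using eq k f by (intro bexI[of _ "-k"] bexI[of _ f]) auto
qed

text \<open>A collision leaves only remainders: up to multiples of \<open>U * R\<close>, the number
  \<open>r * (a + b - c)\<close> is \<open>\<alpha> + \<beta> - \<gamma> - U * e\<close>, which lies
  strictly between \<open>-2 * U\<close> and \<open>2 * U\<close>.\<close>

lemma hash_collision:
  assumes "U > 0" "R > 0" "e \<in> {0, 1}"
    and "hash U R r a + (hash U R r b + e) = hash U R r c + R * f"
  shows "\<exists>k. \<bar>r * (a + b - c) - k * (U * R)\<bar> < 2 * U"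
proof -
  obtain \<alpha> qa where a: "r * a = U * R * qa + U * hash U R r a + \<alpha>" "0 \<le> \<alpha>" "\<alpha> < U"
    by (rule hash_decomp[OF assms(1,2)])
  obtain \<beta> qb where b: "r * b = U * R * qb + U * hash U R r b + \<beta>" "0 \<le> \<beta>" "\<beta> < U"
    by (rule hash_decomp[OF assms(1,2)])
  obtain \<gamma> qc where c: "r * c = U * R * qc + U * hash U R r c + \<gamma>" "0 \<le> \<gamma>" "\<gamma> < U"
    by (rule hash_decomp[OF assms(1,2)])
  have "U * (hash U R r a + (hash U R r b + e)) = U * (hash U R r c + R * f)" using assms(4) by simp
  then have "r * (a + b - c) - (qa + qb - qc + f) * (U * R) = \<alpha> + \<beta> - \<gamma> - U * e"
    using a(1) b(1) c(1) by (simp add: algebra_simps)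
  moreover have "U * e = 0 \<or> U * e = U" using assms(3) by auto
  ultimately have "\<bar>r * (a + b - c) - (qa + qb - qc + f) * (U * R)\<bar> < 2 * U"
    using a b c by linarith
  then show ?thesis by blast
qed

definition bad :: "int \<Rightarrow> int \<Rightarrow> int \<Rightarrow> int set" where
  "bad U Q z = {r\<in>{0..<Q}. \<exists>k. \<bar>r * z - k * Q\<bar> < 2 * U}"

text \<open>Going once round modulo \<open>Q\<close> takes the multiples of \<open>z\<close> about \<open>Q / z\<close> steps, and in each of
  the \<open>z\<close> rounds at most \<open>4 U / z + 1\<close> of them are close to a multiple of \<open>Q\<close>.\<close>

lemma card_bad:
  fixes U Q z :: int
  assumes "z \<noteq> 0" "\<bar>z\<bar> < 2 * U" "2 * U \<le> Q"
  shows "int (card (bad U Q z)) \<le> 10 * U"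
proof -
  define y where "y = \<bar>z\<bar>"
  have y: "0 < y" "y < 2 * U" using assms by (auto simp: y_def)
  \<comment> \<open>\<open>J k\<close> contains every \<open>r\<close> with
    \<open>\<bar>r * y - k * Q\<bar> < 2 * U\<close>; it starts just above the rounded lower end and
    has \<open>4 * U div y + 1\<close> elements.\<close>
  define J where "J k = {(k * Q - 2 * U) div y + 1..(k * Q - 2 * U) div y + 1 + 4 * U div y}" for k
  have "bad U Q z \<subseteq> bad U Q y"
  proof
    fix r assume "r \<in> bad U Q z"
    then obtain k where r: "r \<in> {0..<Q}" "\<bar>r * z - k * Q\<bar> < 2 * U" by (auto simp: bad_def)
    have "\<bar>r * y - (sgn z * k) * Q\<bar> = \<bar>r * z - k * Q\<bar>"
      using assms(1) by (cases "z > 0") (auto simp: y_def abs_if)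
    with r have "\<bar>r * y - (sgn z * k) * Q\<bar> < 2 * U" by simp
    with r(1) show "r \<in> bad U Q y" unfolding bad_def by blast
  qed
  moreover have "bad U Q y \<subseteq> (\<Union>k\<in>{0..y}. J k)"
  proof
    fix r assume "r \<in> bad U Q y"
    then obtain k where r: "0 \<le> r" "r < Q" "\<bar>r * y - k * Q\<bar> < 2 * U" by (auto simp: bad_def)
    have Q: "Q > 0" using y assms(3) by linarith
    have "r * y < Q * y" "0 \<le> r * y" using r y by auto
    then have "Q * k < Q * (y + 1)" "Q * (-1) < Q * k"
      using r(3) assms(3) unfolding distrib_left mult.commute[of Q k] by linarith+
    then have "k < y + 1" "-1 < k" using Q mult_less_cancel_left_pos by blast+
    then have k: "k \<in> {0..y}" by auto
    define b where "b = (k * Q - 2 * U) div y"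
    have "k * Q - 2 * U = y * b + (k * Q - 2 * U) mod y" by (simp add: b_def)
    moreover have "0 \<le> (k * Q - 2 * U) mod y" "(k * Q - 2 * U) mod y < y" using y by simp_all
    ultimately have b: "y * b \<le> k * Q - 2 * U" "k * Q - 2 * U < y * (b + 1)"
      unfolding distrib_left by linarith+
    have "y * b < y * r" using b r unfolding mult.commute[of y r] by linarith
    then have "b < r" using y mult_less_cancel_left_pos by blast
    moreover have "r * y - y * (b + 1) \<le> 4 * U" using b r by linarith
    then have "(r - (b + 1)) * y \<le> 4 * U" by (simp add: algebra_simps)
    then have "((r - (b + 1)) * y) div y \<le> 4 * U div y" using y zdiv_mono1 by blast
    then have "r - (b + 1) \<le> 4 * U div y" using y by simp
    ultimately have "r \<in> J k" by (auto simp: b_def J_def)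
    with k show "r \<in> (\<Union>k\<in>{0..y}. J k)" by blast
  qed
  ultimately have "card (bad U Q z) \<le> card (\<Union>k\<in>{0..y}. J k)"
    by (intro card_mono) (auto simp: J_def)
  also have "\<dots> \<le> (\<Sum>k\<in>{0..y}. card (J k))"
    by (rule card_UN_le) simp
  also have "\<dots> = nat (y + 1) * nat (4 * U div y + 1)" by (simp add: J_def)
  finally have "int (card (bad U Q z)) \<le> int (nat (y + 1) * nat (4 * U div y + 1))" by linarith
  also have "\<dots> = (y + 1) * (4 * U div y + 1)"
  proof -
    have "0 \<le> 4 * U div y" using y by (simp add: pos_imp_zdiv_nonneg_iff)
    then show ?thesis using y by simp
  qed
  also have "\<dots> = y * (4 * U div y) + 4 * U div y + y + 1" by (simp add: algebra_simps)
  \<comment> \<open>The first two summands are at most \<open>4 * U\<close> each, and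
    \<open>y + 1\<close> is at most \<open>2 * U\<close>.\<close>
  also have "\<dots> \<le> 10 * U"
  proof -
    have "0 \<le> 4 * U mod y" "4 * U = y * (4 * U div y) + 4 * U mod y" using y by simp_all
    then have *: "y * (4 * U div y) \<le> 4 * U" by linarith
    have "0 \<le> 4 * U div y" using y by (simp add: pos_imp_zdiv_nonneg_iff)
    then have "1 * (4 * U div y) \<le> y * (4 * U div y)" using y by (intro mult_right_mono) auto
    with * y show ?thesis by linarith
  qed
  finally show ?thesis .
qed

section \<open>Building a block string\<close>

lemma array_of_list_update:
  "0 \<le> i \<Longrightarrow> i < int (length xs) \<Longrightarrow> (array_of_list xs)(i := x) = array_of_list (xs[nat i := x])"
  by (rule ext) (auto simp: array_of_list_def nth_list_update)

text \<open>Outside its list \<open>array_of_list\<close> is \<open>0\<close>, so that writing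
  \<open>0\<close> at the last position is a pop.\<close>

lemma array_of_list_pop:
  "(array_of_list (xs @ [x]))(int (length xs) := 0) = array_of_list xs"
  by (rule ext) (auto simp: array_of_list_def nth_append)

lemma array_of_list_push:
  "(array_of_list xs)(int (length xs) := x) = array_of_list (xs @ [x])"
  by (rule ext) (auto simp: array_of_list_def nth_append)

lemma array_of_list_nth: "i < length xs \<Longrightarrow> array_of_list xs (int i) = xs ! i"
  by (simp add: array_of_list_def)

lemma array_of_list_Nil: "array_of_list [] = (\<lambda>_. 0)"
  by (rule ext) (simp add: array_of_list_def)

lemma array_of_list_replicate_0: "array_of_list (replicate n 0) = (\<lambda>_. 0)"
  by (rule ext) (auto simp: array_of_list_def nat_less_iff)

lemma set_arr_set_reg [simp]: "set_arr a i x (set_reg d y s) = set_reg d y (set_arr a i x s)"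
  by (simp add: set_arr_def set_reg_def)

lemma set_reg_same [simp]: "set_reg d x (set_reg d y s) = set_reg d x s"
  by (simp add: set_reg_def)

text \<open>\<open>room\<close> counts rules: \<open>L + 1\<close> for the zeros,
  \<open>L + 1\<close> for each of the \<open>2 * m\<close> inserted elements and
  \<open>L + 1\<close> for each of the \<open>m\<close> blocks, with rule \<open>n - 1\<close> left
  for the last concatenation. \<open>G\<close> is the frame of all other arrays, which allows two
  constructions in the same memory.\<close>

locale builder =
  fixes M :: int and m L n b xa ya :: nat and G :: "nat \<Rightarrow> int \<Rightarrow> int"
  assumes arrays: "b + 2 < xa" "b + 2 < ya" "xa \<noteq> ya"
    and room: "(L + 1) * (3 * m + 1) < n"
    and M: "int n < M" "2 ^ L \<le> M"
begin

text \<open>Arrays \<open>b\<close>, \<open>b + 1\<close>, \<open>b + 2\<close> hold the rules written so far; \<open>xa\<close> and \<open>ya\<close> hold the set and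
  the shifts and are emptied from the end, so that no cleaning is needed. Registers \<open>8\<close> to \<open>19\<close> are
  scratch: \<open>8\<close> is the next free rule, \<open>9\<close> the root of the tree, \<open>10\<close> the outer loop counter and \<open>19\<close> the rule
  of the prefix generated so far.\<close>

definition ctx :: "int rule list \<Rightarrow> nat list \<Rightarrow> nat list \<Rightarrow> state \<Rightarrow> bool" where
  "ctx S xs ys s \<longleftrightarrow>
     regs s 0 = int m \<and> regs s 2 = int L \<and> regs s 3 = int n \<and> regs s 7 = 1 \<and>
     (\<forall>r\<ge>20. regs s r = 0) \<and>
     arrs s b = array_of_list (map rule_kind S) \<and>
     arrs s (Suc b) = array_of_list (map rule_arg1 S) \<and>
     arrs s (Suc (Suc b)) = array_of_list (map rule_arg2 S) \<and>
     arrs s xa = array_of_list (map int xs) \<and> arrs s ya = array_of_list (map int ys) \<and>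
     (\<forall>a. a \<notin> {b, Suc b, Suc (Suc b), xa, ya} \<longrightarrow> arrs s a = G a) \<and>
     length S = n \<and> is_slp {0, 1} S"

lemma ctx_set_reg [simp]: "7 < d \<Longrightarrow> d < 20 \<Longrightarrow> ctx S xs ys (set_reg d x s) \<longleftrightarrow> ctx S xs ys s"
  by (auto simp: ctx_def)

lemma ctx_regs:
  "ctx S xs ys s \<Longrightarrow> regs s 0 = int m" "ctx S xs ys s \<Longrightarrow> regs s 2 = int L"
  "ctx S xs ys s \<Longrightarrow> regs s 3 = int n" "ctx S xs ys s \<Longrightarrow> regs s 7 = 1"
  "ctx S xs ys s \<Longrightarrow> length S = n" "ctx S xs ys s \<Longrightarrow> is_slp {0, 1} S"
  by (auto simp: ctx_def)

lemma ctx_store: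
  assumes "ctx S xs ys s" "i = int j" "j < n" "rule_ok {0, 1} j r"
    and "k = rule_kind r" "a1 = rule_arg1 r" "a2 = rule_arg2 r"
  shows "ctx (S[j := r]) xs ys
    (set_arr (Suc (Suc b)) i a2 (set_arr (Suc b) i a1 (set_arr b i k s)))"
  using assms arrays is_slp_update[of "{0,1}" S j r]
  by (auto simp: ctx_def array_of_list_update map_update)

lemma ctx_pop_x: "ctx S (xs @ [x]) ys s \<Longrightarrow> i = int (length xs) \<Longrightarrow> ctx S xs ys (set_arr xa i 0 s)"
  using arrays array_of_list_pop[of "map int xs" "int x"] by (auto simp: ctx_def)

lemma ctx_pop_y: "ctx S xs (ys @ [y]) s \<Longrightarrow> i = int (length ys) \<Longrightarrow> ctx S xs ys (set_arr ya i 0 s)"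
  using arrays array_of_list_pop[of "map int ys" "int y"] by (auto simp: ctx_def)

lemma ctx_load_x: "ctx S (xs @ [x]) ys s \<Longrightarrow> arrs s xa (int (length xs)) = int x"
  using array_of_list_nth[of "length xs" "map int (xs @ [x])"] by (auto simp: ctx_def nth_append)

lemma ctx_load_y: "ctx S xs (ys @ [y]) s \<Longrightarrow> arrs s ya (int (length ys)) = int y"
  using array_of_list_nth[of "length ys" "map int (ys @ [y])"] by (auto simp: ctx_def nth_append)

lemma ctx_load_rule:
  assumes "ctx S xs ys s" "j < n"
  shows "arrs s (Suc b) (int j) = rule_arg1 (S ! j)" "arrs s (Suc (Suc b)) (int j) = rule_arg2 (S ! j)"
  using assms by (auto simp: ctx_def array_of_list_nth)

lemma room': "L < n" "m < n" "2 * m < n" "1 < M"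
proof -
  have "(L + 1) * (3 * m + 1) = 3 * (L * m) + 3 * m + L + 1" by (simp add: algebra_simps)
  then show "L < n" "m < n" "2 * m < n" using room by linarith+
  then show "1 < M" using M by linarith
qed

section \<open>Strings of zeros\<close>

definition zeros_prog :: "instr list" where
  "zeros_prog = [Const 8 0, Const 9 0, Arith Add 10 2 9, Loop 10
     [Arith Add 9 8 7, Store b 9 7, Store (Suc b) 9 8, Store (Suc (Suc b)) 9 8,
      Arith Add 8 8 7, Arith Sub 10 10 7]]"

text \<open>These rules serve twice: rule \<open>L\<close> is the tree of the empty set, and rule
  \<open>j\<close> pads the shift for bit \<open>j\<close>.\<close>

definition zeros :: "nat \<Rightarrow> int rule list \<Rightarrow> bool" where
  "zeros k S \<longleftrightarrow> (\<forall>j\<le>k. perfect S j j (replicate (2 ^ j) 0))"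

lemma zeros_update: "zeros k S \<Longrightarrow> k < j \<Longrightarrow> zeros k (S[j := r])"
  by (auto simp: zeros_def intro!: perfect_update)

lemma zeros_Suc:
  assumes "zeros k S" "Suc k < length S"
  shows "zeros (Suc k) (S[Suc k := Concat k k])"
proof -
  have "perfect (S[Suc k := Concat k k]) k k (replicate (2 ^ k) 0)"
    using assms(1) by (auto simp: zeros_def intro!: perfect_update)
  then have "perfect (S[Suc k := Concat k k]) (Suc k) (Suc k) (replicate (2 ^ Suc k) 0)"
    using assms(2) by (auto simp: mult_2 replicate_add intro!: exI[of _ "replicate (2 ^ k) 0"])
  with zeros_update[OF assms(1), of "Suc k"] show ?thesis by (auto simp: zeros_def le_Suc_eq)
qed

lemma wp_zeros:
  assumes "ctx (replicate n (Terminal 0)) xs ys s"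
  shows "wp M zeros_prog (7 * L + 4) (\<lambda>s. \<exists>S. ctx S xs ys s \<and> regs s 8 = int L \<and> zeros L S) s"
proof -
  define I where "I k s \<longleftrightarrow> (\<exists>S. ctx S xs ys s \<and> k \<le> L \<and> regs s 8 = int (L - k) \<and>
    regs s 10 = int k \<and> zeros (L - k) S)" for k s
  have body: "regs s 10 > 0 \<and> wp M [Arith Add 9 8 7, Store b 9 7, Store (Suc b) 9 8,
      Store (Suc (Suc b)) 9 8, Arith Add 8 8 7, Arith Sub 10 10 7] 6 (I k) s" if "I (Suc k) s" for k s
  proof -
    from that obtain S where S: "ctx S xs ys s" "Suc k \<le> L" "regs s 8 = int (L - Suc k)"
      "regs s 10 = int (Suc k)" "zeros (L - Suc k) S" by (auto simp: I_def)
    have e: "L - k = Suc (L - Suc k)" using S(2) by simp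
    have z: "zeros (L - k) (S[L - k := Concat (L - Suc k) (L - Suc k)])"
      unfolding e by (rule zeros_Suc[OF S(5)]) (use room' S(2) ctx_regs(5)[OF S(1)] in simp)
    have c: "ctx (S[L - k := Concat (L - Suc k) (L - Suc k)]) xs ys
       (set_arr (Suc (Suc b)) (int (L - k)) (int (L - Suc k)) (set_arr (Suc b) (int (L - k)) (int (L - Suc k))
          (set_arr b (int (L - k)) 1 s)))"
      by (rule ctx_store[OF S(1)]) (use room' S(2) in \<open>auto simp: rule_ok_def\<close>)
    have "I k (set_reg 10 (int k) (set_reg 8 (int (L - k)) (set_reg 9 (int (L - k)) 
       (set_arr (Suc (Suc b)) (int (L - k)) (int (L - Suc k)) (set_arr (Suc b) (int (L - k)) (int (L - Suc k))
          (set_arr b (int (L - k)) 1 s))))))"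
      unfolding I_def using z c S by (intro exI[of _ "S[L - k := Concat (L - Suc k) (L - Suc k)]"]) auto
    moreover have "int (L - Suc k) + 1 = int (L - k)" using S(2) by simp
    ultimately have "vc M [Arith Add 9 8 7, Store b 9 7, Store (Suc b) 9 8,
      Store (Suc (Suc b)) 9 8, Arith Add 8 8 7, Arith Sub 10 10 7] (I k) s"
      using S(2) M room' by (simp add: ctx_regs[OF S(1)] S(3,4))
    with S(4) show ?thesis
      by (intro conjI wp_straight_end) auto
  qed
  \<comment> \<open>Cleared arrays encode \<open>Terminal 0\<close> in every rule, so rule
    \<open>0\<close> is already in place when the loop starts.\<close>
  have i: "I L (set_reg 10 (int L) (set_reg 9 0 (set_reg 8 0 s)))"
    unfolding I_def using assms room' by (intro exI[of _ "replicate n (Terminal 0)"]) (auto simp: zeros_def)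
  show ?thesis unfolding zeros_prog_def
    apply (rule wp_straight[of _ "[Const 8 0, Const 9 0, Arith Add 10 2 9]", simplified append.simps, where T' = "7 * L + 1"])
     apply (simp add: ctx_regs[OF assms])
    using M room' i  apply simp
     apply (rule wp_Loop[where I = I and k = L and Tq = 6 and Tp = 0])
    apply (auto simp: body I_def intro: wp_Nil)
    done
qed

lemma zeros_cong:
  "zeros k S \<Longrightarrow> length S' = length S \<Longrightarrow> (\<And>j. j \<le> k \<Longrightarrow> S' ! j = S ! j) \<Longrightarrow> zeros k S'"
  unfolding zeros_def by (meson order_trans perfect_cong)

lemma zeros_gen: "zeros L S \<Longrightarrow> k \<le> L \<Longrightarrow> gen S k (replicate (2 ^ k) 0)"
  unfolding zeros_def using perfect_gen by blast

section \<open>Inserting the elements of a set\<close>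

lemma and_1_drop_bit: "and (drop_bit k (int x)) 1 = of_bool (bit x k)"
  unfolding and_one_eq drop_bit_of_nat bit_iff_odd_drop_bit mod2_eq_if by simp

lemma drop_bit_le_M: "x < 2 ^ L \<Longrightarrow> drop_bit k (int x) \<le> M"
proof -
  assume "x < 2 ^ L"
  then have "int x < 2 ^ L" by (metis of_nat_less_iff of_nat_numeral of_nat_power)
  moreover have "drop_bit k (int x) \<le> int x"
    unfolding drop_bit_of_nat by (simp add: drop_bit_eq_div)
  moreover have "0 \<le> drop_bit k (int x)" by simp
  ultimately show ?thesis using M by linarith
qed

text \<open>One level of \<open>copy_path\<close>: register 13 is the current node, 11 the height
  still to go, 12 the element, 16 the rule being written and 17 the one below it. The child off the
  path is taken over from register 14 or 15. Adding a zeroed register is the way to copy a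
  register.\<close>

definition descend :: "instr list" where
  "descend =
     [Load 14 (Suc b) 13, Load 15 (Suc (Suc b)) 13, Arith Add 16 8 11, Store b 16 7,
      Arith Sub 11 11 7, Arith Add 17 8 11, Arith Shr 18 12 11, Arith And 18 18 7,
      Branch 18
        [Store (Suc b) 16 14, Store (Suc (Suc b)) 16 17, Const 14 0, Arith Add 13 14 15]
        [Store (Suc b) 16 17, Store (Suc (Suc b)) 16 15, Const 15 0, Arith Add 13 14 15]]"

text \<open>The target \<open>S'\<close> is fixed in advance: what remains of the recursion of
  \<open>copy_path\<close>, applied to the current rules, has to produce it. One iteration is one
  unfolding.\<close>

definition descending :: "nat \<Rightarrow> nat \<Rightarrow> nat \<Rightarrow> int rule list \<Rightarrow> nat list \<Rightarrow> nat list \<Rightarrow> nat \<Rightarrow> state \<Rightarrow> bool" where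
  "descending p x i S' xs ys k s \<longleftrightarrow> (\<exists>S cur w. ctx S xs ys s \<and> k \<le> L \<and> regs s 8 = int p \<and>
     regs s 10 = int i \<and> regs s 11 = int k \<and> regs s 12 = int x \<and> regs s 13 = int cur \<and>
     cur < p \<and> perfect S k cur w \<and> copy_path p x k cur S = S')"

lemma descendingI:
  assumes "ctx S xs ys s" "k \<le> L" "regs s 8 = int p" "regs s 10 = int i" "regs s 11 = int k"
    "regs s 12 = int x" "regs s 13 = int cur" "cur < p" "perfect S k cur w" "copy_path p x k cur S = S'"
  shows "descending p x i S' xs ys k s"
  using assms unfolding descending_def by blast

lemma wp_descend:
  assumes "descending p x i S' xs ys (Suc k) s" "p + L < n" "x < 2 ^ L"
  shows "regs s 11 > 0 \<and> wp M descend 14 (descending p x i S' xs ys k) s"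
proof -
  from assms(1) obtain S cur w where c: "ctx S xs ys s" and s: "Suc k \<le> L" "regs s 8 = int p"
     "regs s 10 = int i" "regs s 11 = int (Suc k)" "regs s 12 = int x" "regs s 13 = int cur"
     "cur < p" and pf: "perfect S (Suc k) cur w" and cp: "copy_path p x (Suc k) cur S = S'"
    unfolding descending_def by blast
  from pf obtain l r u v where *: "S ! cur = Concat l r" "l < cur" "r < cur" "perfect S k l u"
      "perfect S k r v" by auto
  have load: "arrs s (Suc b) (int cur) = int l" "arrs s (Suc (Suc b)) (int cur) = int r"
    using ctx_load_rule[OF c, of cur] s(1,7) assms(2) *(1) by auto
  have c1: "ctx (S[p + Suc k := Concat l (p + k)]) xs ys
      (set_arr (Suc (Suc b)) (int p + (1 + int k)) (int p + int k) (set_arr (Suc b) (int p + (1 + int k)) (int l)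
        (set_arr b (int p + (1 + int k)) 1 s)))"
    by (rule ctx_store[OF c]) (use assms(2) s(1,7) *(2,3) in \<open>auto simp: rule_ok_def\<close>)
  have c2: "ctx (S[p + Suc k := Concat (p + k) r]) xs ys
      (set_arr (Suc (Suc b)) (int p + (1 + int k)) (int r) (set_arr (Suc b) (int p + (1 + int k)) (int p + int k)
        (set_arr b (int p + (1 + int k)) 1 s)))"
    by (rule ctx_store[OF c]) (use assms(2) s(1,7) *(2,3) in \<open>auto simp: rule_ok_def\<close>)
  have p1: "perfect (S[p + Suc k := Concat l (p + k)]) k r v"
    using *(2-5) s(7) by (auto intro!: perfect_update)
  have p2: "perfect (S[p + Suc k := Concat (p + k) r]) k l u"
    using *(2-5) s(7) by (auto intro!: perfect_update)
  have bounds: "int p + (1 + int k) \<le> M" "int p + int k \<le> M" "int k \<le> M" "int l \<le> M" "int r \<le> M"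
    using assms(2) s(1,7) *(2,3) M by linarith+
  note simps = s load ctx_regs[OF c] and_1_drop_bit drop_bit_le_M[OF assms(3)]
  show ?thesis
    unfolding descend_def
    apply (intro conjI)
    subgoal using s by simp
    apply (rule wp_straight_end)
    using room' s(1) bounds
     apply (simp add: simps)
    apply (intro conjI impI)
    subgoal by (rule descendingI[where S = "S[p + Suc k := Concat l (p + k)]" and cur = r and w = v])
       (use c1 p1 s * cp in \<open>auto split: if_splits\<close>)
    subgoal by (rule descendingI[where S = "S[p + Suc k := Concat (p + k) r]" and cur = l and w = u])
       (use c2 p2 s * cp in \<open>auto split: if_splits\<close>)
    apply simp
    done
qed


definition insert_body :: "instr list" where
  "insert_body =
     [Arith Sub 10 10 7, Load 12 xa 10, Const 13 0, Store xa 10 13, Arith Add 13 9 13,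
      Const 14 0, Arith Add 11 2 14] @
     Loop 11 descend #
     [Const 14 0, Store b 8 14, Store (Suc b) 8 7, Store (Suc (Suc b)) 8 14,
      Arith Add 9 8 2, Arith Add 8 9 7]"

text \<open>The array is consumed from its end: \<open>take k xs\<close> is still stored,
  \<open>drop k xs\<close> is in the tree. Besides the zeros, each insertion so far has used
  \<open>L + 1\<close> rules, whence the value of \<open>p\<close>.\<close>

definition inserting :: "nat list \<Rightarrow> nat list \<Rightarrow> nat \<Rightarrow> state \<Rightarrow> bool" where
  "inserting xs ys k s \<longleftrightarrow> (\<exists>S p rt. ctx S (take k xs) ys s \<and> k \<le> length xs \<and>
     regs s 8 = int p \<and> regs s 9 = int rt \<and> regs s 10 = int k \<and> rt < p \<and>
     p = (L + 1) * (1 + (length xs - k)) \<and> zeros L S \<and>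
     perfect S L rt (indicator_list (2 ^ L) (set (drop k xs))))"

lemma insertingI:
  assumes "ctx S (take k xs) ys s" "k \<le> length xs" "regs s 8 = int p" "regs s 9 = int rt"
    "regs s 10 = int k" "rt < p" "p = (L + 1) * (1 + (length xs - k))" "zeros L S"
    "perfect S L rt (indicator_list (2 ^ L) (set (drop k xs)))"
  shows "inserting xs ys k s"
  using assms unfolding inserting_def by blast

lemma wp_insert_body:
  assumes "inserting xs ys (Suc k) s" "length xs = 2 * m" "\<forall>x\<in>set xs. x < 2 ^ L"
  shows "regs s 10 > 0 \<and> wp M insert_body (15 * L + 14) (inserting xs ys k) s"
proof -
  from assms(1) obtain S p rt where c: "ctx S (take (Suc k) xs) ys s" and
    s: "Suc k \<le> length xs" "regs s 8 = int p" "regs s 9 = int rt" "regs s 10 = int (Suc k)"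
      "rt < p" and p: "p = (L + 1) * (1 + (length xs - Suc k))" and z: "zeros L S" and
    pf: "perfect S L rt (indicator_list (2 ^ L) (set (drop (Suc k) xs)))"
    unfolding inserting_def by blast
  define x where "x = xs ! k"
  define S' where "S' = copy_path p x L rt S"
  have x: "x < 2 ^ L" using assms(3) s(1) by (simp add: x_def)
  have tk: "take (Suc k) xs = take k xs @ [x]" using s(1) by (simp add: take_Suc_conv_app_nth x_def)
  have dr: "drop k xs = x # drop (Suc k) xs" using s(1) by (simp add: Cons_nth_drop_Suc x_def)
  have lk: "int (length (take k xs)) = int k" using s(1) by simp
  have "length xs - k = Suc (length xs - Suc k)" using s(1) by simp
  then have p': "p + (L + 1) = (L + 1) * (1 + (length xs - k))" unfolding p by (simp only: mult_Suc_right) simp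
  also have "\<dots> \<le> (L + 1) * (3 * m + 1)" using assms(2) by (intro mult_left_mono) auto
  finally have pn: "p + (L + 1) < n" using room room' by linarith
  have Lp: "L < p" by (simp add: p)
  have zeros': "zeros L S'" using z
    by (rule zeros_cong) (use Lp in \<open>auto simp: S'_def copy_path_nth\<close>)
  have "perfect S' L (p + L) ((indicator_list (2 ^ L) (set (drop (Suc k) xs)))[x mod 2 ^ L := 1])"
    unfolding S'_def by (rule perfect_copy_path[OF pf]) (use s pn ctx_regs(5)[OF c] in auto)
  then have pf': "perfect S' L (p + L) (indicator_list (2 ^ L) (set (drop k xs)))"
    using x by (simp add: indicator_list_update dr)
  have load: "arrs s xa (int k) = int x" using ctx_load_x[OF c[unfolded tk]] lk by simp
  have c0: "ctx S (take k xs) ys (set_arr xa (int k) 0 s)"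
    using ctx_pop_x[OF c[unfolded tk]] lk by simp
  have bounds: "int p + (1 + int L) < M" "int p + int L < M" "int k < M" "int rt < M" "int x \<le> M" "int L < M"
    using pn M s(1,5) room' assms(2) drop_bit_le_M[OF x, of 0] by simp_all
  define J where "J = descending p x k S' (take k xs) ys"
  define post where "post = [Const 14 0, Store b 8 14, Store (Suc b) 8 7, Store (Suc (Suc b)) 8 14,
      Arith Add 9 8 2, Arith Add 8 9 7]"
  have start: "J L (set_reg 11 (int L) (set_reg 14 0 (set_reg 13 (int rt) (set_reg 12 (int x)
      (set_reg 10 (int k) (set_arr xa (int k) 0 s))))))"
    unfolding J_def
    by (rule descendingI[where S = S and cur = rt and w = "indicator_list (2 ^ L) (set (drop (Suc k) xs))"])
      (use c0 s pf in \<open>auto simp: S'_def\<close>)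
  have loop: "wp M (Loop 11 descend # post) (15 * L + 7) (inserting xs ys k) s1" if "J L s1" for s1
  proof (rule wp_Loop[where I = J and k = L and Tq = 14 and Tp = 6, OF that])
    show "0 < regs s 11 \<and> wp M descend 14 (J j) s" if "J (Suc j) s" for j s
      using wp_descend that pn x unfolding J_def by simp
    show "\<not> 0 < regs s 11" if "J 0 s" for s
      using that unfolding J_def descending_def by auto
    show "wp M post 6 (inserting xs ys k) s2" if "J 0 s2" for s2
    proof -
      \<comment> \<open>At height \<open>0\<close> all that is left of \<open>copy_path\<close> is
        the leaf in rule \<open>p\<close>, which the code after the loop writes.\<close>
      from that obtain S0 cur where s2: "ctx S0 (take k xs) ys s2" "regs s2 8 = int p" "regs s2 10 = int k"
         "S0[p := Terminal 1] = S'" unfolding J_def descending_def by auto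
      have c2: "ctx S' (take k xs) ys (set_arr (Suc (Suc b)) (int p) 0 (set_arr (Suc b) (int p) 1 (set_arr b (int p) 0 s2)))"
        using ctx_store[OF s2(1) refl, of p "Terminal 1"] pn s2(4) by (simp add: rule_ok_def)
      show ?thesis
        unfolding post_def
        apply (rule wp_straight_end)
        using bounds room' apply (simp add: ctx_regs[OF s2(1)] s2(2,3))
         apply (rule insertingI[where S = S' and p = "p + (L + 1)" and rt = "p + L", OF _ _ _ _ _ _ p' zeros' pf'])
        using c2 s s2 apply simp_all
        done
    qed
  qed simp
  show ?thesis
  proof
    show "wp M insert_body (15 * L + 14) (inserting xs ys k) s"
      unfolding insert_body_def post_def[symmetric]
      apply (rule wp_straight[where T' = "15 * L + 7"])
      using bounds room' s(1) loop[OF start]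
      apply (simp_all add: ctx_regs[OF c] s load)
      done
  qed (use s in simp)
qed

definition insert_prog :: "instr list" where
  "insert_prog = [Const 10 0, Arith Add 9 8 10, Arith Add 8 8 7, Arith Add 10 0 0, Loop 10 insert_body]"

lemma wp_insert:
  assumes "ctx S xs ys s" "regs s 8 = int L" "zeros L S" "length xs = 2 * m" "\<forall>x\<in>set xs. x < 2 ^ L"
  shows "wp M insert_prog (2 * m * (15 * L + 15) + 5) (\<lambda>s. \<exists>S rt. ctx S [] ys s \<and>
     regs s 8 = int ((L + 1) * (2 * m + 1)) \<and> regs s 9 = int rt \<and> rt < (L + 1) * (2 * m + 1) \<and>
     zeros L S \<and> gen S rt (indicator_list (2 ^ L) (set xs))) s"
proof -
  have start: "inserting xs ys (2 * m) (set_reg 10 (2 * int m) (set_reg 8 (int L + 1) (set_reg 9 (int L) (set_reg 10 0 s))))"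
    by (rule insertingI[where S = S and p = "L + 1" and rt = L])
      (use assms in \<open>auto simp: zeros_def indicator_list_empty\<close>)
  have loop: "wp M [Loop 10 insert_body] (2 * m * (15 * L + 15) + 1) (\<lambda>s. \<exists>S rt. ctx S [] ys s \<and>
     regs s 8 = int ((L + 1) * (2 * m + 1)) \<and> regs s 9 = int rt \<and> rt < (L + 1) * (2 * m + 1) \<and>
     zeros L S \<and> gen S rt (indicator_list (2 ^ L) (set xs))) s1" if "inserting xs ys (2 * m) s1" for s1
  proof (rule wp_Loop[where I = "inserting xs ys", OF that, where Tp = 0 and Tq = "15 * L + 14"])
    show "0 < regs s 10 \<and> wp M insert_body (15 * L + 14) (inserting xs ys k) s"
      if "inserting xs ys (Suc k) s" for k s
      using wp_insert_body[OF that assms(4,5)] .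
    show "\<not> 0 < regs s 10" if "inserting xs ys 0 s" for s
      using that unfolding inserting_def by auto
    show "wp M [] 0 (\<lambda>s. \<exists>S rt. ctx S [] ys s \<and>
     regs s 8 = int ((L + 1) * (2 * m + 1)) \<and> regs s 9 = int rt \<and> rt < (L + 1) * (2 * m + 1) \<and>
     zeros L S \<and> gen S rt (indicator_list (2 ^ L) (set xs))) s" if "inserting xs ys 0 s" for s
    proof -
      from that obtain S p rt where "ctx S (take 0 xs) ys s" "regs s 8 = int p" "regs s 9 = int rt"
        "rt < p" "p = (L + 1) * (1 + (length xs - 0))" "zeros L S"
        "perfect S L rt (indicator_list (2 ^ L) (set (drop 0 xs)))"
        unfolding inserting_def by blast
      then show ?thesis using assms(4)
        by (intro wp_Nil exI[of _ S] exI[of _ rt]) (auto intro: perfect_gen)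
    qed
  qed simp
  show ?thesis unfolding insert_prog_def
    apply (rule wp_straight[of _ "[Const 10 0, Arith Add 9 8 10, Arith Add 8 8 7, Arith Add 10 0 0]",
        simplified append.simps, where T' = "2 * m * (15 * L + 15) + 1"])
    using M room' loop[OF start] apply (simp_all add: ctx_regs[OF assms(1)] assms(2))
    done
qed


section \<open>Shifting a vector bit by bit\<close>

definition shift_step :: "instr list" where
  "shift_step =
     [Store b 8 7, Arith Shr 18 12 11, Arith And 18 18 7,
      Branch 18 [Store (Suc b) 8 11, Store (Suc (Suc b)) 8 13]
                [Store (Suc b) 8 13, Store (Suc (Suc b)) 8 11],
      Const 13 0, Arith Add 13 8 13, Arith Add 8 8 7, Arith Add 11 11 7, Arith Sub 14 14 7]"

text \<open>\<open>p\<close> is the first rule of the current block, \<open>j\<close> the number of bits that remain.\<close>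

definition shifting :: "nat \<Rightarrow> nat \<Rightarrow> nat \<Rightarrow> nat \<Rightarrow> nat \<Rightarrow> nat list \<Rightarrow> int list \<Rightarrow> int list \<Rightarrow> nat \<Rightarrow> state \<Rightarrow> bool" where
  "shifting p y i rt acc ys v w j s \<longleftrightarrow> (\<exists>S k cur. ctx S [] ys s \<and> k + j = L \<and>
     regs s 8 = int (p + k) \<and> regs s 9 = int rt \<and> regs s 10 = int i \<and> regs s 11 = int k \<and>
     regs s 12 = int y \<and> regs s 13 = int cur \<and> regs s 14 = int j \<and> regs s 19 = int acc \<and>
     cur < p + k \<and> zeros L S \<and> gen S rt w \<and> gen S acc v \<and> gen S cur (shifted k y w))"

lemma shiftingI:
  assumes "ctx S [] ys s" "k + j = L" "regs s 8 = int (p + k)" "regs s 9 = int rt" "regs s 10 = int i"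
    "regs s 11 = int k" "regs s 12 = int y" "regs s 13 = int cur" "regs s 14 = int j" "regs s 19 = int acc"
    "cur < p + k" "zeros L S" "gen S rt w" "gen S acc v" "gen S cur (shifted k y w)"
  shows "shifting p y i rt acc ys v w j s"
  using assms unfolding shifting_def by blast

text \<open>Register 11 is both the bit position \<open>k\<close> and the index of the rule with
  \<open>2 ^ k\<close> zeros; the new rule joins it to the current string on the side that bit
  \<open>k\<close> demands, as in \<open>shifted_Suc\<close>.\<close>

lemma wp_shift_step:
  assumes "shifting p y i rt acc ys v w (Suc j) s" "p + L < n" "y < 2 ^ L" "L < p" "rt < p" "acc < p"
  shows "regs s 14 > 0 \<and> wp M shift_step 11 (shifting p y i rt acc ys v w j) s"
proof -
  from assms(1) obtain S k cur where c: "ctx S [] ys s" and kj: "k + Suc j = L" and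
    s: "regs s 8 = int (p + k)" "regs s 9 = int rt" "regs s 10 = int i" "regs s 11 = int k"
     "regs s 12 = int y" "regs s 13 = int cur" "regs s 14 = int (Suc j)" "regs s 19 = int acc" and
    cur: "cur < p + k" and z: "zeros L S" and g: "gen S rt w" "gen S acc v" "gen S cur (shifted k y w)"
    unfolding shifting_def by blast
  have len: "length S = n" using ctx_regs(5)[OF c] .
  have zk: "gen S k (replicate (2 ^ k) 0)" using z kj by (intro zeros_gen) auto
  define r :: "int rule" where "r = (if bit y k then Concat k cur else Concat cur k)"
  define S' where "S' = S[p + k := r]"
  have z': "zeros L S'" unfolding S'_def using z assms(4) by (auto intro: zeros_update)
  have g': "gen S' rt w" "gen S' acc v" "gen S' cur (shifted k y w)" "gen S' k (replicate (2 ^ k) 0)"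
    unfolding S'_def using g zk assms cur kj by (auto intro!: gen_update)
  have new: "gen S' (p + k) (shifted (Suc k) y w)"
  proof (cases "bit y k")
    case True
    have "gen S' (p + k) (replicate (2 ^ k) 0 @ shifted k y w)"
      by (rule gen_Concat[of _ _ k cur])
        (use True g' assms(2,4) cur kj len in \<open>auto simp: S'_def r_def\<close>)
    with True show ?thesis by (simp add: shifted_Suc)
  next
    case False
    have "gen S' (p + k) (shifted k y w @ replicate (2 ^ k) 0)"
      by (rule gen_Concat[of _ _ cur k])
        (use False g' assms(2,4) cur kj len in \<open>auto simp: S'_def r_def\<close>)
    with False show ?thesis by (simp add: shifted_Suc)
  qed
  have ok: "rule_ok {0, 1} (p + k) r" using assms(4) cur kj by (auto simp: r_def rule_ok_def)
  have c': "ctx S' [] ys (set_arr (Suc (Suc b)) (int p + int k) (rule_arg2 r)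
      (set_arr (Suc b) (int p + int k) (rule_arg1 r) (set_arr b (int p + int k) 1 s)))"
    unfolding S'_def by (rule ctx_store[OF c _ _ ok]) (use assms(2) kj in \<open>auto simp: r_def\<close>)
  have bounds: "int p + int k < M" "int k < M" "int cur < M" "int j < M" "int L < M" "1 < M"
    using assms(2) kj cur M room' by linarith+
  have args: "bit y k \<Longrightarrow> rule_arg1 r = int k" "bit y k \<Longrightarrow> rule_arg2 r = int cur"
    "\<not> bit y k \<Longrightarrow> rule_arg1 r = int cur" "\<not> bit y k \<Longrightarrow> rule_arg2 r = int k"
    by (auto simp: r_def)
  show ?thesis
    apply (intro conjI)
    subgoal using s by simp
    unfolding shift_step_def
    apply (rule wp_straight_end)
    using bounds
     apply (simp add: ctx_regs[OF c] s and_1_drop_bit drop_bit_le_M[OF assms(3)])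
    apply (intro conjI impI)
    subgoal by (rule shiftingI[where S = S' and k = "Suc k" and cur = "p + k"])
       (use c' args kj s z' g' new in \<open>auto split: if_splits\<close>)
    subgoal by (rule shiftingI[where S = S' and k = "Suc k" and cur = "p + k"])
       (use c' args kj s z' g' new in \<open>auto split: if_splits\<close>)
    apply simp
    done
qed

section \<open>Concatenating the shifted blocks\<close>

definition block_body :: "instr list" where
  "block_body =
     [Arith Sub 10 10 7, Load 12 ya 10, Const 11 0, Store ya 10 11, Arith Add 13 9 11, Arith Add 14 2 11] @
     Loop 14 shift_step #
     [Store b 8 7, Store (Suc b) 8 19, Store (Suc (Suc b)) 8 13, Const 19 0, Arith Add 19 8 19,
      Arith Add 8 8 7]"

text \<open>The shifts in \<open>drop k ys\<close> are done; each has used \<open>L\<close> rules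
  for shifting the tree \<open>rt\<close> and one for joining the block to the string of rule
  \<open>acc\<close>.\<close>

definition blocks :: "nat list \<Rightarrow> int list \<Rightarrow> nat \<Rightarrow> state \<Rightarrow> bool" where
  "blocks ys w k s \<longleftrightarrow> (\<exists>S p rt acc. ctx S [] (take k ys) s \<and> k \<le> length ys \<and>
     regs s 8 = int p \<and> regs s 9 = int rt \<and> regs s 10 = int k \<and> regs s 19 = int acc \<and>
     rt < p \<and> acc < p \<and> p = (L + 1) * (2 * m + 1 + (length ys - k)) \<and> zeros L S \<and>
     gen S rt w \<and> gen S acc (0 # concat (map (\<lambda>y. shifted L y w) (rev (drop k ys)))))"

lemma blocksI:
  assumes "ctx S [] (take k ys) s" "k \<le> length ys" "regs s 8 = int p" "regs s 9 = int rt"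
    "regs s 10 = int k" "regs s 19 = int acc" "rt < p" "acc < p"
    "p = (L + 1) * (2 * m + 1 + (length ys - k))" "zeros L S" "gen S rt w"
    "gen S acc (0 # concat (map (\<lambda>y. shifted L y w) (rev (drop k ys))))"
  shows "blocks ys w k s"
  using assms unfolding blocks_def by blast

lemma wp_block_body:
  assumes "blocks ys w (Suc k) s" "length ys = m" "\<forall>y\<in>set ys. y < 2 ^ L"
  shows "regs s 10 > 0 \<and> wp M block_body (12 * L + 13) (blocks ys w k) s"
proof -
  define v where "v = 0 # concat (map (\<lambda>y. shifted L y w) (rev (drop (Suc k) ys)))"
  from assms(1) obtain S p rt acc where c: "ctx S [] (take (Suc k) ys) s" and
    s: "Suc k \<le> length ys" "regs s 8 = int p" "regs s 9 = int rt" "regs s 10 = int (Suc k)"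
      "regs s 19 = int acc" "rt < p" "acc < p" and
    p: "p = (L + 1) * (2 * m + 1 + (length ys - Suc k))" and z: "zeros L S" and
    g: "gen S rt w" "gen S acc v"
    unfolding blocks_def v_def by blast
  define y where "y = ys ! k"
  have y: "y < 2 ^ L" using assms(3) s(1) by (simp add: y_def)
  have tk: "take (Suc k) ys = take k ys @ [y]" using s(1) by (simp add: take_Suc_conv_app_nth y_def)
  have dr: "drop k ys = y # drop (Suc k) ys" using s(1) by (simp add: Cons_nth_drop_Suc y_def)
  have lk: "int (length (take k ys)) = int k" using s(1) by simp
  have "length ys - k = Suc (length ys - Suc k)" using s(1) by simp
  then have p': "p + (L + 1) = (L + 1) * (2 * m + 1 + (length ys - k))"
    unfolding p by (simp only: mult_Suc_right add_Suc_right)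
  also have "\<dots> \<le> (L + 1) * (3 * m + 1)" using assms(2) by (intro mult_left_mono) auto
  finally have pn: "p + (L + 1) < n" using room room' by linarith
  have Lp: "L < p" by (simp add: p)
  have load: "arrs s ya (int k) = int y" using ctx_load_y[OF c[unfolded tk]] lk by simp
  have c0: "ctx S [] (take k ys) (set_arr ya (int k) 0 s)"
    using ctx_pop_y[OF c[unfolded tk]] lk by simp
  have bounds: "int p + (1 + int L) < M" "int p + int L < M" "int k < M" "int rt < M" "int y \<le> M" "int L < M"
    "1 < M"
    using pn M s(1,6) room' assms(2) drop_bit_le_M[OF y, of 0] by simp_all
  define J where "J = shifting p y k rt acc (take k ys) v w"
  define post where "post = [Store b 8 7, Store (Suc b) 8 19, Store (Suc (Suc b)) 8 13, Const 19 0,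
      Arith Add 19 8 19, Arith Add 8 8 7]"
  have start: "J L (set_reg 14 (int L) (set_reg 13 (int rt) (set_reg 11 0 (set_reg 12 (int y)
      (set_reg 10 (int k) (set_arr ya (int k) 0 s))))))"
    unfolding J_def
    by (rule shiftingI[where S = S and cur = rt and k = 0])
      (use c0 s z g in \<open>auto simp: shifted_0\<close>)
  have loop: "wp M (Loop 14 shift_step # post) (12 * L + 7) (blocks ys w k) s1" if "J L s1" for s1
  proof (rule wp_Loop[where I = J and k = L and Tq = 11 and Tp = 6, OF that])
    show "0 < regs s 14 \<and> wp M shift_step 11 (J j) s" if "J (Suc j) s" for j s
      using wp_shift_step that pn y s Lp unfolding J_def by simp
    show "\<not> 0 < regs s 14" if "J 0 s" for s
      using that unfolding J_def shifting_def by auto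
    show "wp M post 6 (blocks ys w k) s2" if "J 0 s2" for s2
    proof -
      from that obtain S0 cur where c0: "ctx S0 [] (take k ys) s2" and
         s2: "regs s2 8 = int (p + L)" "regs s2 9 = int rt" "regs s2 10 = int k"
           "regs s2 13 = int cur" "regs s2 19 = int acc" "cur < p + L" and
         z0: "zeros L S0" and g0: "gen S0 rt w" "gen S0 acc v" "gen S0 cur (shifted L y w)"
        unfolding J_def shifting_def by auto
      define S' where "S' = S0[p + L := Concat acc cur]"
      have c2: "ctx S' [] (take k ys) (set_arr (Suc (Suc b)) (int p + int L) (int cur)
          (set_arr (Suc b) (int p + int L) (int acc) (set_arr b (int p + int L) 1 s2)))"
        unfolding S'_def
        by (rule ctx_store[OF c0]) (use pn s s2 in \<open>auto simp: rule_ok_def\<close>)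
      have z': "zeros L S'" unfolding S'_def using z0 Lp by (auto intro: zeros_update)
      have g': "gen S' rt w" "gen S' acc v" "gen S' cur (shifted L y w)"
        unfolding S'_def using g0 s s2 by (auto intro!: gen_update)
      have new: "gen S' (p + L) (v @ shifted L y w)"
        by (rule gen_Concat[of _ _ acc cur]) (use g' pn s s2 ctx_regs(5)[OF c0] in \<open>auto simp: S'_def\<close>)
      have v: "v @ shifted L y w = 0 # concat (map (\<lambda>y. shifted L y w) (rev (drop k ys)))"
        by (simp add: v_def dr)
      show ?thesis
        unfolding post_def
        apply (rule wp_straight_end)
        using bounds apply (simp add: ctx_regs[OF c0] s2)
         apply (rule blocksI[where S = S' and p = "p + (L + 1)" and rt = rt and acc = "p + L", OF _ _ _ _ _ _ _ _ p' z'])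
        using c2 s s2 g' new v apply (simp_all del: One_nat_def)
        done
    qed
  qed simp
  show ?thesis
  proof
    show "wp M block_body (12 * L + 13) (blocks ys w k) s"
      unfolding block_body_def post_def[symmetric]
      apply (rule wp_straight[where T' = "12 * L + 7"])
      using bounds s(1) loop[OF start]
      apply (simp_all add: ctx_regs[OF c] s load)
      done
  qed (use s in simp)
qed

definition blocks_prog :: "instr list" where
  "blocks_prog = [Const 19 0, Arith Add 10 0 19] @ Loop 10 block_body #
     [Arith Sub 11 3 7, Const 12 0, Store b 11 7, Store (Suc b) 11 19, Store (Suc (Suc b)) 11 12]"

definition built :: "nat list \<Rightarrow> nat list \<Rightarrow> state \<Rightarrow> bool" where
  "built xs ys s \<longleftrightarrow> (\<exists>S. ctx S [] [] s \<and> gen S (n - 1) (block_string L xs ys))"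

lemma wp_blocks:
  assumes "ctx S [] ys s" "regs s 8 = int ((L + 1) * (2 * m + 1))" "regs s 9 = int rt"
    "rt < (L + 1) * (2 * m + 1)" "zeros L S" "gen S rt (indicator_list (2 ^ L) (set xs))"
    "length ys = m" "\<forall>y\<in>set ys. y < 2 ^ L"
  shows "wp M blocks_prog (m * (12 * L + 14) + 8) (built xs ys) s"
proof -
  define w where "w = indicator_list (2 ^ L) (set xs)"
  define post where "post = [Arith Sub 11 3 7, Const 12 0, Store b 11 7, Store (Suc b) 11 19, Store (Suc (Suc b)) 11 12]"
  have z0: "gen S 0 [0]" using zeros_gen[OF assms(5), of 0] by simp
  have start: "blocks ys w m (set_reg 10 (int m) (set_reg 19 0 s))"
    by (rule blocksI[where S = S and p = "(L + 1) * (2 * m + 1)" and rt = rt and acc = 0])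
      (use assms z0 in \<open>auto simp: w_def\<close>)
  have loop: "wp M (Loop 10 block_body # post) (m * (12 * L + 14) + 6) (built xs ys) s1"
    if "blocks ys w m s1" for s1
  proof (rule wp_Loop[where I = "blocks ys w", OF that, where Tp = 5 and Tq = "12 * L + 13"])
    show "0 < regs s 10 \<and> wp M block_body (12 * L + 13) (blocks ys w k) s"
      if "blocks ys w (Suc k) s" for k s
      using wp_block_body[OF that assms(7,8)] .
    show "\<not> 0 < regs s 10" if "blocks ys w 0 s" for s
      using that unfolding blocks_def by auto
    show "wp M post 5 (built xs ys) s" if "blocks ys w 0 s" for s
    proof -
      define v where "v = 0 # concat (map (\<lambda>y. shifted L y w) (rev ys))"
      from that obtain S p rt acc where c: "ctx S [] [] s" and
        s: "regs s 8 = int p" "regs s 19 = int acc" "acc < p" "p = (L + 1) * (2 * m + 1 + length ys)" and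
        z: "zeros L S" and g: "gen S acc v"
        unfolding blocks_def v_def by auto
      have "p = (L + 1) * (3 * m + 1)" using s(4) assms(7) by simp
      then have pn: "p < n" using room by simp
      \<comment> \<open>An SLP generates the string of its last rule, so the result goes to rule
        \<open>n - 1\<close>; the right operand is rule \<open>0\<close>, which adds the trailing
        zero.\<close>
      define S' where "S' = S[n - 1 := Concat acc 0]"
      have eq: "int n - 1 = int (n - 1)" using pn by simp
      have c2: "ctx S' [] [] (set_arr (Suc (Suc b)) (int n - 1) 0
          (set_arr (Suc b) (int n - 1) (int acc) (set_arr b (int n - 1) 1 s)))"
        unfolding S'_def
        by (rule ctx_store[OF c eq]) (use pn s(3) in \<open>auto simp: rule_ok_def\<close>)
      have g0: "gen S 0 [0]" using zeros_gen[OF z, of 0] by simp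
      have g': "gen S' acc v" "gen S' 0 [0]"
        unfolding S'_def using g g0 pn s(3) by (auto intro!: gen_update)
      have "gen S' (n - 1) (v @ [0])"
        by (rule gen_Concat[of _ _ acc 0]) (use g' pn s ctx_regs(5)[OF c] in \<open>auto simp: S'_def\<close>)
      then have "built xs ys (set_reg 12 0 (set_reg 11 (int n - 1) (set_arr (Suc (Suc b)) (int n - 1) 0
          (set_arr (Suc b) (int n - 1) (int acc) (set_arr b (int n - 1) 1 s)))))"
        unfolding built_def using c2 by (intro exI[of _ S']) (simp add: block_string_def v_def w_def)
      then show ?thesis
        unfolding post_def
        apply (intro wp_straight_end)
        using M room' apply (simp_all add: ctx_regs[OF c] s)
        done
    qed
  qed simp
  show ?thesis unfolding blocks_prog_def post_def[symmetric]
    apply (rule wp_straight[where T' = "m * (12 * L + 14) + 6"])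
    using M room' loop[OF start] apply (simp_all add: ctx_regs[OF assms(1)])
    done
qed

definition build :: "instr list" where
  "build = zeros_prog @ insert_prog @ blocks_prog"

lemma wp_build:
  assumes "ctx (replicate n (Terminal 0)) xs ys s" "length xs = 2 * m" "\<forall>x\<in>set xs. x < 2 ^ L"
    "length ys = m" "\<forall>y\<in>set ys. y < 2 ^ L"
  shows "wp M build (20 * n) (built xs ys) s"
  unfolding build_def
proof (rule wp_append[OF wp_zeros[OF assms(1)]])
  fix s assume "\<exists>S. ctx S xs ys s \<and> regs s 8 = int L \<and> zeros L S"
  then obtain S where S: "ctx S xs ys s" "regs s 8 = int L" "zeros L S" by blast
  show "wp M (insert_prog @ blocks_prog) (2 * m * (15 * L + 15) + 5 + (m * (12 * L + 14) + 8)) (built xs ys) s"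
  proof (rule wp_append[OF wp_insert[OF S assms(2,3)]])
    fix s assume "\<exists>S rt. ctx S [] ys s \<and> regs s 8 = int ((L + 1) * (2 * m + 1)) \<and> regs s 9 = int rt \<and>
      rt < (L + 1) * (2 * m + 1) \<and> zeros L S \<and> gen S rt (indicator_list (2 ^ L) (set xs))"
    then show "wp M blocks_prog (m * (12 * L + 14) + 8) (built xs ys) s"
      using wp_blocks[OF _ _ _ _ _ _ assms(4,5)] by blast
  qed simp
next
  \<comment> \<open>\<open>20 * n\<close> dominates the three running times, since
    \<open>20 * room\<close> has the leading term \<open>60 * m * L\<close> against
    \<open>42 * m * L\<close>.\<close>
  have "20 * ((L + 1) * (3 * m + 1)) = 60 * (m * L) + 60 * m + 20 * L + 20" by (simp add: algebra_simps)
  moreover have "(7 * L + 4) + (2 * m * (15 * L + 15) + 5 + (m * (12 * L + 14) + 8)) =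
    42 * (m * L) + 44 * m + 7 * L + 17" by (simp add: algebra_simps)
  ultimately show "(7 * L + 4) + (2 * m * (15 * L + 15) + 5 + (m * (12 * L + 14) + 8)) \<le> 20 * n"
    using room by linarith
qed

end

section \<open>Parameters of the reduction\<close>

definition log_ceil :: "nat \<Rightarrow> nat" where
  "log_ceil m = (LEAST l. m \<le> 2 ^ l)"

text \<open>\<open>2 ^ depth k c0 m\<close> is \<open>m powr (3 + 1 / k)\<close> up to constants.
  The hash range \<open>R\<close> is only half of it, with exponent \<open>depth k c0 m - 1\<close>,
  so that \<open>h b + 1\<close> and \<open>h c + R\<close> are still below
  \<open>2 ^ depth k c0 m\<close>.\<close>

definition depth :: "nat \<Rightarrow> nat \<Rightarrow> nat \<Rightarrow> nat" where
  "depth k c0 m = 3 * log_ceil m + log_ceil m div k + c0"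

definition vec_len :: "nat \<Rightarrow> nat \<Rightarrow> nat \<Rightarrow> nat" where
  "vec_len k c0 m = 2 + m * (2 ^ Suc (depth k c0 m) - 1)"

text \<open>\<open>P / D\<close> stands for the fourth power of the proportionality constant;
  comparing fourth powers keeps the search within the integers.\<close>

definition slp_size :: "nat \<Rightarrow> nat \<Rightarrow> nat \<Rightarrow> nat" where
  "slp_size P D N = (LEAST n. P * N \<le> D * n ^ 4)"

lemma log_ceil: "m \<le> 2 ^ log_ceil m"
  unfolding log_ceil_def by (rule LeastI[of _ m]) (simp add: less_imp_le)

lemma less_log_ceil: "j < log_ceil m \<Longrightarrow> 2 ^ j < m"
  unfolding log_ceil_def using not_less_Least leI by blast

lemma slp_size:
  assumes "0 < D"
  shows "P * N \<le> D * slp_size P D N ^ 4"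
  unfolding slp_size_def
proof (rule LeastI)
  have "P * N \<le> (P * N) ^ 4"
    by (cases "P * N = 0") (use power_increasing[of 1 4 "P * N"] in auto)
  also have "\<dots> \<le> D * (P * N) ^ 4" using assms by simp
  finally show "P * N \<le> D * (P * N) ^ 4" .
qed

lemma less_slp_size: "j < slp_size P D N \<Longrightarrow> D * j ^ 4 < P * N"
  unfolding slp_size_def using not_less_Least leI by blast

text \<open>\<open>M\<close> has to bound every intermediate value: the constants in the program
  text, the powers of two, the product \<open>r * x\<close> with \<open>r < U * R\<close> and
  \<open>x \<le> U\<close>, and both sides of the test that finds the size.\<close>

locale reduction =
  fixes k c0 P D m U :: nat and M :: int
  assumes pos: "0 < k" "1 < c0" "0 < P" "0 < D" "0 < m" "m \<le> U"
    and room: "(depth k c0 m + 1) * (3 * m + 1) < slp_size P D (vec_len k c0 m)"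
    and M: "3 \<le> M" "int k \<le> M" "int c0 \<le> M" "int P \<le> M" "int D \<le> M"
      "int (slp_size P D (vec_len k c0 m)) < M" "2 ^ Suc (depth k c0 m) \<le> M"
      "int U * (int U * 2 ^ (depth k c0 m - 1)) \<le> M"
      "int (P * vec_len k c0 m) \<le> M" "int (D * slp_size P D (vec_len k c0 m) ^ 4) \<le> M"
begin

abbreviation "l \<equiv> log_ceil m"
abbreviation "L \<equiv> depth k c0 m"
abbreviation "N \<equiv> vec_len k c0 m"
abbreviation "n \<equiv> slp_size P D N"
abbreviation R :: int where "R \<equiv> 2 ^ (L - 1)"

lemma L_pos: "0 < L" and U_pos: "0 < U" and R_pos: "0 < R" and l_le: "l \<le> L"
  using pos by (auto simp: depth_def)

lemma double_R: "2 * R = 2 ^ L"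
  using L_pos by (cases L) auto

text \<open>The first string has its rules in arrays 0 to 2, its set in 7 and its shifts in 6. The
  second has them in 3 to 5, 8 and 9; the hashing does not write to array 9, which thus already
  holds \<open>m\<close> zero shifts.\<close>

sublocale B1: builder M m L n 0 7 6 G for G
  by unfold_locales (use room M in auto)

sublocale B2: builder M m L n 3 8 9 G for G
  by unfold_locales (use room M in auto)

lemma M_ge: "int m \<le> M" "int U \<le> M" "R \<le> M" "2 ^ l \<le> M" "int U * R \<le> M" "int L \<le> M" "int l \<le> M"
    "0 \<le> M"
proof -
  have UR: "1 * 1 \<le> int U * R" using U_pos by (intro mult_mono) auto
  then have "1 * (int U * R) \<le> int U * (int U * R)" using U_pos by (intro mult_mono) auto
  with M(8) show "int U * R \<le> M" by linarith
  have "int U * 1 \<le> int U * R" "1 * R \<le> int U * R" using U_pos by (intro mult_mono; simp)+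
  with \<open>int U * R \<le> M\<close> show "int U \<le> M" "R \<le> M" by linarith+
  with pos show "int m \<le> M" by linarith
  have "(2::int) ^ l \<le> 2 ^ Suc L" using l_le by (intro power_increasing) auto
  with M show "2 ^ l \<le> M" by linarith
  have "int L < 2 ^ L" by (metis of_nat_less_two_power)
  moreover have "(0::int) \<le> 2 ^ L" by simp
  ultimately show "int L \<le> M" using M(7) unfolding power_Suc by linarith
  then show "int l \<le> M" using l_le by linarith
  show "0 \<le> M" using M by linarith
qed

definition base :: "(nat \<Rightarrow> int \<Rightarrow> int) \<Rightarrow> state \<Rightarrow> bool" where
  "base G s \<longleftrightarrow> regs s 0 = int m \<and> regs s 1 = int U \<and> (\<forall>r\<ge>20. regs s r = 0) \<and> arrs s = G"

lemma base_set_reg [simp]: "1 < d \<Longrightarrow> d < 20 \<Longrightarrow> base G (set_reg d x s) \<longleftrightarrow> base G s"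
  by (auto simp: base_def)

lemma base_regs: "base G s \<Longrightarrow> regs s 0 = int m" "base G s \<Longrightarrow> regs s (Suc 0) = int U"
  by (auto simp: base_def)

section \<open>Computing the parameters\<close>

definition log_prog :: "instr list" where
  "log_prog = [Const 7 1, Const 8 0, Const 9 1, Arith Sub 10 0 9,
     Loop 10 [Arith Add 9 9 9, Arith Add 8 8 7, Arith Sub 10 0 9]]"

lemma wp_log:
  assumes "base G s"
  shows "wp M log_prog (4 * l + 5) (\<lambda>s. base G s \<and> regs s 7 = 1 \<and> regs s 8 = int l) s"
proof -
  define I where "I j s \<longleftrightarrow> base G s \<and> regs s 7 = 1 \<and> j \<le> l \<and> regs s 8 = int (l - j) \<and>
    regs s 9 = 2 ^ (l - j) \<and> regs s 10 = int m - 2 ^ (l - j)" for j s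
  have body: "regs s 10 > 0 \<and> wp M [Arith Add 9 9 9, Arith Add 8 8 7, Arith Sub 10 0 9] 3 (I j) s"
    if "I (Suc j) s" for j s
  proof -
    from that have I: "base G s" "regs s 7 = 1" "Suc j \<le> l" "regs s 8 = int (l - Suc j)"
      "regs s 9 = 2 ^ (l - Suc j)" "regs s 10 = int m - 2 ^ (l - Suc j)" by (auto simp: I_def)
    have "2 ^ (l - Suc j) < m" using I(3) by (intro less_log_ceil) simp
    then have "int (2 ^ (l - Suc j)) < int m" unfolding of_nat_less_iff .
    then have r: "regs s 10 > 0" using I(6) by simp
    have e: "l - j = Suc (l - Suc j)" using I(3) by simp
    have "(2::int) ^ (l - j) \<le> 2 ^ l" by (intro power_increasing) auto
    moreover have "(1::int) \<le> 2 ^ (l - j)" by simp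
    ultimately have b: "2 ^ (l - j) \<le> M" "\<bar>int m - 2 ^ (l - j)\<bar> \<le> M" using M_ge by linarith+
    have "wp M [Arith Add 9 9 9, Arith Add 8 8 7, Arith Sub 10 0 9] 3 (I j) s"
      apply (rule wp_straight_end)
      using b I(3) M_ge unfolding I_def e apply (simp_all add: base_regs[OF I(1)] I(1,2,4-6))
      done
    with r show ?thesis by simp
  qed
  have loop: "wp M [Loop 10 [Arith Add 9 9 9, Arith Add 8 8 7, Arith Sub 10 0 9]] (Suc (4 * l))
     (\<lambda>s. base G s \<and> regs s 7 = 1 \<and> regs s 8 = int l) s" if "I l s" for s
  proof (rule wp_Loop[where I = I, OF that body, where Tp = 0])
    have "int m \<le> 2 ^ l" using log_ceil[of m] by (metis of_nat_le_iff of_nat_numeral of_nat_power)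
    then show "\<not> 0 < regs s 10" if "I 0 s" for s using that by (auto simp: I_def)
    show "wp M [] 0 (\<lambda>s. base G s \<and> regs s 7 = 1 \<and> regs s 8 = int l) s" if "I 0 s" for s
      using that by (intro wp_Nil) (simp add: I_def)
  qed simp_all
  show ?thesis unfolding log_prog_def
    apply (rule wp_straight[of _ "[Const 7 1, Const 8 0, Const 9 1, Arith Sub 10 0 9]",
        simplified append.simps, where T' = "Suc (4 * l)"])
    using M M_ge pos assms apply (simp_all add: base_regs[OF assms])
    apply (rule loop)
    apply (simp add: I_def base_regs[OF assms])
    done
qed

definition ready :: "(nat \<Rightarrow> int \<Rightarrow> int) \<Rightarrow> state \<Rightarrow> bool" where
  "ready G s \<longleftrightarrow> base G s \<and> regs s 2 = int L \<and> regs s 3 = int n \<and> regs s 4 = R \<and>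
     regs s 6 = int U * R \<and> regs s 7 = 1"

text \<open>Registers 2, 4 and 6 receive \<open>L\<close>, \<open>R\<close> and
  \<open>U * R\<close>, register 8 becomes \<open>P * N\<close>, and register 3 counts up to
  \<open>n\<close>. The linear search is affordable, since writing the rules takes time of order
  \<open>n\<close> anyway. Of the parameters, only the constants \<open>k\<close>,
  \<open>c0\<close>, \<open>P\<close> and \<open>D\<close> occur in the text.\<close>

definition params_prog :: "instr list" where
  "params_prog =
     [Const 9 (int k), Arith Div 9 8 9, Const 10 3, Arith Mul 8 8 10, Arith Add 8 8 9, Const 9 (int c0),
      Arith Add 2 8 9, Arith Shl 8 7 2, Arith Shr 4 8 7, Arith Mul 6 1 4,
      Arith Add 8 8 8, Arith Sub 8 8 7, Arith Mul 8 0 8, Const 9 2, Arith Add 8 8 9,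
      Const 9 (int P), Arith Mul 8 8 9, Const 3 0, Const 9 (int D), Arith Add 10 8 3] @
     [Loop 10 [Arith Add 3 3 7, Arith Mul 11 3 3, Arith Mul 11 11 11, Arith Mul 11 11 9,
        Arith Sub 10 8 11]]"

lemma int_N: "int N = int m * (2 * 2 ^ L - 1) + 2"
proof -
  have "(1::nat) \<le> 2 * 2 ^ L" by simp
  then show ?thesis by (simp add: vec_len_def of_nat_diff)
qed

lemma wp_params:
  assumes "base G s" "regs s 7 = 1" "regs s 8 = int l"
  shows "wp M params_prog (6 * n + 21) (ready G) s"
proof -
  define J where "J s \<longleftrightarrow> base G s \<and> regs s 2 = int L \<and> regs s 4 = R \<and> regs s 6 = int U * R \<and> regs s 7 = 1 \<and>
    regs s 8 = int (P * N) \<and> regs s 9 = int D" for s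
  define I where "I j s \<longleftrightarrow> J s \<and> j \<le> n \<and> regs s 3 = int (n - j) \<and>
    regs s 10 = int (P * N) - int (D * (n - j) ^ 4)" for j s
  define body where "body = [Arith Add 3 3 7, Arith Mul 11 3 3, Arith Mul 11 11 11, Arith Mul 11 11 9,
        Arith Sub 10 8 11]"
  have body: "regs s 10 > 0 \<and> wp M body 5 (I j) s"
    if "I (Suc j) s" for j s
  proof -
    from that have I: "J s" "Suc j \<le> n" "regs s 3 = int (n - Suc j)"
      "regs s 10 = int (P * N) - int (D * (n - Suc j) ^ 4)" by (auto simp: I_def)
    have J: "base G s" "regs s 2 = int L" "regs s 4 = R" "regs s 6 = int U * R" "regs s 7 = 1"
      "regs s 8 = int (P * N)" "regs s 9 = int D" using I(1) by (auto simp: J_def)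
    have "D * (n - Suc j) ^ 4 < P * N" using I(2) by (intro less_slp_size) simp
    then have r: "regs s 10 > 0" using I(4) by linarith
    have e: "n - j = Suc (n - Suc j)" using I(2) by simp
    define x where "x = int (n - j)"
    have x1: "x = 1 + int (n - Suc j)" using e by (simp add: x_def)
    have x0: "1 \<le> x" using I(2) by (simp add: x_def)
    have "x * x \<le> x ^ 4" "x ^ 4 \<le> int D * x ^ 4" "x \<le> x * x"
      using x0 pos(4) power_increasing[of 2 4 x] by (simp_all add: power2_eq_square)
    moreover have "x ^ 4 \<le> int n ^ 4" using x0 by (intro power_mono) (auto simp: x_def)
    then have "int D * x ^ 4 \<le> int D * int n ^ 4" by (intro mult_left_mono) auto
    then have "int D * x ^ 4 \<le> M" using M(10) by (simp add: of_nat_power)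
    moreover have "0 \<le> int D * x ^ 4" using x0 by simp
    ultimately have b: "x \<le> M" "x * x \<le> M" "x ^ 4 \<le> M" "\<bar>int D * x ^ 4\<bar> \<le> M"
      "\<bar>int (P * N) - int D * x ^ 4\<bar> \<le> M" using M(9) by linarith+
    have x4: "x * x * (x * x) = x ^ 4" by (simp add: power4_eq_xxxx)
    have "wp M body 5 (I j) s"
      unfolding body_def
      apply (rule wp_straight_end)
      using b x0 I(2) J I(3) x1[symmetric] x4 x_def[symmetric]
       apply (simp_all add: I_def J_def mult.commute[of _ "int D"] add.commute[of _ 1] del: of_nat_diff)
      done
    with r show ?thesis by simp
  qed
  have loop: "wp M [Loop 10 body] (Suc (6 * n)) (ready G) s" if "I n s" for s
  proof (rule wp_Loop[where I = I, OF that body, where Tp = 0])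
    have "int (P * N) \<le> int (D * n ^ 4)" using slp_size[OF pos(4), of P N] by linarith
    then show "\<not> 0 < regs s 10" if "I 0 s" for s using that by (auto simp: I_def)
    show "wp M [] 0 (ready G) s" if "I 0 s" for s
      using that by (intro wp_Nil) (simp add: I_def J_def ready_def)
  qed simp_all
  have L: "int l * 3 + int l div int k + int c0 = int L" by (simp add: depth_def zdiv_int)
  have "int (l div k) \<le> int l" by simp
  then have dl: "int l div int k \<le> M" "0 \<le> int l div int k"
    using M_ge(7) unfolding zdiv_int[symmetric] by linarith+
  have dr: "drop_bit (Suc 0) (2 ^ L) = R" using L_pos by (cases L) (auto simp: drop_bit_eq_div)
  define X where "X = int m * (2 * 2 ^ L - 1)"
  have X: "(X + 2) * int P = int (P * N)" by (simp add: int_N X_def)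
  have "(1::int) \<le> 2 * 2 ^ L" using one_le_power[of "2::int" "Suc L"] by simp
  then have X0: "0 \<le> X" by (simp add: X_def)
  then have "(X + 2) * 1 \<le> (X + 2) * int P" using pos(3) by (intro mult_left_mono) auto
  moreover have "(X + 2) * int P \<le> M" using M(9) unfolding X .
  ultimately have XM: "X + 2 \<le> M" "(X + 2) * int P \<le> M" by (simp_all only: mult_1_right)
  have pM: "2 * 2 ^ L \<le> M" "0 \<le> (2::int) ^ L" using M(7) by simp_all
  have lM: "int l * 3 + int l div int k \<le> M" "int l * 3 \<le> M" using L dl M_ge(6) by linarith+
  show ?thesis unfolding params_prog_def body_def[symmetric]
    apply (rule wp_straight[where T' = "Suc (6 * n)"])
    subgoal
      using dl lM pM XM X0 M(1-5) M_ge \<open>1 \<le> 2 * 2 ^ L\<close>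
      apply (simp add: base_regs[OF assms(1)] assms(2,3) L dr push_bit_eq_mult flip: X_def del: of_nat_mult)
      apply (rule loop)
      using assms X apply (simp add: I_def J_def)
      done
    by simp
qed

end

section \<open>The reduction program\<close>

lemma vc_clear:
  "0 \<le> M \<Longrightarrow> Q (s\<lparr>regs := \<lambda>r. if r \<in> set ds then 0 else regs s r\<rparr>) \<Longrightarrow> vc M (map (\<lambda>d. Const d 0) ds) Q s"
proof (induction ds arbitrary: s)
  case (Cons d ds)
  have "(set_reg d 0 s)\<lparr>regs := \<lambda>r. if r \<in> set ds then 0 else regs (set_reg d 0 s) r\<rparr> =
      s\<lparr>regs := \<lambda>r. if r \<in> set (d # ds) then 0 else regs s r\<rparr>"
    by (rule state.equality) auto
  then show ?case using Cons by simp
qed simp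

lemma cost_clear: "cost (map (\<lambda>d. Const d 0) ds) = length ds"
  by (induction ds) auto

lemma array_of_list_pop_take:
  assumes "Suc j \<le> length xs"
  shows "(array_of_list (take (Suc j) xs))(int j := 0) = array_of_list (take j xs)"
  using assms array_of_list_pop[of "take j xs" "xs ! j"] by (simp add: take_Suc_conv_app_nth)

lemma array_of_list_push_at:
  "int (length xs) = i \<Longrightarrow> (array_of_list xs)(i := x) = array_of_list (xs @ [x])"
  using array_of_list_push by blast

context reduction
begin

text \<open>The inputs are popped from their ends while the hashes are pushed in reverse order; the
  emptied arrays 0 to 2 are where the rules of the first string will go. The second marks
  \<open>h b + 1\<close> and \<open>h c + R\<close> absorb the carry and the wrap-around.\<close>

definition hash_body :: "instr list" where
  "hash_body =
     [Arith Sub 9 0 8, Arith Sub 8 8 7,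
      Load 10 0 8, Arith Mul 10 5 10, Arith Mod 10 10 6, Arith Div 10 10 1, Store 6 9 10,
      Arith Add 9 9 9, Arith Add 11 9 7,
      Load 10 1 8, Arith Mul 10 5 10, Arith Mod 10 10 6, Arith Div 10 10 1, Store 7 9 10,
      Arith Add 10 10 7, Store 7 11 10,
      Load 10 2 8, Arith Mul 10 5 10, Arith Mod 10 10 6, Arith Div 10 10 1, Store 8 9 10,
      Arith Add 10 10 4, Store 8 11 10,
      Const 10 0, Store 0 8 10, Store 1 8 10, Store 2 8 10]"

definition hash_prog :: "instr list" where
  "hash_prog = [Const 9 0, Arith Add 8 0 9] @ [Loop 8 hash_body]"

definition pairs :: "int \<Rightarrow> (nat \<Rightarrow> int) \<Rightarrow> nat list \<Rightarrow> int list" where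
  "pairs d h xs = concat (map (\<lambda>x. [h x, h x + d]) xs)"

lemma length_pairs: "length (pairs d h xs) = 2 * length xs"
  by (induction xs) (auto simp: pairs_def)

lemma pairs_snoc: "pairs d h (xs @ [x]) = (pairs d h xs @ [h x]) @ [h x + d]"
  by (simp add: pairs_def)

definition keys :: "int \<Rightarrow> state \<Rightarrow> bool" where
  "keys r s \<longleftrightarrow> regs s 0 = int m \<and> regs s 1 = int U \<and> regs s 2 = int L \<and> regs s 3 = int n \<and>
     regs s 4 = R \<and> regs s 5 = r \<and> regs s 6 = int U * R \<and> regs s 7 = 1 \<and> (\<forall>i\<ge>20. regs s i = 0)"

lemma keys_set_reg [simp]: "7 < d \<Longrightarrow> d < 20 \<Longrightarrow> keys r (set_reg d x s) \<longleftrightarrow> keys r s"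
  by (auto simp: keys_def)

lemma keys_set_arr [simp]: "keys r (set_arr a i x s) \<longleftrightarrow> keys r s"
  by (auto simp: keys_def)

definition hashing :: "int \<Rightarrow> nat list \<Rightarrow> nat list \<Rightarrow> nat list \<Rightarrow> nat \<Rightarrow> state \<Rightarrow> bool" where
  "hashing r A B C j s \<longleftrightarrow> keys r s \<and> j \<le> m \<and> regs s 8 = int j \<and>
     arrs s 0 = array_of_list (take j (map int A)) \<and>
     arrs s 1 = array_of_list (take j (map int B)) \<and>
     arrs s 2 = array_of_list (take j (map int C)) \<and>
     arrs s 6 = array_of_list (map (\<lambda>a. hash (int U) R r (int a)) (rev (drop j A))) \<and>
     arrs s 7 = array_of_list (pairs 1 (\<lambda>a. hash (int U) R r (int a)) (rev (drop j B))) \<and>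
     arrs s 8 = array_of_list (pairs R (\<lambda>a. hash (int U) R r (int a)) (rev (drop j C))) \<and>
     (\<forall>a. a \<notin> {0, 1, 2, 6, 7, 8} \<longrightarrow> arrs s a = (\<lambda>_. 0))"

lemma wp_hash_body:
  assumes s: "hashing r A B C (Suc j) s" and r: "0 \<le> r" "r < int U * R"
    and len: "length A = m" "length B = m" "length C = m"
    and sub: "set A \<subseteq> {1..U}" "set B \<subseteq> {1..U}" "set C \<subseteq> {1..U}"
  shows "regs s 8 > 0 \<and> wp M hash_body 27 (hashing r A B C j) s"
proof -
  define h where "h a = hash (int U) R r (int a)" for a
  have h: "0 \<le> h a" "h a < R" for a using hash_range[of "int U" R r] U_pos by (auto simp: h_def)
  from s have j: "j < m" and k: "keys r s" and s8: "regs s 8 = int (Suc j)" by (auto simp: hashing_def)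
  define Q where "Q = int U * R"
  define W where "W = R"
  define q where "q = m - Suc j"
  have regs: "regs s 0 = int q + (1 + int j)" "regs s (Suc 0) = int U" "regs s 4 = W" "regs s 5 = r"
    "regs s 6 = Q" "regs s 7 = 1" using k j by (auto simp: keys_def Q_def W_def q_def)
  have ar: "arrs s 0 = array_of_list (take (Suc j) (map int A))"
    "arrs s (Suc 0) = array_of_list (take (Suc j) (map int B))"
    "arrs s 2 = array_of_list (take (Suc j) (map int C))"
    "arrs s 6 = array_of_list (map h (rev (drop (Suc j) A)))"
    "arrs s 7 = array_of_list (pairs 1 h (rev (drop (Suc j) B)))"
    "arrs s 8 = array_of_list (pairs W h (rev (drop (Suc j) C)))"
    "\<And>a. a \<notin> {0, Suc 0, 2, 6, 7, 8} \<Longrightarrow> arrs s a = (\<lambda>_. 0)"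
    using s by (auto simp: hashing_def h_def[abs_def] W_def)
  have ld: "arrs s 0 (int j) = int (A ! j)" "arrs s (Suc 0) (int j) = int (B ! j)" "arrs s 2 (int j) = int (C ! j)"
    using j len by (simp_all add: ar array_of_list_nth)
  have Q: "0 < Q" "Q \<le> M" using U_pos M_ge by (simp_all add: Q_def)
  have mul: "0 \<le> r * int x" "r * int x \<le> M" "0 \<le> r * int x mod Q" "r * int x mod Q \<le> M"
    "r * int x mod Q div int U = h x" "h x \<le> M" "h x + 1 \<le> M" "h x + W \<le> M" "0 \<le> h x"
    "0 \<le> h x + W" if "x \<le> U" for x
  proof -
    have "r * int x \<le> (int U * R) * int U" using r that by (intro mult_mono) auto
    then show "r * int x \<le> M" using M(8) by (simp add: mult.commute)
    show "r * int x mod Q \<le> M" using Q pos_mod_bound[of Q "r * int x"] by linarith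
    show "h x \<le> M" "h x + 1 \<le> M" "0 \<le> h x" using h[of x] M_ge by linarith+
    have "(0::int) \<le> 2 ^ L" by simp
    then have "2 * R \<le> M" using double_R M(7) unfolding power_Suc by linarith
    then show "h x + W \<le> M" "0 \<le> h x + W" using h[of x] R_pos unfolding W_def by linarith+
  qed (use r U_pos Q in \<open>simp_all add: h_def hash_def Q_def\<close>)
  have le: "A ! j \<le> U" "B ! j \<le> U" "C ! j \<le> U"
    using sub len j nth_mem[of j A] nth_mem[of j B] nth_mem[of j C] by (auto simp: subset_eq)
  have push: "(array_of_list (map h (rev (drop (Suc j) A))))(int q := h (A ! j)) =
      array_of_list (map h (rev (drop j A)))"
    using j len by (subst array_of_list_push_at) (auto simp: Cons_nth_drop_Suc[symmetric] q_def)
  have push2: 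
    "(array_of_list (pairs d h (rev (drop (Suc j) B))))(2 * int q := h (B ! j), 2 * int q + 1 := h (B ! j) + d) =
      array_of_list (pairs d h (rev (drop j B)))" if "length B = m" for B d
    using j that by (subst array_of_list_push_at, simp add: length_pairs q_def, subst array_of_list_push_at)
      (auto simp: Cons_nth_drop_Suc[symmetric] pairs_snoc length_pairs q_def)
  have pop: "(array_of_list (take (Suc j) xs))(int j := 0) = array_of_list (take j xs)"
    if "length xs = m" for xs
    using array_of_list_pop_take that j by simp
  have hashing_iff: "hashing r A B C j s \<longleftrightarrow> keys r s \<and> j \<le> m \<and> regs s 8 = int j \<and>
     arrs s 0 = array_of_list (take j (map int A)) \<and>
     arrs s (Suc 0) = array_of_list (take j (map int B)) \<and>
     arrs s 2 = array_of_list (take j (map int C)) \<and>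
     arrs s 6 = array_of_list (map h (rev (drop j A))) \<and>
     arrs s 7 = array_of_list (pairs 1 h (rev (drop j B))) \<and>
     arrs s 8 = array_of_list (pairs W h (rev (drop j C))) \<and>
     (\<forall>a. a \<notin> {0, Suc 0, 2, 6, 7, 8} \<longrightarrow> arrs s a = (\<lambda>_. 0))" for s
    by (simp add: hashing_def h_def[abs_def] W_def)
  have bounds: "2 * int q + 1 \<le> M" "int j \<le> M" "1 \<le> M" "j \<le> m"
    using j M(6,1) B1.room'(3) by (simp_all add: q_def)
  have "wp M hash_body 27 (hashing r A B C j) s"
    unfolding hash_body_def
    apply (rule wp_straight_end)
     apply (simp add: regs s8 ld mul[OF le(1)] mul[OF le(2)] mul[OF le(3)])
    using bounds
     apply (simp add: hashing_iff k ar push push2 len pop)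
    apply simp
    done
  then show ?thesis using s8 by simp
qed


lemma wp_hash:
  assumes k: "keys r s" and r: "0 \<le> r" "r < int U * R" and arr: "arrs s = arrs (three_sum_input (U, A, B, C))"
    and len: "length A = m" "length B = m" "length C = m"
    and sub: "set A \<subseteq> {1..U}" "set B \<subseteq> {1..U}" "set C \<subseteq> {1..U}"
  shows "wp M hash_prog (28 * m + 3) (hashing r A B C 0) s"
proof -
  have k0: "regs s 0 = int m" using k by (simp add: keys_def)
  have start: "hashing r A B C m (set_reg 8 (int m) (set_reg 9 0 s))"
    using len k unfolding hashing_def
    by (simp add: arr initial_state_def pairs_def array_of_list_Nil numeral_2_eq_2)
  show ?thesis
    unfolding hash_prog_def
    apply (rule wp_straight[where T' = "28 * m + 1"])
     apply (simp add: k0 M_ge)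
     apply (rule wp_Loop[where I = "hashing r A B C" and k = m and Tq = 27 and Tp = 0, OF start])
    using wp_hash_body[OF _ r len sub] apply blast
       apply (simp add: hashing_def)
      apply (rule wp_Nil, assumption)
     apply simp_all
    done
qed

section \<open>Keys as natural numbers and the assembled program\<close>

definition hkey :: "int \<Rightarrow> nat \<Rightarrow> nat" where
  "hkey r a = nat (hash (int U) R r (int a))"

definition a_marks :: "int \<Rightarrow> nat list \<Rightarrow> nat list" where
  "a_marks r A = map (hkey r) (rev A)"

definition marks :: "nat \<Rightarrow> int \<Rightarrow> nat list \<Rightarrow> nat list" where
  "marks d r B = concat (map (\<lambda>b. [hkey r b, hkey r b + d]) (rev B))"

lemma int_hkey: "int (hkey r a) = hash (int U) R r (int a)"
  using hash_range[of "int U" R r "int a"] U_pos by (simp add: hkey_def)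

lemma hkey_less: "hkey r a < 2 ^ (L - 1)"
proof -
  have "int (hkey r a) < R" using hash_range[of "int U" R r "int a"] U_pos by (simp add: int_hkey)
  then have "int (hkey r a) < int (2 ^ (L - 1))" by simp
  then show ?thesis unfolding of_nat_less_iff .
qed

lemma int_a_marks: "map int (a_marks r A) = map (\<lambda>a. hash (int U) R r (int a)) (rev A)"
  by (simp add: a_marks_def int_hkey)

lemma int_marks: "map int (marks d r B) = pairs (int d) (\<lambda>a. hash (int U) R r (int a)) (rev B)"
  by (simp add: marks_def pairs_def map_concat o_def int_hkey)

lemma length_marks: "length (marks d r B) = 2 * length B" "length (a_marks r A) = length A"
  by (induction B) (auto simp: marks_def a_marks_def)

lemma double_nat: "2 * 2 ^ (L - 1) = (2 ^ L :: nat)"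
  using L_pos by (cases L) auto

text \<open>Keys are below \<open>2 ^ (L - 1)\<close>, half of \<open>2 ^ L\<close>, so adding
  \<open>1\<close> or \<open>2 ^ (L - 1)\<close> stays in range.\<close>

lemma marks_less:
  "\<forall>x\<in>set (a_marks r A). x < 2 ^ L" "\<forall>x\<in>set (marks 1 r A). x < 2 ^ L"
  "\<forall>x\<in>set (marks (2 ^ (L - 1)) r A). x < 2 ^ L"
proof -
  have "hkey r a < 2 ^ L" "Suc (hkey r a) < 2 ^ L \<or> L = 0" "hkey r a + 2 ^ (L - 1) < 2 ^ L" for a
    using hkey_less[of r a] double_nat by linarith+
  then show "\<forall>x\<in>set (a_marks r A). x < 2 ^ L" "\<forall>x\<in>set (marks 1 r A). x < 2 ^ L"
    "\<forall>x\<in>set (marks (2 ^ (L - 1)) r A). x < 2 ^ L"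
    using L_pos by (auto simp: a_marks_def marks_def)
qed

text \<open>The given algorithm is only known to work from its own initial state, so register 0 gets
  the size and all other registers in use return to \<open>0\<close>.\<close>

definition cleanup :: "instr list" where
  "cleanup = [Const 8 0, Arith Add 0 3 8] @ map (\<lambda>d. Const d 0) [1..<20]"

definition tail_prog :: "instr list" where
  "tail_prog = hash_prog @ B1.build @ B2.build @ cleanup"

definition reduced :: "int \<Rightarrow> nat list \<Rightarrow> nat list \<Rightarrow> nat list \<Rightarrow> int rule list \<Rightarrow> int rule list \<Rightarrow> bool" where
  "reduced r A B C S T \<longleftrightarrow> length S = n \<and> length T = n \<and> is_slp {0, 1} S \<and> is_slp {0, 1} T \<and>
     slp_string S = block_string L (marks 1 r B) (a_marks r A) \<and>
     slp_string T = block_string L (marks (2 ^ (L - 1)) r C) (replicate m 0)"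

lemma wp_tail:
  assumes k: "keys r s" and r: "0 \<le> r" "r < int U * R" and arr: "arrs s = arrs (three_sum_input (U, A, B, C))"
    and len: "length A = m" "length B = m" "length C = m"
    and sub: "set A \<subseteq> {1..U}" "set B \<subseteq> {1..U}" "set C \<subseteq> {1..U}"
  shows "wp M tail_prog (28 * m + 40 * n + 24) (\<lambda>s. \<exists>S T. reduced r A B C S T \<and> s = ip_input (S, T)) s"
  unfolding tail_prog_def
proof (rule wp_append[OF wp_hash[OF assms]])
  fix s1 assume s1: "hashing r A B C 0 s1"
  define G1 where "G1 = (\<lambda>a::nat. if a = 8 then array_of_list (map int (marks (2 ^ (L - 1)) r C)) else (\<lambda>_. 0))"
  have ctx1: "B1.ctx G1 (replicate n (Terminal 0)) (marks 1 r B) (a_marks r A) s1"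
    using s1 room unfolding hashing_def B1.ctx_def keys_def int_a_marks int_marks G1_def
    by (simp add: is_slp_iff rule_ok_def array_of_list_Nil array_of_list_replicate_0 numeral_2_eq_2)
  show "wp M (B1.build @ B2.build @ cleanup) (20 * n + (20 * n + 21))
      (\<lambda>s. \<exists>S T. reduced r A B C S T \<and> s = ip_input (S, T)) s1"
  proof (rule wp_append[OF B1.wp_build[OF ctx1]])
    fix s2 assume "B1.built G1 (marks 1 r B) (a_marks r A) s2"
    then obtain S where S: "B1.ctx G1 S [] [] s2" "gen S (n - 1) (block_string L (marks 1 r B) (a_marks r A))"
      unfolding B1.built_def by blast
    \<comment> \<open>The frame of the second construction keeps the finished rules of the first in
      arrays 0 to 2.\<close>
    define G2 where "G2 = (\<lambda>a::nat. if a < 3 then arrs s2 a else (\<lambda>_. 0))"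
    have a2: "arrs s2 0 = array_of_list (map rule_kind S)" "arrs s2 (Suc 0) = array_of_list (map rule_arg1 S)"
        "arrs s2 2 = array_of_list (map rule_arg2 S)"
        "arrs s2 8 = array_of_list (map int (marks (2 ^ (L - 1)) r C))"
      using S(1) unfolding B1.ctx_def G1_def by (simp_all add: numeral_2_eq_2)
    have a2': "arrs s2 a = (\<lambda>_. 0)" if "3 \<le> a" "a \<noteq> 8" for a
    proof (cases "a = 6 \<or> a = 7")
      case True
      then show ?thesis using S(1) unfolding B1.ctx_def by (auto simp: array_of_list_Nil)
    next
      case False
      then have "a \<notin> {0, Suc 0, Suc (Suc 0), 7, 6}" using that by auto
      then have "arrs s2 a = G1 a" using S(1) unfolding B1.ctx_def by blast
      then show ?thesis using that by (simp add: G1_def)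
    qed
    have len0: "regs s2 0 = int m \<and> regs s2 2 = int L \<and> regs s2 3 = int n \<and> regs s2 7 = 1 \<and>
       (\<forall>r\<ge>20. regs s2 r = 0)" using S(1) unfolding B1.ctx_def by blast
    have ctx2: "B2.ctx G2 (replicate n (Terminal 0)) (marks (2 ^ (L - 1)) r C) (replicate m 0) s2"
      unfolding B2.ctx_def using len0 a2(4) room
      by (simp add: a2' G2_def is_slp_iff rule_ok_def array_of_list_replicate_0 del: of_nat_power)
    show "wp M (B2.build @ cleanup) (20 * n + 21) (\<lambda>s. \<exists>S T. reduced r A B C S T \<and> s = ip_input (S, T)) s2"
    proof (rule wp_append[OF B2.wp_build[OF ctx2]])
      fix s3 assume "B2.built G2 (marks (2 ^ (L - 1)) r C) (replicate m 0) s3"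
      then obtain T where T: "B2.ctx G2 T [] [] s3"
          "gen T (n - 1) (block_string L (marks (2 ^ (L - 1)) r C) (replicate m 0))"
        unfolding B2.built_def by blast
      have lenST: "length S = n" "length T = n" "is_slp {0, 1} S" "is_slp {0, 1} T"
        using B1.ctx_regs(5,6)[OF S(1)] B2.ctx_regs(5,6)[OF T(1)] by auto
      have ne: "S \<noteq> []" "T \<noteq> []" using lenST by (auto simp: is_slp_iff)
      have red: "reduced r A B C S T"
        unfolding reduced_def using lenST S(2) T(2) ne gen_slp_string by metis
      have "regs s3 3 = int n" "\<forall>r\<ge>20. regs s3 r = 0" using T(1) by (auto simp: B2.ctx_def)
      have a3: "arrs s3 3 = array_of_list (map rule_kind T)" "arrs s3 4 = array_of_list (map rule_arg1 T)"
          "arrs s3 5 = array_of_list (map rule_arg2 T)"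
        using T(1) unfolding B2.ctx_def by (simp_all add: eval_nat_numeral)
      have a3': "arrs s3 a = (if a < 3 then arrs s2 a else (\<lambda>_. 0))" if "a \<notin> {3, 4, 5}" for a
      proof (cases "a = 8 \<or> a = 9")
        case True
        then show ?thesis using T(1) unfolding B2.ctx_def by (auto simp: array_of_list_Nil)
      next
        case False
        then have "a \<notin> {3, Suc 3, Suc (Suc 3), 8, 9}" using that by auto
        then have "arrs s3 a = G2 a" using T(1) unfolding B2.ctx_def by blast
        then show ?thesis by (simp add: G2_def)
      qed
      have a: "arrs s3 a = arrs (ip_input (S, T)) a" for a
      proof -
        consider "a = 0" | "a = Suc 0" | "a = 2" | "a = 3" | "a = 4" | "a = 5" | "a \<ge> 6" by linarith
        then show ?thesis
          by cases (simp_all add: a2 a3 a3' initial_state_def)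
      qed
      have "(set_reg 0 (int n) (set_reg 8 0 s3))\<lparr>regs :=
          \<lambda>r. if r \<in> set [1..<20] then 0 else regs (set_reg 0 (int n) (set_reg 8 0 s3)) r\<rparr> = ip_input (S, T)"
      proof (rule state.equality)
        show "regs ((set_reg 0 (int n) (set_reg 8 0 s3))\<lparr>regs :=
          \<lambda>r. if r \<in> set [1..<20] then 0 else regs (set_reg 0 (int n) (set_reg 8 0 s3)) r\<rparr>) =
          regs (ip_input (S, T))"
          using \<open>\<forall>r\<ge>20. regs s3 r = 0\<close> lenST by (auto simp: initial_state_def fun_eq_iff)
        show "arrs ((set_reg 0 (int n) (set_reg 8 0 s3))\<lparr>regs :=
          \<lambda>r. if r \<in> set [1..<20] then 0 else regs (set_reg 0 (int n) (set_reg 8 0 s3)) r\<rparr>) =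
          arrs (ip_input (S, T))"
          using a by (simp add: fun_eq_iff del: ip_input.simps)
      qed simp
      moreover define post where "post s \<longleftrightarrow> (\<exists>S T. reduced r A B C S T \<and> s = ip_input (S, T))" for s
      ultimately have post: "post ((set_reg 0 (int n) (set_reg 8 0 s3))\<lparr>regs :=
          \<lambda>r. if r \<in> set [1..<20] then 0 else regs (set_reg 0 (int n) (set_reg 8 0 s3)) r\<rparr>)"
        using red by blast
      have "wp M (map (\<lambda>d. Const d 0) [1..<20]) 19 post (set_reg 0 (int n) (set_reg 8 0 s3))"
        by (rule wp_straight_end, rule vc_clear[OF M_ge(8)], rule post) (simp add: cost_clear)
      then have "wp M cleanup 21 post s3"
        unfolding cleanup_def using M_ge(8) M(6) \<open>regs s3 3 = int n\<close>
        by (intro wp_straight[where T' = 19]) simp_all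
      then show "wp M cleanup 21 (\<lambda>s. \<exists>S T. reduced r A B C S T \<and> s = ip_input (S, T)) s3"
        unfolding post_def .
    qed (use len marks_less in \<open>simp_all add: length_marks\<close>)
  qed (use len marks_less in \<open>simp_all add: length_marks\<close>)
qed simp

definition head_prog :: "instr list" where
  "head_prog = log_prog @ params_prog"

lemma wp_head:
  assumes "length A = m"
  shows "wp M head_prog (4 * l + 6 * n + 26) (ready (arrs (three_sum_input (U, A, B, C)))) (three_sum_input (U, A, B, C))"
proof -
  have b: "base (arrs (three_sum_input (U, A, B, C))) (three_sum_input (U, A, B, C))"
    using assms by (auto simp: base_def initial_state_def)
  show ?thesis unfolding head_prog_def
    by (rule wp_append[OF wp_log[OF b]]) (use wp_params in auto)
qed

end

section \<open>Size estimates\<close>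

lemma two_power_log_ceil: "0 < m \<Longrightarrow> 2 ^ log_ceil m \<le> 2 * m"
  using less_log_ceil[of "log_ceil m - 1" m] by (cases "log_ceil m") auto

lemma power_depth:
  "(2 :: 'a :: comm_semiring_1) ^ depth k c0 m = (2 ^ log_ceil m) ^ 3 * 2 ^ (log_ceil m div k) * 2 ^ c0"
  by (simp only: depth_def power_add mult.commute[of 3] power_mult)

text \<open>The crude exponent \<open>4\<close> replaces \<open>3 + 1 / k\<close>; it is enough for
  the size of words.\<close>

lemma power_depth_le:
  assumes "0 < m"
  shows "2 ^ depth k c0 m \<le> 16 * 2 ^ c0 * m ^ 4"
proof -
  have "(2::nat) ^ (log_ceil m div k) \<le> 2 ^ log_ceil m" by (intro power_increasing) auto
  also have "\<dots> \<le> 2 * m" by (rule two_power_log_ceil[OF assms])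
  finally have "(2 ^ log_ceil m) ^ 3 * 2 ^ (log_ceil m div k) * 2 ^ c0 \<le> (2 * m) ^ 3 * (2 * m) * 2 ^ c0"
    using two_power_log_ceil[OF assms] by (intro mult_mono power_mono) auto
  also have "\<dots> = 16 * 2 ^ c0 * m ^ 4" by (simp add: power_mult_distrib power3_eq_cube power4_eq_xxxx)
  finally show ?thesis unfolding power_depth .
qed

lemma vec_len_le:
  assumes "0 < m"
  shows "vec_len k c0 m \<le> 4 * m * 2 ^ depth k c0 m"
proof -
  have "m * (2 ^ Suc (depth k c0 m) - 1) + m = m * 2 ^ Suc (depth k c0 m)"
    by (simp add: diff_mult_distrib2)
  moreover have "1 * 1 \<le> m * 2 ^ depth k c0 m" using assms by (intro mult_mono) auto
  ultimately show ?thesis using assms by (simp add: vec_len_def)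
qed

lemma vec_len_ge: "m * 2 ^ depth k c0 m \<le> vec_len k c0 m"
proof -
  have "(2::nat) ^ depth k c0 m \<le> 2 ^ Suc (depth k c0 m) - 1" by simp
  then have "m * 2 ^ depth k c0 m \<le> m * (2 ^ Suc (depth k c0 m) - 1)" by (rule mult_le_mono2)
  then show ?thesis unfolding vec_len_def by linarith
qed

text \<open>For \<open>n \<ge> 2\<close> one has \<open>n \<le> 2 * (n - 1)\<close>, and the
  constant covers the rest. It turns the failure of the size test at \<open>n - 1\<close> into a
  bound on \<open>n\<close>.\<close>

lemma power4_le_pred: "(n :: nat) ^ 4 \<le> 16 * (n - 1) ^ 4 + 16"
proof (cases "n \<ge> 2")
  case True
  then have "n ^ 4 \<le> (2 * (n - 1)) ^ 4" by (intro power_mono) auto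
  then show ?thesis by (simp add: power_mult_distrib)
next
  case False
  then have "n = 0 \<or> n = 1" by auto
  then show ?thesis by auto
qed

lemma slp_size_le: "D * slp_size P D N ^ 4 \<le> 16 * (P * N + D)"
proof (cases "slp_size P D N")
  case (Suc j)
  have "D * slp_size P D N ^ 4 \<le> D * (16 * (slp_size P D N - 1) ^ 4 + 16)"
    by (rule mult_le_mono2[OF power4_le_pred])
  also have "\<dots> \<le> 16 * (P * N + D)" using less_slp_size[of j P D N] Suc by (simp add: algebra_simps)
  finally show ?thesis .
qed simp

text \<open>Both sides are expressed through \<open>x = l div k + c0\<close>: the number of rules is
  at most a constant times \<open>m * (x + 1)\<close>, because \<open>l \<le> k * (x + 1)\<close>,
  while \<open>n ^ 4\<close> is at least a constant times \<open>m ^ 4 * 2 ^ x\<close>. By the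
  choice of \<open>c0\<close>, the exponential wins for all \<open>x \<ge> c0\<close>.\<close>

lemma room:
  assumes pos: "0 < k" "0 < D" "0 < m"
    and c0: "\<And>x. c0 \<le> x \<Longrightarrow> 256 * D * (3 * k + 1) ^ 4 * (x + 1) ^ 4 < P * 2 ^ x"
  shows "(depth k c0 m + 1) * (3 * m + 1) < slp_size P D (vec_len k c0 m)"
proof (rule ccontr)
  define l L n x where "l = log_ceil m" and "L = depth k c0 m" and "n = slp_size P D (vec_len k c0 m)"
    and "x = l div k + c0"
  assume "\<not> ?thesis"
  then have "n \<le> (L + 1) * (3 * m + 1)" by (simp add: n_def L_def)
  also have "\<dots> \<le> (L + 1) * (4 * m)" using pos by (intro mult_le_mono2) auto
  also have "L + 1 \<le> (3 * k + 1) * (x + 1)"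
  proof -
    have "l = k * (l div k) + l mod k" "l mod k < k" using pos by simp_all
    then have l: "l \<le> k * (l div k) + k" by linarith
    have "L + 1 = 3 * l + (x + 1)" by (simp add: L_def depth_def l_def x_def)
    also have "\<dots> \<le> 3 * (k * (l div k) + k) + (x + 1)" using l by simp
    also have "\<dots> \<le> 3 * (k * x + k) + (x + 1)" by (simp add: x_def)
    finally show ?thesis by (simp add: algebra_simps)
  qed
  finally have "n \<le> (3 * k + 1) * (x + 1) * (4 * m)" by simp
  then have "n ^ 4 \<le> ((3 * k + 1) * (x + 1) * (4 * m)) ^ 4" by (rule power_mono) simp
  then have "D * n ^ 4 \<le> D * ((3 * k + 1) * (x + 1) * (4 * m)) ^ 4" by (rule mult_le_mono2)
  also have "\<dots> = (256 * D * (3 * k + 1) ^ 4 * (x + 1) ^ 4) * m ^ 4"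
    unfolding power_mult_distrib by simp
  also have "\<dots> < (P * 2 ^ x) * m ^ 4" using c0[of x] pos by (intro mult_strict_right_mono) (auto simp: x_def)
  also have "\<dots> \<le> P * (m * 2 ^ L)"
  proof -
    have "m ^ 3 \<le> (2 ^ l) ^ 3" using log_ceil[of m] by (intro power_mono) (auto simp: l_def)
    then have "m * (2 ^ x * m ^ 3) \<le> m * (2 ^ x * (2 ^ l) ^ 3)" by simp
    also have "\<dots> = m * 2 ^ L" unfolding L_def power_depth by (simp add: x_def l_def power_add)
    finally have "m * (2 ^ x * m ^ 3) \<le> m * 2 ^ L" .
    then have "P * (m * (2 ^ x * m ^ 3)) \<le> P * (m * 2 ^ L)" by (rule mult_le_mono2)
    then show ?thesis by (simp add: eval_nat_numeral ac_simps)
  qed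
  also have "\<dots> \<le> P * vec_len k c0 m" using vec_len_ge[of m k c0] by (intro mult_le_mono2) (simp add: L_def)
  also have "\<dots> \<le> D * n ^ 4" unfolding n_def by (rule slp_size[OF pos(2)])
  finally show False by simp
qed

section \<open>Estimates with real exponents\<close>

lemma two_power_div_le:
  assumes "0 < k"
  shows "2 ^ (l div k) \<le> (2 ^ l :: real) powr (1 / real k)"
    and "(2 ^ l :: real) powr (1 / real k) \<le> 2 * 2 ^ (l div k)"
proof -
  have e: "(2 ^ l :: real) powr (1 / real k) = 2 powr (real l / real k)"
    by (simp add: powr_powr flip: powr_realpow)
  have "real (l div k) \<le> real l / real k" by (rule of_nat_div_le_of_nat)
  then have "2 powr real (l div k) \<le> (2::real) powr (real l / real k)" by (intro powr_mono) auto
  then show "2 ^ (l div k) \<le> (2 ^ l :: real) powr (1 / real k)" unfolding e by (simp add: powr_realpow)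
  have "real l / real k \<le> real (l div k) + 1" using real_of_int_div3[of "int l" "int k"] by (simp flip: zdiv_int)
  then have "(2::real) powr (real l / real k) \<le> 2 powr (real (l div k) + 1)" by (intro powr_mono) auto
  then show "(2 ^ l :: real) powr (1 / real k) \<le> 2 * 2 ^ (l div k)"
    unfolding e by (simp add: powr_add powr_realpow)
qed

text \<open>The \<open>16\<close> is \<open>2 ^ 3 * 2\<close>: rounding \<open>m\<close> up to a
  power of two at most doubles it.\<close>

lemma power_depth_powr_le:
  assumes "0 < m" "0 < k"
  shows "2 ^ depth k c0 m \<le> 16 * 2 ^ c0 * real m powr (3 + 1 / real k)"
proof -
  define l where "l = log_ceil m"
  have l: "(2::real) ^ l \<le> 2 * real m"
    using two_power_log_ceil[OF assms(1)] unfolding l_def by (metis of_nat_le_iff of_nat_mult of_nat_numeral of_nat_power)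
  have "2 ^ (l div k) \<le> (2 ^ l :: real) powr (1 / real k)" by (rule two_power_div_le(1)[OF assms(2)])
  also have "\<dots> \<le> (2 * real m) powr (1 / real k)" using l by (intro powr_mono2) auto
  also have "\<dots> = 2 powr (1 / real k) * real m powr (1 / real k)" by (simp add: powr_mult)
  also have "\<dots> \<le> 2 powr 1 * real m powr (1 / real k)" using assms by (intro mult_right_mono powr_mono) auto
  finally have *: "2 ^ (l div k) \<le> 2 * real m powr (1 / real k)" by simp
  have "(2::real) ^ depth k c0 m = (2 ^ l) ^ 3 * 2 ^ (l div k) * 2 ^ c0"
    by (simp only: power_depth l_def)
  also have "\<dots> \<le> (2 * real m) ^ 3 * (2 * real m powr (1 / real k)) * 2 ^ c0"
    using l * by (intro mult_mono power_mono) auto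
  also have "\<dots> = 16 * 2 ^ c0 * (real m powr 3 * real m powr (1 / real k))"
    using assms by (simp add: power_mult_distrib powr_numeral)
  finally show ?thesis by (simp add: powr_add)
qed

text \<open>\<open>c0 \<ge> 2\<close> pays twice: for the factor \<open>2\<close> lost in rounding
  \<open>l / k\<close> down, and for the \<open>- 1\<close> in the exponent of
  \<open>R\<close>.\<close>

lemma power_depth_powr_ge:
  assumes "0 < m" "0 < k" "1 < c0"
  shows "real m powr (3 + 1 / real k) \<le> 2 ^ (depth k c0 m - 1)"
proof -
  define l where "l = log_ceil m"
  have l: "real m \<le> 2 ^ l"
    using log_ceil[of m] unfolding l_def by (metis of_nat_le_iff of_nat_numeral of_nat_power)
  have "real m powr (1 / real k) \<le> (2 ^ l) powr (1 / real k)" using l by (intro powr_mono2) auto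
  also have "\<dots> \<le> 2 * 2 ^ (l div k)" by (rule two_power_div_le(2)[OF assms(2)])
  finally have *: "real m powr (1 / real k) \<le> 2 * 2 ^ (l div k)" .
  have "real m powr (3 + 1 / real k) = real m ^ 3 * real m powr (1 / real k)"
    using assms by (simp add: powr_add powr_numeral)
  also have "\<dots> \<le> (2 ^ l) ^ 3 * (2 * 2 ^ (l div k))" using l * by (intro mult_mono power_mono) auto
  also have "\<dots> = 2 ^ (3 * l + l div k + 1)" by (simp add: power_add power_mult mult.commute)
  also have "\<dots> \<le> 2 ^ (depth k c0 m - 1)" using assms by (intro power_increasing) (auto simp: depth_def l_def)
  finally show ?thesis .
qed

text \<open>The dimension is of order \<open>m powr (4 + 1 / k)\<close>, and the exponent is divided
  by four. The constant is a deliberate overestimate: \<open>C \<ge> 1\<close> gives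
  \<open>C \<le> C ^ 4\<close>, so that no root of a constant is taken.\<close>

lemma slp_size_powr_le:
  assumes "0 < m" "0 < k" "0 < P" "0 < D" and C: "C = 3000 * real P * 2 ^ c0"
  shows "real (slp_size P D (vec_len k c0 m)) \<le> C * real m powr (1 + 1 / (4 * real k))"
proof -
  define N where "N = vec_len k c0 m"
  define n where "n = slp_size P D N"
  have "n ^ 4 \<le> 16 * (n - 1) ^ 4 + 16" by (rule power4_le_pred)
  also have "\<dots> \<le> 16 * (P * N) + 16"
  proof (cases n)
    case (Suc j)
    then have "D * j ^ 4 < P * N" unfolding n_def by (intro less_slp_size) simp
    moreover have "1 * j ^ 4 \<le> D * j ^ 4" using assms(4) by (intro mult_right_mono) auto
    ultimately have "j ^ 4 \<le> P * N" by linarith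
    then show ?thesis using Suc by simp
  qed simp
  also have "\<dots> \<le> 32 * (P * N)" using assms(3) by (simp add: N_def vec_len_def)
  also have "\<dots> \<le> 32 * (P * (4 * m * 2 ^ depth k c0 m))"
    using vec_len_le[OF assms(1), of k c0] by (intro mult_le_mono2) (simp add: N_def)
  finally have "real (n ^ 4) \<le> real (32 * (P * (4 * m * 2 ^ depth k c0 m)))" by (simp only: of_nat_le_iff)
  also have "\<dots> = 128 * real P * real m * 2 ^ depth k c0 m" by simp
  also have "\<dots> \<le> 128 * real P * real m * (16 * 2 ^ c0 * real m powr (3 + 1 / real k))"
    using power_depth_powr_le[OF assms(1,2)] by (intro mult_left_mono) auto
  also have "\<dots> = 2048 * real P * 2 ^ c0 * (real m powr 1 * real m powr (3 + 1 / real k))"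
    using assms by simp
  also have "real m powr 1 * real m powr (3 + 1 / real k) = real m powr (4 + 1 / real k)"
    by (simp only: powr_add[symmetric]) simp
  also have "2048 * real P * 2 ^ c0 * real m powr (4 + 1 / real k) \<le> C * real m powr (4 + 1 / real k)"
    unfolding C by (intro mult_right_mono) auto
  also have "\<dots> \<le> C ^ 4 * real m powr (4 + 1 / real k)"
  proof -
    have "1 * 1 \<le> 3000 * real P" "(1::real) \<le> 2 ^ c0" using assms(3) by auto
    then have "1 * 1 \<le> C" unfolding C by (intro mult_mono) auto
    then show ?thesis using power_increasing[of 1 4 C] by (intro mult_right_mono) auto
  qed
  also have "\<dots> = (C * real m powr (1 + 1 / (4 * real k))) ^ 4"
  proof -
    have "(1 + 1 / (4 * real k)) * 4 = 4 + 1 / real k" using assms(2) by (simp add: field_simps)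
    then have "real m powr (4 + 1 / real k) = (real m powr (1 + 1 / (4 * real k))) powr 4"
      by (simp only: powr_powr)
    also have "\<dots> = (real m powr (1 + 1 / (4 * real k))) ^ 4" using assms(1) by (intro powr_numeral) simp
    finally show ?thesis by (simp only: power_mult_distrib)
  qed
  finally have "real n ^ 4 \<le> (C * real m powr (1 + 1 / (4 * real k))) ^ 4"
    by (simp only: of_nat_power)
  then have "real n ^ Suc 3 \<le> (C * real m powr (1 + 1 / (4 * real k))) ^ Suc 3"
    by (simp only: Suc_numeral semiring_norm)
  moreover have "0 \<le> C * real m powr (1 + 1 / (4 * real k))" unfolding C by simp
  ultimately show ?thesis unfolding n_def N_def by (rule power_le_imp_le_base)
qed

section \<open>Correctness of the reduction\<close>

lemma card_UN_le_mult:
  assumes "finite S" "\<And>x. x \<in> S \<Longrightarrow> card (f x) \<le> K"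
  shows "card (\<Union>x\<in>S. f x) \<le> card S * K"
  using card_UN_le[OF assms(1), of f] sum_bounded_above[of S "\<lambda>x. card (f x)" K] assms(2) by simp

lemma root4_bounds:
  fixes c N n :: real
  assumes "0 \<le> c" "0 \<le> N" "0 \<le> n"
  shows "c * N powr (1/4) \<le> n \<longleftrightarrow> c ^ 4 * N \<le> n ^ 4" "n \<le> c * N powr (1/4) \<longleftrightarrow> n ^ 4 \<le> c ^ 4 * N"
proof -
  have "(N powr (1/4)) ^ 4 = N" using assms by (cases "N = 0") (simp_all add: powr_power)
  then have e: "(c * N powr (1/4)) ^ 4 = c ^ 4 * N" by (simp add: power_mult_distrib)
  show "c * N powr (1/4) \<le> n \<longleftrightarrow> c ^ 4 * N \<le> n ^ 4" "n \<le> c * N powr (1/4) \<longleftrightarrow> n ^ 4 \<le> c ^ 4 * N"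
    unfolding e[symmetric] using assms by (simp_all add: power_mono_iff)
qed

context reduction
begin

definition bad_keys :: "nat list \<Rightarrow> nat list \<Rightarrow> nat list \<Rightarrow> int set" where
  "bad_keys A B C = (\<Union>a\<in>set A. \<Union>b\<in>set B. \<Union>c\<in>set C.
     if a + b = c then {} else bad (int U) (int U * R) (int a + int b - int c))"

lemma R_ge_2: "2 \<le> R"
proof -
  have "(2::int) ^ 1 \<le> 2 ^ (L - 1)" using pos by (intro power_increasing) (auto simp: depth_def)
  then show ?thesis by simp
qed

lemma bad_keys_subset: "bad_keys A B C \<subseteq> {0..<int U * R}"
  by (auto simp: bad_keys_def bad_def split: if_splits)

text \<open>Each of the at most \<open>m ^ 3\<close> triples spoils at most \<open>10 * U\<close>
  draws; \<open>card_bad\<close> applies since \<open>\<bar>a + b - c\<bar> < 2 * U\<close> and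
  \<open>R \<ge> 2\<close>.\<close>

lemma card_bad_keys:
  assumes "length A = m" "length B = m" "length C = m"
    and "set A \<subseteq> {1..U}" "set B \<subseteq> {1..U}" "set C \<subseteq> {1..U}"
  shows "card (bad_keys A B C) \<le> m * (m * (m * (10 * U)))"
proof -
  define bd where "bd a b c = (if a + b = c then {} else bad (int U) (int U * R) (int a + int b - int c))" for a b c :: nat
  have bd: "card (bd a b c) \<le> 10 * U" if "a \<in> set A" "b \<in> set B" "c \<in> set C" for a b c
  proof (cases "a + b = c")
    case False
    have r: "1 \<le> a" "a \<le> U" "1 \<le> b" "b \<le> U" "1 \<le> c" "c \<le> U" using that assms by auto
    have "int U * 2 \<le> int U * R" using R_ge_2 by (intro mult_left_mono) auto
    then have "int (card (bad (int U) (int U * R) (int a + int b - int c))) \<le> 10 * int U"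
      using False r by (intro card_bad) (auto simp flip: of_nat_add)
    with False show ?thesis by (simp add: bd_def)
  qed (simp add: bd_def)
  have card: "card (set xs) * K \<le> m * K" if "length xs = m" for xs :: "nat list" and K
    using card_length[of xs] that by simp
  have C: "card (\<Union>c\<in>set C. bd a b c) \<le> m * (10 * U)" if "a \<in> set A" "b \<in> set B" for a b
    by (rule order_trans[OF card_UN_le_mult card[OF assms(3)]]) (use bd that in auto)
  have B: "card (\<Union>b\<in>set B. \<Union>c\<in>set C. bd a b c) \<le> m * (m * (10 * U))" if "a \<in> set A" for a
    by (rule order_trans[OF card_UN_le_mult card[OF assms(2)]]) (use C that in auto)
  have "card (\<Union>a\<in>set A. \<Union>b\<in>set B. \<Union>c\<in>set C. bd a b c) \<le> m * (m * (m * (10 * U)))"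
    by (rule order_trans[OF card_UN_le_mult card[OF assms(1)]]) (use B in auto)
  then show ?thesis unfolding bad_keys_def bd_def .
qed

text \<open>A solution always makes the product positive, by \<open>hash_sum\<close>; it is the
  converse that depends on \<open>r\<close> avoiding \<open>bad_keys\<close>.\<close>

lemma reduced_answer:
  assumes red: "reduced r A B C S T" and len: "length A = m"
    and r: "r \<in> {0..<int U * R}" "r \<notin> bad_keys A B C"
  shows "(if ip_answer (S, T) > 0 then 1 else 0) = three_sum_answer (U, A, B, C)"
proof -
  have la: "length (a_marks r A) = m" using len by (simp add: length_marks)
  have "ip_answer (S, T) > 0 \<longleftrightarrow>
      (\<exists>x\<in>set (marks 1 r B). \<exists>y\<in>set (a_marks r A). x + y \<in> set (marks (2 ^ (L - 1)) r C))"
    using red inner_product_block_string_pos_iff[OF marks_less(2,1,3), of r B r A r C]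
    by (simp add: reduced_def la)
  also have "\<dots> \<longleftrightarrow> (\<exists>a\<in>set A. \<exists>b\<in>set B. \<exists>c\<in>set C. a + b = c)"
  proof
    assume "\<exists>x\<in>set (marks 1 r B). \<exists>y\<in>set (a_marks r A). x + y \<in> set (marks (2 ^ (L - 1)) r C)"
    then obtain a b c e f where abc: "a \<in> set A" "b \<in> set B" "c \<in> set C" and e: "e = 0 \<or> e = (1::nat)"
      and f: "f = 0 \<or> f = (1::nat)" and "hkey r b + e + hkey r a = hkey r c + 2 ^ (L - 1) * f"
      unfolding marks_def a_marks_def by force
    then have "int (hkey r b + e + hkey r a) = int (hkey r c + 2 ^ (L - 1) * f)" by simp
    then have "hash (int U) R r (int a) + (hash (int U) R r (int b) + int e) =
        hash (int U) R r (int c) + R * int f" by (simp add: int_hkey algebra_simps)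
    moreover have "int e \<in> {0, 1}" using e by auto
    ultimately have "\<exists>k. \<bar>r * (int a + int b - int c) - k * (int U * R)\<bar> < 2 * int U"
      using U_pos by (intro hash_collision) auto
    with r(1) have "r \<in> bad (int U) (int U * R) (int a + int b - int c)" by (simp add: bad_def)
    with r(2) abc have "a + b = c" unfolding bad_keys_def by (auto split: if_splits)
    with abc show "\<exists>a\<in>set A. \<exists>b\<in>set B. \<exists>c\<in>set C. a + b = c" by blast
  next
    assume "\<exists>a\<in>set A. \<exists>b\<in>set B. \<exists>c\<in>set C. a + b = c"
    then obtain a b where ab: "a \<in> set A" "b \<in> set B" "a + b \<in> set C" by blast
    obtain e f where e: "e \<in> {0, 1}" and f: "f \<in> {0, 1}" and
      eq: "hash (int U) R r (int a) + (hash (int U) R r (int b) + e) = hash (int U) R r (int a + int b) + R * f"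
    proof -
      have "\<exists>e\<in>{0, 1}. \<exists>f\<in>{0, 1}. hash (int U) R r (int a) + (hash (int U) R r (int b) + e) =
          hash (int U) R r (int a + int b) + R * f"
        by (rule hash_sum) (use U_pos in auto)
      then show thesis using that by blast
    qed
    have "int (hkey r b + nat e + hkey r a) = int (hkey r (a + b) + 2 ^ (L - 1) * nat f)"
      using eq e f by (auto simp: int_hkey)
    then have "hkey r b + nat e + hkey r a = hkey r (a + b) + 2 ^ (L - 1) * nat f" by (simp only: of_nat_eq_iff)
    moreover have "hkey r b + nat e \<in> set (marks 1 r B)" using ab e by (auto simp: marks_def)
    moreover have "hkey r (a + b) + 2 ^ (L - 1) * nat f \<in> set (marks (2 ^ (L - 1)) r C)"
      using ab f by (auto simp: marks_def)
    moreover have "hkey r a \<in> set (a_marks r A)" using ab by (simp add: a_marks_def)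
    ultimately show "\<exists>x\<in>set (marks 1 r B). \<exists>y\<in>set (a_marks r A). x + y \<in> set (marks (2 ^ (L - 1)) r C)"
      by (metis (no_types))
  qed
  finally show ?thesis by simp
qed

text \<open>The lower constant is met since \<open>n\<close> passes the size test. For the upper
  one, \<open>n - 1\<close> fails it, so \<open>n - 1 \<le> \<beta> * N powr (1/4)\<close>, and the
  missing \<open>1\<close> fits into the gap \<open>c2 - \<beta>\<close> because
  \<open>N \<ge> 2 ^ c0\<close>.\<close>

lemma reduced_instance:
  assumes red: "reduced r A B C S T" and len: "length A = m" and \<Sigma>: "{0, 1} \<subseteq> \<Sigma>"
    and c: "0 < c1" "c1 ^ 4 * real D \<le> real P" "real P \<le> \<beta> ^ 4 * real D" "0 < \<beta>" "\<beta> < c2"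
      "(1 / (c2 - \<beta>)) ^ 4 \<le> 2 ^ c0"
  shows "(S, T) \<in> ip_instances \<Sigma> c1 c2" "ip_size (S, T) = n" "ip_dim (S, T) = N"
proof -
  have lenS: "length (slp_string S) = N" "length (slp_string T) = N"
    using red len by (simp_all add: reduced_def length_block_string length_marks vec_len_def)
  show "ip_size (S, T) = n" "ip_dim (S, T) = N" using red lenS by (simp_all add: reduced_def)
  have slp: "is_slp \<Sigma> S" "is_slp \<Sigma> T"
    using red \<Sigma> unfolding reduced_def is_slp_def by (auto split: rule.splits)
  have D: "0 < real D" using pos by simp
  have "real (P * N) \<le> real (D * n ^ 4)" using slp_size[OF pos(4), of P N] by (simp only: of_nat_le_iff)
  then have PN: "real P * real N \<le> real D * real n ^ 4" by simp
  have "real D * (c1 ^ 4 * real N) \<le> real P * real N"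
    using mult_right_mono[OF c(2), of "real N"] by (simp add: mult_ac)
  with PN have "real D * (c1 ^ 4 * real N) \<le> real D * real n ^ 4" by linarith
  then have low: "c1 * real N powr (1/4) \<le> real n" using root4_bounds(1)[of c1 "real N" "real n"] c D by simp
  have n1: "1 \<le> n" using room by linarith
  have "real (D * (n - 1) ^ 4) \<le> real (P * N)"
    using less_slp_size[of "n - 1" P D N] n1 by (simp only: of_nat_le_iff) simp
  then have "real D * real (n - 1) ^ 4 \<le> real P * real N" by simp
  also have "\<dots> \<le> real D * (\<beta> ^ 4 * real N)"
    using mult_right_mono[OF c(3), of "real N"] by (simp add: mult_ac)
  finally have "real (n - 1) \<le> \<beta> * real N powr (1/4)"
    using root4_bounds(2)[of \<beta> "real N" "real (n - 1)"] c D by simp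
  moreover have "1 \<le> (c2 - \<beta>) * real N powr (1/4)"
  proof -
    have "1 * 2 ^ c0 \<le> m * 2 ^ L" using pos by (intro mult_mono power_increasing) (auto simp: depth_def)
    also have "\<dots> \<le> N" by (rule vec_len_ge)
    finally have "real (2 ^ c0) \<le> real N" by (simp only: of_nat_le_iff mult_1)
    moreover have "real (2 ^ c0) = 2 ^ c0" by simp
    ultimately have "(1 / (c2 - \<beta>)) ^ 4 \<le> real N" using c(6) by linarith
    then have "1 ^ 4 \<le> (c2 - \<beta>) ^ 4 * real N" using c(5) by (simp add: power_divide field_simps)
    then show ?thesis using root4_bounds(2)[of "c2 - \<beta>" "real N" 1] c(5) by simp
  qed
  ultimately have "real n \<le> c2 * real N powr (1/4)" using n1 by (simp add: algebra_simps of_nat_diff)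
  with low slp lenS show "(S, T) \<in> ip_instances \<Sigma> c1 c2"
    using red by (simp add: ip_instances_def reduced_def)
qed

lemma reduction_correct:
  fixes Bd \<delta> :: real
  assumes inst: "(U, A, B, C) \<in> three_sum_instances" "length A = m" and \<Sigma>: "{0, 1} \<subseteq> \<Sigma>"
    and c: "0 < c1" "c1 ^ 4 * real D \<le> real P" "real P \<le> \<beta> ^ 4 * real D" "0 < \<beta>" "\<beta> < c2"
      "(1 / (c2 - \<beta>)) ^ 4 \<le> 2 ^ c0"
    and p: "\<And>x. x \<in> ip_instances \<Sigma> c1 c2 \<Longrightarrow> ip_size x = n \<Longrightarrow> ip_dim x = N \<Longrightarrow>
      halts_within T3 p (ip_input x) \<and> words_bounded Bd p (ip_input x) \<and>
      success_prob T3 p (ip_input x) (ip_answer x) \<ge> 1 - \<delta>"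
    and Bd: "real_of_int M \<le> Bd" and \<delta>: "0 \<le> \<delta>" and T: "131 * n + T3 \<le> T"
  defines "prog \<equiv> head_prog @ [Rand 5 6] @ tail_prog @ p @ sign_prog"
  shows "halts_within T prog (three_sum_input (U, A, B, C))"
    "words_bounded Bd prog (three_sum_input (U, A, B, C))"
    "success_prob T prog (three_sum_input (U, A, B, C)) (three_sum_answer (U, A, B, C)) \<ge>
       1 - \<delta> - 10 * real m ^ 3 / 2 ^ (L - 1)"
proof -
  have len: "length A = m" "length B = m" "length C = m"
    and sub: "set A \<subseteq> {1..U}" "set B \<subseteq> {1..U}" "set C \<subseteq> {1..U}"
    using inst by (auto simp: three_sum_instances_def)
  define s0 where "s0 = three_sum_input (U, A, B, C)"
  define good where "good r s \<longleftrightarrow> (\<exists>S T. reduced r A B C S T \<and> s = ip_input (S, T))" for r s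
  have bounded: "bounded_by M s0"
  proof -
    have "0 \<le> x \<and> x \<le> int U" if "x \<in> set (map int A) \<union> set (map int B) \<union> set (map int C)" for x
      using that sub by auto
    then have arr: "\<bar>array_of_list xs i\<bar> \<le> M" if "set xs \<subseteq> set (map int A) \<union> set (map int B) \<union> set (map int C)" for xs i
    proof (cases "0 \<le> i \<and> i < int (length xs)")
      case True
      then have "xs ! nat i \<in> set xs" by (intro nth_mem) auto
      with that \<open>\<And>x. x \<in> set (map int A) \<union> set (map int B) \<union> set (map int C) \<Longrightarrow> 0 \<le> x \<and> x \<le> int U\<close>
      have "0 \<le> xs ! nat i \<and> xs ! nat i \<le> int U" by blast
      with True M_ge show ?thesis by (simp add: array_of_list_def)
    qed (use M_ge in \<open>auto simp: array_of_list_def\<close>)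
    have "\<bar>array_of_list (map int A) i\<bar> \<le> M" "\<bar>array_of_list (map int B) i\<bar> \<le> M"
      "\<bar>array_of_list (map int C) i\<bar> \<le> M" for i
      by (rule arr, auto)+
    then show ?thesis
      using M_ge len unfolding s0_def bounded_by_def
      by (auto simp: initial_state_def less_Suc_eq numeral_2_eq_2 numeral_3_eq_3)
  qed
  have len': "l \<le> n" "m \<le> n" "1 \<le> n"
    using l_le B1.room'(1,2) by linarith+
  have head: "wp M head_prog (4 * l + 6 * n + 26) (ready (arrs s0)) s0"
    unfolding s0_def by (rule wp_head[OF len(1)])
  have tail: "wp M tail_prog (28 * m + 40 * n + 24) (good r) (set_reg 5 r s)"
    if "ready (arrs s0) s" "r \<in> {0..<int U * R}" for s r
    unfolding good_def
    by (rule wp_tail[OF _ _ _ _ len sub]) (use that in \<open>auto simp: keys_def ready_def base_def s0_def\<close>)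
  have p': "halts_within T3 p s \<and> words_bounded Bd p s \<and>
      (\<exists>v. success_prob T3 p s v \<ge> 1 - \<delta> \<and>
        (r \<notin> bad_keys A B C \<longrightarrow> (if v > 0 then 1 else 0) = three_sum_answer (U, A, B, C)))"
    if r: "r \<in> {0..<int U * R}" and g: "good r s" for r s
  proof -
    from g obtain S T' where ST: "reduced r A B C S T'" "s = ip_input (S, T')" unfolding good_def by blast
    from p[OF reduced_instance[OF ST(1) len(1) \<Sigma> c]] reduced_answer[OF ST(1) len(1) r] ST(2)
    show ?thesis by blast
  qed
  \<comment> \<open>The overhead is \<open>4 * l + 46 * n + 28 * m + 53\<close>, and
    \<open>4 + 46 + 28 + 53 = 131\<close>.\<close>
  have T': "4 * l + 6 * n + 26 + 1 + (28 * m + 40 * n + 24) + (T3 + 2) \<le> T"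
    using T len' by linarith
  have Q: "0 < int U * R" "int U * R \<le> M" using U_pos M_ge by simp_all
  have Bd1: "1 \<le> Bd" using M(1) Bd by linarith
  note main = randomized_reduction[OF head bounded Q _ tail p' Bd Bd1 T' bad_keys_subset \<delta>]
  have r6: "ready (arrs s0) s \<Longrightarrow> regs s 6 = int U * R" for s by (simp add: ready_def)
  show "halts_within T prog (three_sum_input (U, A, B, C))"
    "words_bounded Bd prog (three_sum_input (U, A, B, C))"
    unfolding prog_def s0_def[symmetric] using main(1,2) r6 by blast+
  have "real (card (bad_keys A B C)) \<le> real (m * (m * (m * (10 * U))))"
    using card_bad_keys[OF len sub] by (simp only: of_nat_le_iff)
  then have "real (card (bad_keys A B C)) / real_of_int (int U * R) \<le> real (m * (m * (m * (10 * U)))) / real_of_int (int U * R)"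
    using Q by (intro divide_right_mono) auto
  also have "\<dots> = 10 * real m ^ 3 / 2 ^ (L - 1)" using U_pos by (simp add: power3_eq_cube)
  finally show "success_prob T prog (three_sum_input (U, A, B, C)) (three_sum_answer (U, A, B, C)) \<ge>
       1 - \<delta> - 10 * real m ^ 3 / 2 ^ (L - 1)"
    unfolding prog_def s0_def[symmetric] using main(3) r6 by fastforce
qed

end

section \<open>The lower bound\<close>

lemma words_bounded_mono: "words_bounded B p s \<Longrightarrow> B \<le> B' \<Longrightarrow> words_bounded B' p s"
  unfolding words_bounded_def by (meson order_trans)

lemma vec_len_le_power:
  assumes "0 < m" "m \<le> U"
  shows "vec_len k c0 m \<le> 64 * 2 ^ c0 * U ^ 5"
proof -
  have "vec_len k c0 m \<le> 4 * m * 2 ^ depth k c0 m" by (rule vec_len_le[OF assms(1)])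
  also have "\<dots> \<le> 4 * m * (16 * 2 ^ c0 * m ^ 4)"
    by (rule mult_le_mono2[OF power_depth_le[OF assms(1)]])
  also have "\<dots> = 64 * 2 ^ c0 * m ^ 5" using power_Suc[of m 4] by (simp del: power_Suc)
  also have "\<dots> \<le> 64 * 2 ^ c0 * U ^ 5" using assms(2) by (intro mult_le_mono2 power_mono) auto
  finally show ?thesis .
qed

text \<open>The power \<open>U ^ 6\<close> comes from the product \<open>U * (U * R)\<close> with
  \<open>R\<close> at most of order \<open>U ^ 4\<close>; the coefficients \<open>1024\<close> and
  \<open>16\<close> come from \<open>D * n ^ 4 \<le> 16 * (P * N + D)\<close> and
  \<open>P * N \<le> 64 * P * 2 ^ c0 * U ^ 6\<close>.\<close>

lemma reduction_params:
  assumes pos: "0 < k" "1 < c0" "0 < P" "0 < D" "0 < m" "m \<le> U"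
    and c0: "\<And>x. c0 \<le> x \<Longrightarrow> 256 * D * (3 * k + 1) ^ 4 * (x + 1) ^ 4 < P * 2 ^ x"
  shows "reduction k c0 P D m U (int ((1024 * P * 2 ^ c0 + 16 * D + k + c0 + 3) * U ^ 6))"
proof -
  define Mn where "Mn = (1024 * P * 2 ^ c0 + 16 * D + k + c0 + 3) * U ^ 6"
  define L N n where "L = depth k c0 m" and "N = vec_len k c0 m" and "n = slp_size P D (vec_len k c0 m)"
  have U6: "1 \<le> U ^ 6" using pos by simp
  have U5: "U ^ 5 \<le> U ^ 6" "U ^ 4 \<le> U ^ 6" using pos by (intro power_increasing; simp)+
  define X Y Z where "X = P * 2 ^ c0 * U ^ 6" and "Y = D * U ^ 6" and "Z = 2 ^ c0 * U ^ 6"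
  have M: "Mn = 1024 * X + 16 * Y + k * U ^ 6 + c0 * U ^ 6 + 3 * U ^ 6"
    by (simp add: Mn_def X_def Y_def algebra_simps)
  have le: "D \<le> Y" "k \<le> k * U ^ 6" "c0 \<le> c0 * U ^ 6"
    using U6 by (simp_all add: Y_def)
  have "1 * 1 \<le> 2 ^ c0 * U ^ 6" using U6 by (intro mult_le_mono) auto
  then have "P * 1 \<le> P * (2 ^ c0 * U ^ 6)" by (intro mult_le_mono2) simp
  then have PX: "P \<le> X" by (simp only: X_def mult.assoc mult_1_right)
  have "1 * (2 ^ c0 * U ^ 6) \<le> P * (2 ^ c0 * U ^ 6)" using pos by (intro mult_le_mono1) simp
  then have ZX: "Z \<le> X" by (simp only: X_def Z_def mult.assoc mult_1_left)
  have "2 ^ L \<le> 16 * 2 ^ c0 * m ^ 4" unfolding L_def by (rule power_depth_le[OF pos(5)])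
  also have m4: "\<dots> \<le> 16 * 2 ^ c0 * U ^ 4" using pos(6) by (intro mult_le_mono2 power_mono) auto
  finally have 2: "2 ^ L \<le> 16 * 2 ^ c0 * U ^ 4" .
  also have "\<dots> \<le> 16 * 2 ^ c0 * U ^ 6" by (rule mult_le_mono2[OF U5(2)])
  finally have "2 ^ L \<le> 16 * Z" by (simp only: Z_def mult.assoc)
  then have L1: "2 ^ Suc L \<le> 32 * Z" by simp
  have "(2::nat) ^ (L - 1) \<le> 2 ^ L" by (intro power_increasing) auto
  then have "U * (U * 2 ^ (L - 1)) \<le> U * (U * (16 * 2 ^ c0 * U ^ 4))" using 2 by (intro mult_le_mono2) linarith
  also have "\<dots> = 16 * Z" using power_Suc[of U 4] power_Suc[of U 5] by (simp add: Z_def del: power_Suc)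
  finally have UUR: "U * (U * 2 ^ (L - 1)) \<le> 16 * Z" .
  have "P * N \<le> P * (64 * 2 ^ c0 * U ^ 5)" unfolding N_def by (rule mult_le_mono2[OF vec_len_le_power[OF pos(5,6)]])
  also have "\<dots> \<le> P * (64 * 2 ^ c0 * U ^ 6)" by (intro mult_le_mono2 U5)
  finally have PN: "P * N \<le> 64 * X" by (simp only: X_def mult_ac)
  have "D * n ^ 4 \<le> 16 * (P * N + D)" unfolding n_def N_def by (rule slp_size_le)
  also have "\<dots> \<le> 16 * (64 * X + Y)" by (intro mult_le_mono2 add_mono PN le)
  finally have Dn: "D * n ^ 4 \<le> 1024 * X + 16 * Y" by simp
  have "n ^ 1 \<le> n ^ 4" by (cases "n = 0") (simp, intro power_increasing, auto)
  also have "1 * n ^ 4 \<le> D * n ^ 4" using pos by (intro mult_le_mono1) simp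
  finally have nD: "n \<le> D * n ^ 4" by simp
  have Mle: "3 \<le> Mn" "k \<le> Mn" "c0 \<le> Mn" "D \<le> Mn" "n < Mn" "P \<le> Mn" "2 ^ Suc L \<le> Mn"
    "U * (U * 2 ^ (L - 1)) \<le> Mn" "P * N \<le> Mn" "D * n ^ 4 \<le> Mn"
    using M U6 le PX ZX L1 UUR PN Dn nD by linarith+
  have "int (2 ^ Suc L) \<le> int Mn" "int (U * (U * 2 ^ (L - 1))) \<le> int Mn"
    using Mle(7,8) by (simp_all only: of_nat_le_iff)
  moreover have "int (2 ^ Suc L) = 2 ^ Suc L" "int (U * (U * 2 ^ (L - 1))) = int U * (int U * 2 ^ (L - 1))"
    by simp_all
  ultimately have Mint: "2 ^ Suc L \<le> int Mn" "int U * (int U * 2 ^ (L - 1)) \<le> int Mn" by simp_all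
  have "3 \<le> int Mn" using Mle(1) by simp
  moreover have "int k \<le> int Mn" "int c0 \<le> int Mn" "int P \<le> int Mn" "int D \<le> int Mn" "int n < int Mn"
    "int (P * N) \<le> int Mn" "int (D * n ^ 4) \<le> int Mn"
    using Mle by (simp_all only: of_nat_le_iff of_nat_less_iff)
  ultimately show ?thesis
    using pos room[OF pos(1,4,5) c0] Mint
    unfolding Mn_def L_def N_def n_def
    by unfold_locales
qed

theorem theorem1:
  fixes \<Sigma> :: "int set" and c1 c2 \<epsilon> :: real
  assumes "three_sum_conjecture"
    and "finite \<Sigma>" and "{0, 1} \<subseteq> \<Sigma>"
    and "0 < c1" and "c1 < c2"
    and "\<epsilon> > 0"
  shows "\<not> solvable_in_time (ip_instances \<Sigma> c1 c2) ip_size ip_dim ip_input ip_answer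
           (\<lambda>n. real n powr (2 - \<epsilon>))"
proof
  assume "solvable_in_time (ip_instances \<Sigma> c1 c2) ip_size ip_dim ip_input ip_answer
           (\<lambda>n. real n powr (2 - \<epsilon>))"
  then obtain p K d c where "c > 0" and p: "\<And>x. x \<in> ip_instances \<Sigma> c1 c2 \<Longrightarrow>
      halts_within (nat \<lfloor>K * real (ip_size x) powr (2 - \<epsilon>)\<rfloor>) p (ip_input x) \<and>
      words_bounded (K * real (ip_dim x) ^ d) p (ip_input x) \<and>
      success_prob (nat \<lfloor>K * real (ip_size x) powr (2 - \<epsilon>)\<rfloor>) p (ip_input x) (ip_answer x)
        \<ge> 1 - K * real (ip_size x) powr (- c)"
    unfolding solvable_in_time_def Let_def by blast
  \<comment> \<open>For \<open>\<epsilon> > 1\<close> the assumed time could drop below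
    \<open>n\<close>, the cost of writing the rules; \<open>e \<le> 1\<close> keeps
    \<open>n \<le> n powr (2 - e)\<close>.\<close>
  define e where "e = min \<epsilon> 1"
  have e: "0 < e" "e \<le> 1" "e \<le> \<epsilon>" using assms(6) by (auto simp: e_def)
  define k where "k = nat \<lceil>1 / e\<rceil>"
  have "1 / e \<le> real k" unfolding k_def by (rule real_nat_ceiling_ge)
  moreover have "1 \<le> 1 / e" using e by simp
  ultimately have "0 < k" "1 / e \<le> real k" by auto
  then have k: "0 < k" "1 / real k \<le> e" using e by (auto simp: field_simps)
  define \<beta> where "\<beta> = (c1 + c2) / 2"
  have \<beta>: "0 < \<beta>" "c1 < \<beta>" "\<beta> < c2" using assms(4,5) by (auto simp: \<beta>_def)
  have "c1 ^ 4 < \<beta> ^ 4" using \<beta> assms(4) by (intro power_strict_mono) auto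
  then obtain q where q: "q \<in> \<rat>" "c1 ^ 4 < q" "q < \<beta> ^ 4" using Rats_dense_in_real by blast
  have "0 < c1 ^ 4" using assms(4) by simp
  with q have q0: "0 < q" by linarith
  obtain P D where "D \<noteq> 0" and PD: "\<bar>q\<bar> = real P / real D" using Rats_abs_nat_div_natE[OF q(1)] by metis
  have D: "0 < D" using \<open>D \<noteq> 0\<close> by simp
  have P: "0 < P" using PD q0 by (intro gr0I) auto
  have cP: "c1 ^ 4 * real D \<le> real P" "real P \<le> \<beta> ^ 4 * real D"
  proof -
    have "real P = q * real D" using PD q0 D by (simp add: field_simps)
    then show "c1 ^ 4 * real D \<le> real P" "real P \<le> \<beta> ^ 4 * real D"
      using q by (simp_all add: mult_right_mono)
  qed
  \<comment> \<open>From the threshold \<open>x0\<close> on, \<open>2 ^ x\<close> exceeds both the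
    quartic polynomial that occurs in \<open>room\<close> and the constant that the rounding of
    \<open>n\<close> requires; adding \<open>2\<close> ensures \<open>1 < c0\<close>.\<close>
  have "eventually (\<lambda>x. 256 * real D * (3 * real k + 1) ^ 4 * (real x + 1) ^ 4 < 2 ^ x) sequentially"
    by real_asymp
  moreover have "eventually (\<lambda>x. (1 / (c2 - \<beta>)) ^ 4 \<le> (2::real) ^ x) sequentially"
    by real_asymp
  ultimately have "eventually (\<lambda>x. 256 * real D * (3 * real k + 1) ^ 4 * (real x + 1) ^ 4 < 2 ^ x \<and>
      (1 / (c2 - \<beta>)) ^ 4 \<le> (2::real) ^ x) sequentially"
    by (rule eventually_conj)
  then obtain x0 where x0: "\<And>x. x0 \<le> x \<Longrightarrow> 256 * real D * (3 * real k + 1) ^ 4 * (real x + 1) ^ 4 < 2 ^ x"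
    "(1 / (c2 - \<beta>)) ^ 4 \<le> (2::real) ^ x0" unfolding eventually_sequentially by blast
  define c0 where "c0 = x0 + 2"
  have "256 * D * (3 * k + 1) ^ 4 * (x + 1) ^ 4 < 2 ^ x" if "c0 \<le> x" for x
  proof -
    have "real (256 * D * (3 * k + 1) ^ 4 * (x + 1) ^ 4) < real (2 ^ x)"
      using x0(1)[of x] that by (simp add: c0_def add.commute)
    then show ?thesis unfolding of_nat_less_iff .
  qed
  moreover have "2 ^ x \<le> P * 2 ^ x" for x using P by simp
  ultimately have c0: "256 * D * (3 * k + 1) ^ 4 * (x + 1) ^ 4 < P * 2 ^ x" if "c0 \<le> x" for x
    using that by (meson less_le_trans)
  have "(2::real) ^ x0 \<le> 2 ^ c0" by (intro power_increasing) (auto simp: c0_def)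
  with x0(2) have c2: "(1 / (c2 - \<beta>)) ^ 4 \<le> (2::real) ^ c0" by linarith
  have c01: "1 < c0" by (simp add: c0_def)
  define K1 where "K1 = \<bar>K\<bar>"
  have K1: "0 \<le> K1" "K \<le> K1" by (auto simp: K1_def)
  define Cm where "Cm = 1024 * P * 2 ^ c0 + 16 * D + k + c0 + 3"
  define Cn where "Cn = 3000 * real P * 2 ^ c0"
  define Cw where "Cw = real Cm + K1 * (64 * 2 ^ c0) ^ d"
  define Ct where "Ct = (131 + K1) * Cn ^ 2"
  define K' where "K' = Cw + Ct + K1 + 10"
  have C0: "0 \<le> Cw" "0 \<le> Ct" using K1 by (auto simp: Cw_def Ct_def)
  have "1 * 1 \<le> 3000 * real P" "(1::real) \<le> 2 ^ c0" using P by auto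
  then have "1 * 1 \<le> Cn" unfolding Cn_def by (intro mult_mono) auto
  then have Cn1: "1 \<le> Cn" by simp
  \<comment> \<open>\<open>m powr (- c)\<close> belongs to the error of the given algorithm,
    \<open>m powr (- (1 / k))\<close> to that of the hashing; the slower decay prevails.\<close>
  define c' where "c' = min c (1 / real k)"
  have c': "0 < c'" "c' \<le> c" "c' \<le> 1 / real k" using \<open>c > 0\<close> k by (auto simp: c'_def)
  \<comment> \<open>\<open>head_prog\<close> depends on \<open>k\<close>, \<open>c0\<close>,
    \<open>P\<close> and \<open>D\<close> only and \<open>tail_prog\<close> on no parameter, so one
    program serves all instances.\<close>
  define prog where "prog = reduction.head_prog k c0 P D @ [Rand 5 6] @ reduction.tail_prog @ p @ sign_prog"
  have "solvable_in_time three_sum_instances three_sum_size three_sum_universe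
        three_sum_input three_sum_answer (\<lambda>m. real m powr (2 - e / 2))"
    unfolding solvable_in_time_def Let_def
  \<comment> \<open>The exponent \<open>5 * d + 6\<close> covers \<open>N ^ d\<close>, with
    \<open>N\<close> at most of order \<open>U ^ 5\<close>, as well as the \<open>U ^ 6\<close> of
    the reduction itself.\<close>
  proof (rule exI[of _ prog], rule exI[of _ K'], rule exI[of _ "5 * d + 6"], rule exI[of _ c'], intro conjI ballI)
    show "0 < c'" by (rule c'(1))
    fix x assume x: "x \<in> three_sum_instances"
    obtain U A B C where xe: "x = (U, A, B, C)" by (cases x) auto
    define m where "m = length A"
    have A: "set A \<subseteq> {1..U}" "distinct A" "A \<noteq> []" using x by (auto simp: xe three_sum_instances_def)
    have m0: "0 < m" using A by (simp add: m_def)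
    have "card (set A) \<le> card {1..U}" using A by (intro card_mono) auto
    then have mU: "m \<le> U" using A by (simp add: m_def distinct_card)
    interpret red: reduction k c0 P D m U "int (Cm * U ^ 6)"
      unfolding Cm_def by (rule reduction_params[OF k(1) c01 P D m0 mU c0])
    define n N where "n = slp_size P D (vec_len k c0 m)" and "N = vec_len k c0 m"
    have mn: "m \<le> n" "1 \<le> n" using red.B1.room'(1,2) by (simp_all add: n_def)
    define T3 where "T3 = nat \<lfloor>K * real n powr (2 - \<epsilon>)\<rfloor>"
    define \<delta> where "\<delta> = K1 * real n powr (- c)"
    define Bd where "Bd = K' * real U ^ (5 * d + 6)"
    define T where "T = nat \<lfloor>K' * real m powr (2 - e / 2)\<rfloor>"
    have U1: "1 \<le> real U" using m0 mU by simp
    have Bd1: "real_of_int (int (Cm * U ^ 6)) \<le> Bd"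
    proof -
      have "real_of_int (int (Cm * U ^ 6)) = real Cm * real U ^ 6" by simp
      also have "\<dots> \<le> K' * real U ^ (5 * d + 6)"
        using U1 C0 K1 by (intro mult_mono power_increasing) (auto simp: K'_def Cw_def)
      finally show ?thesis by (simp add: Bd_def)
    qed
    have Bd2: "K * real N ^ d \<le> Bd"
    proof -
      have "real N \<le> real (64 * 2 ^ c0 * U ^ 5)"
        using vec_len_le_power[OF m0 mU, of k c0] unfolding N_def by (simp only: of_nat_le_iff)
      then have "real N \<le> (64 * 2 ^ c0) * real U ^ 5" by simp
      then have "K * real N ^ d \<le> K1 * ((64 * 2 ^ c0) * real U ^ 5) ^ d"
        using K1 by (intro mult_mono power_mono) auto
      also have "\<dots> = (K1 * (64 * 2 ^ c0) ^ d) * real U ^ (5 * d)" by (simp add: power_mult_distrib power_mult)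
      also have "\<dots> \<le> K' * real U ^ (5 * d + 6)"
        using U1 C0 K1 by (intro mult_mono power_increasing) (auto simp: K'_def Cw_def)
      finally show ?thesis by (simp add: Bd_def)
    qed
    have pn: "halts_within T3 p (ip_input x) \<and> words_bounded Bd p (ip_input x) \<and>
      success_prob T3 p (ip_input x) (ip_answer x) \<ge> 1 - \<delta>"
      if "x \<in> ip_instances \<Sigma> c1 c2" "ip_size x = n" "ip_dim x = N" for x
    proof -
      have "K * real n powr (- c) \<le> \<delta>" unfolding \<delta>_def using K1 by (intro mult_right_mono) auto
      with p[OF that(1)] words_bounded_mono[OF _ Bd2] show ?thesis
        unfolding that T3_def by fastforce
    qed
    have n_le: "real n \<le> Cn * real m powr (1 + 1 / (4 * real k))"
      unfolding n_def by (rule slp_size_powr_le[OF m0 k(1) P D Cn_def])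
    have T: "131 * n + T3 \<le> T"
    proof -
      have n1: "1 \<le> real n" using mn by simp
      have "real n powr (2 - \<epsilon>) \<le> real n powr (2 - e)" using n1 e by (intro powr_mono) auto
      then have "K * real n powr (2 - \<epsilon>) \<le> K1 * real n powr (2 - e)" using K1 by (intro mult_mono) auto
      moreover have "0 \<le> K1 * real n powr (2 - e)" using K1 by simp
      ultimately have T3: "real T3 \<le> K1 * real n powr (2 - e)" unfolding T3_def by linarith
      have "real n powr 1 \<le> real n powr (2 - e)" using n1 e by (intro powr_mono) auto
      with T3 have "real (131 * n + T3) \<le> (131 + K1) * real n powr (2 - e)" using n1 by (simp add: algebra_simps)
      also have "real n powr (2 - e) \<le> (Cn * real m powr (1 + 1 / (4 * real k))) powr (2 - e)"
        using n_le e by (intro powr_mono2) auto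
      also have "\<dots> = Cn powr (2 - e) * real m powr ((1 + 1 / (4 * real k)) * (2 - e))"
        using Cn1 by (simp add: powr_mult powr_powr)
      also have "\<dots> \<le> Cn powr 2 * real m powr (2 - e / 2)"
      proof (intro mult_mono powr_mono)
        \<comment> \<open>The excess \<open>1 / (4 * k)\<close> in the exponent of the size costs at
          most \<open>e / 2\<close>, half of what is saved.\<close>
        have "(1 / (4 * real k)) * (2 - e) \<le> (e / 4) * 2" using k e by (intro mult_mono) auto
        then show "(1 + 1 / (4 * real k)) * (2 - e) \<le> 2 - e / 2" by (simp add: algebra_simps)
      qed (use Cn1 e m0 in auto)
      finally have "real (131 * n + T3) \<le> (131 + K1) * (Cn powr 2 * real m powr (2 - e / 2))"
        using K1 by (simp add: mult_left_mono)
      also have "\<dots> = Ct * real m powr (2 - e / 2)" using Cn1 by (simp add: Ct_def powr_numeral)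
      also have "\<dots> \<le> K' * real m powr (2 - e / 2)" using C0 K1 by (intro mult_right_mono) (auto simp: K'_def)
      finally show ?thesis unfolding T_def by (rule le_nat_floor)
    qed
    have \<delta>0: "0 \<le> \<delta>" using K1 by (simp add: \<delta>_def)
    have inst: "(U, A, B, C) \<in> three_sum_instances" using x by (simp add: xe)
    note main = red.reduction_correct[OF inst m_def[symmetric] assms(3,4) cP \<beta>(1,3) c2
        pn[unfolded n_def N_def] Bd1 \<delta>0 T[unfolded n_def], folded prog_def]
    show "halts_within (nat \<lfloor>K' * real (three_sum_size x) powr (2 - e / 2)\<rfloor>) prog (three_sum_input x)"
      unfolding xe three_sum_size.simps m_def[symmetric] T_def[symmetric] by (rule main(1))
    show "words_bounded (K' * real (three_sum_universe x) ^ (5 * d + 6)) prog (three_sum_input x)"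
      unfolding xe three_sum_universe.simps Bd_def[symmetric] by (rule main(2))
    \<comment> \<open>The given error bound refers to the size \<open>n\<close> of the constructed
      instance; \<open>m \<le> n\<close> carries it over to \<open>m\<close>.\<close>
    have "\<delta> \<le> K1 * real m powr (- c)" unfolding \<delta>_def
      using mn m0 \<open>c > 0\<close> K1 by (intro mult_left_mono powr_mono2') auto
    also have "\<dots> \<le> K1 * real m powr (- c')" using m0 c' K1 by (intro mult_left_mono powr_mono) auto
    finally have 1: "\<delta> \<le> K1 * real m powr (- c')" .
    have "10 * real m ^ 3 / 2 ^ (depth k c0 m - 1) \<le> 10 * real m ^ 3 / real m powr (3 + 1 / real k)"
      using power_depth_powr_ge[OF m0 k(1) c01] m0 by (intro divide_left_mono) auto
    also have "\<dots> = 10 * real m powr (- (1 / real k))"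
    proof -
      have "real m powr (3 + 1 / real k) = real m ^ 3 * real m powr (1 / real k)"
        using m0 by (simp only: powr_add) (simp add: powr_numeral)
      then show ?thesis using m0 by (simp add: powr_minus divide_inverse)
    qed
    also have "\<dots> \<le> 10 * real m powr (- c')" using m0 c' by (intro mult_left_mono powr_mono) auto
    finally have 2: "10 * real m ^ 3 / 2 ^ (depth k c0 m - 1) \<le> 10 * real m powr (- c')" .
    have "K1 * real m powr (- c') + 10 * real m powr (- c') \<le> K' * real m powr (- c')"
      unfolding distrib_right[symmetric] using C0 by (intro mult_right_mono) (auto simp: K'_def)
    with 1 2 main(3) have "1 - K' * real m powr (- c') \<le> success_prob T prog (three_sum_input (U, A, B, C)) (three_sum_answer (U, A, B, C))"
      by linarith
    then show "1 - K' * real (three_sum_size x) powr (- c') \<le>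
        success_prob (nat \<lfloor>K' * real (three_sum_size x) powr (2 - e / 2)\<rfloor>) prog (three_sum_input x) (three_sum_answer x)"
      unfolding xe three_sum_size.simps m_def[symmetric] T_def[symmetric] .
  qed
  with assms(1) e(1) show False unfolding three_sum_conjecture_def by (metis half_gt_zero)
qed

end
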